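(* $\mathrm{Rel}(\textsc{Hamiltonian Cycle}, \mathrm{dist}_E, n/3)$ is in FP.
   Context: For a problem $\Pi$, a metric $\mathrm{dist}$ on its inputs, and a non-decreasing function $d:\mathbb N\to\mathbb R_+\cup\{\infty\}$, the function problem $\mathrm{Rel}(\Pi,\mathrm{dist},d)$ is: given an input $I$ of $\Pi$, output a pair $(J,\Pi(J))$ where $J$ is an input of $\Pi$ with $\mathrm{dist}(I,J)\le d(|I|)$ and $\Pi(J)$ is a correct answer to $\Pi$ on $J$ (a correct solution on $J$, or the symbol $\mathrm{nil}$ if none exists). For graph problems $|I|$ is the number of vertices $n$ of the input graph, and writing $n/3$ as third argument means the function $n\mapsto n/3$. For graphs $G,H$: $\mathrm{dist}_E(G,H)=|E(G)\triangle E(H)|$ if $V(G)=V(H)$ and $\infty$ otherwise. \textsc{Hamiltonian Cycle}: given a graph $G$, output a Hamiltonian cycle of $G$, or $\mathrm{nil}$ if $G$ is not Hamiltonian. FP is the class of function problems solvable in polynomial time. *)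

theory Defs
  imports "HOL-Library.Extended_Nonnegative_Real" "HOL-Computational_Algebra.Polynomial"
begin

section \<open>Function problems and their relaxations\<close>

text \<open>
  The correct answers on an instance are what an algorithm is allowed to output; for a search
  problem this includes the symbol nil (here \<open>None\<close>) on instances without a solution.
\<close>

record ('i, 'o) problem =
  inputs :: "'i set"
  answers :: "'i \<Rightarrow> 'o set"
  isize :: "'i \<Rightarrow> nat"

definition or_nil :: "'s set \<Rightarrow> 's option set" where
  "or_nil S = (if S = {} then {None} else Some ` S)"

definition Rel ::
  "('i, 'o) problem \<Rightarrow> ('i \<Rightarrow> 'i \<Rightarrow> ennreal) \<Rightarrow> (nat \<Rightarrow> ennreal) \<Rightarrow> ('i, 'i \<times> 'o) problem" where
  "Rel P \<delta> d =
    \<lparr> inputs = inputs P,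
      answers = (\<lambda>I. {(J, a). J \<in> inputs P \<and> \<delta> I J \<le> d (isize P I) \<and> a \<in> answers P J}),
      isize = isize P \<rparr>"


section \<open>Graphs and Hamiltonian cycles\<close>

record 'v graph =
  verts :: "'v set"
  edges :: "'v set set"

definition simple_graph :: "'v graph \<Rightarrow> bool" where
  "simple_graph G \<longleftrightarrow> finite (verts G) \<and>
    (\<forall>e \<in> edges G. \<exists>u v. e = {u, v} \<and> u \<noteq> v \<and> u \<in> verts G \<and> v \<in> verts G)"

definition dist_E :: "'v graph \<Rightarrow> 'v graph \<Rightarrow> ennreal" where
  "dist_E G H =
    (if verts G = verts H then of_nat (card (sym_diff (edges G) (edges H))) else \<infinity>)"

text \<open>A cycle is given by listing its vertices in cyclic order; it has at least three of them.\<close>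

definition hamiltonian_cycle :: "'v graph \<Rightarrow> 'v list \<Rightarrow> bool" where
  "hamiltonian_cycle G c \<longleftrightarrow>
    distinct c \<and> set c = verts G \<and> 3 \<le> length c \<and>
    (\<forall>i < length c. {c ! i, c ! (Suc i mod length c)} \<in> edges G)"

definition Hamiltonian_Cycle :: "('v graph, 'v list option) problem" where
  "Hamiltonian_Cycle =
    \<lparr> inputs = {G. simple_graph G},
      answers = (\<lambda>G. or_nil {c. hamiltonian_cycle G c}),
      isize = (\<lambda>G. card (verts G)) \<rparr>"


section \<open>Deterministic multitape Turing machines\<close>

text \<open>
  A tape is two-way infinite. It is represented by the cells to the left of the head (nearest
  first) and the cells from the head on to the right; all cells not listed are blank. Tape symbols
  are natural numbers, \<open>0\<close> being the blank.
\<close>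

datatype dir = Left | Stay | Right

type_synonym tape = "nat list \<times> nat list"

fun tape_read :: "tape \<Rightarrow> nat" where
  "tape_read (l, []) = 0"
| "tape_read (l, a # r) = a"

fun tape_write :: "nat \<Rightarrow> tape \<Rightarrow> tape" where
  "tape_write b (l, r) = (l, b # tl r)"

fun tape_move :: "dir \<Rightarrow> tape \<Rightarrow> tape" where
  "tape_move Stay t = t"
| "tape_move Left ([], r) = ([], 0 # r)"
| "tape_move Left (a # l, r) = (l, a # r)"
| "tape_move Right (l, []) = (0 # l, [])"
| "tape_move Right (l, a # r) = (a # l, r)"

text \<open>
  States are the numbers below \<open>num_states\<close>, with initial state \<open>0\<close>, and symbols the numbers
  below \<open>num_symbols\<close>. The value \<open>None\<close> of the transition function means that the machine halts.
\<close>

record turing_machine =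
  num_tapes :: nat
  num_states :: nat
  num_symbols :: nat
  trans :: "nat \<Rightarrow> nat list \<Rightarrow> (nat \<times> (nat \<times> dir) list) option"

text \<open>The four symbols required are the blank and the three input symbols below.\<close>

definition wf_tm :: "turing_machine \<Rightarrow> bool" where
  "wf_tm M \<longleftrightarrow> 1 \<le> num_tapes M \<and> 1 \<le> num_states M \<and> 4 \<le> num_symbols M \<and>
    (\<forall>q rs q' acts.
       q < num_states M \<and> length rs = num_tapes M \<and> set rs \<subseteq> {..<num_symbols M} \<and>
       trans M q rs = Some (q', acts) \<longrightarrow>
       q' < num_states M \<and> length acts = num_tapes M \<and> fst ` set acts \<subseteq> {..<num_symbols M})"

type_synonym config = "nat \<times> tape list"

definition tm_step :: "turing_machine \<Rightarrow> config \<Rightarrow> config option" where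
  "tm_step M = (\<lambda>(q, ts).
     map_option (\<lambda>(q', acts). (q', map2 (\<lambda>(b, m) t. tape_move m (tape_write b t)) acts ts))
       (trans M q (map tape_read ts)))"

fun tm_run :: "turing_machine \<Rightarrow> nat \<Rightarrow> config \<Rightarrow> config" where
  "tm_run M 0 c = c"
| "tm_run M (Suc t) c = (case tm_step M c of None \<Rightarrow> c | Some c' \<Rightarrow> tm_run M t c')"

datatype sym = Zero | One | Sep

primrec sym_code :: "sym \<Rightarrow> nat" where
  "sym_code Zero = 1"
| "sym_code One = 2"
| "sym_code Sep = 3"

definition tm_init :: "turing_machine \<Rightarrow> sym list \<Rightarrow> config" where
  "tm_init M w = (0, ([], map sym_code w) # replicate (num_tapes M - 1) ([], []))"

text \<open>The output is the word on the first tape that extends from the head to the next blank.\<close>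

definition tm_output :: "config \<Rightarrow> nat list" where
  "tm_output c = takeWhile (\<lambda>a. a \<noteq> 0) (snd (hd (snd c)))"

definition tm_computes :: "turing_machine \<Rightarrow> sym list \<Rightarrow> nat \<Rightarrow> sym list \<Rightarrow> bool" where
  "tm_computes M w t v \<longleftrightarrow>
    (let c = tm_run M t (tm_init M w) in tm_step M c = None \<and> tm_output c = map sym_code v)"


section \<open>The class FP\<close>

text \<open>
  Encodings are relations between objects and words, since an object such as a graph may have
  several encodings (corresponding to different orders of listing its vertices and edges). An
  algorithm has to cope with every encoding of its input and may output any encoding of a correct
  answer. Time is measured in the length of the input word.
\<close>

definition FP :: "('i \<Rightarrow> sym list \<Rightarrow> bool) \<Rightarrow> ('o \<Rightarrow> sym list \<Rightarrow> bool) \<Rightarrow> ('i, 'o) problem set" where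
  "FP enc_in enc_out = {P. \<exists>M (p :: nat poly). wf_tm M \<and>
     (\<forall>I \<in> inputs P. \<forall>w. enc_in I w \<longrightarrow>
        (\<exists>a v t. t \<le> poly p (length w) \<and> tm_computes M w t v \<and> a \<in> answers P I \<and> enc_out a v))}"


section \<open>Encodings\<close>

text \<open>Binary notation, most significant bit first\<close>

fun bin :: "nat \<Rightarrow> sym list" where
  "bin n = (if n = 0 then [Zero] else if n = 1 then [One]
            else bin (n div 2) @ [if even n then Zero else One])"

declare bin.simps [simp del]

text \<open>
  Every number is followed by a separator, and a further separator ends a list. As no number has
  an empty notation, these codes are self-delimiting and can be concatenated.
\<close>

definition vertices_word :: "nat list \<Rightarrow> sym list" where
  "vertices_word vs = concat (map (\<lambda>v. bin v @ [Sep]) vs) @ [Sep]"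

definition edges_word :: "(nat \<times> nat) list \<Rightarrow> sym list" where
  "edges_word es = concat (map (\<lambda>(u, v). bin u @ [Sep] @ bin v @ [Sep]) es) @ [Sep]"

definition graph_enc :: "nat graph \<Rightarrow> sym list \<Rightarrow> bool" where
  "graph_enc G w \<longleftrightarrow> (\<exists>vs es.
     distinct vs \<and> set vs = verts G \<and>
     distinct (map (\<lambda>(u, v). {u, v}) es) \<and> (\<lambda>(u, v). {u, v}) ` set es = edges G \<and>
     w = vertices_word vs @ edges_word es)"

fun cycle_enc :: "nat list option \<Rightarrow> sym list \<Rightarrow> bool" where
  "cycle_enc None w \<longleftrightarrow> w = [Zero]"
| "cycle_enc (Some c) w \<longleftrightarrow> w = One # vertices_word c"

definition pair_enc ::
  "('a \<Rightarrow> sym list \<Rightarrow> bool) \<Rightarrow> ('b \<Rightarrow> sym list \<Rightarrow> bool) \<Rightarrow> 'a \<times> 'b \<Rightarrow> sym list \<Rightarrow> bool" where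
  "pair_enc e f = (\<lambda>(a, b) w. \<exists>u v. e a u \<and> f b v \<and> w = u @ v)"


subsection \<open>Every graph has an encoding, and encodings can be decoded\<close>

lemma graph_enc_exists:
  assumes "simple_graph G"
  shows "\<exists>w. graph_enc G w"
proof -
  have fV: "finite (verts G)" using assms by (simp add: simple_graph_def)
  then obtain vs where vs: "distinct vs" "set vs = verts G"
    using finite_distinct_list by blast
  have "edges G \<subseteq> Pow (verts G)" using assms by (auto simp: simple_graph_def)
  then have "finite (edges G)" using fV finite_subset by blast
  then obtain xs where xs: "distinct xs" "set xs = edges G"
    using finite_distinct_list by blast
  define f :: "nat \<times> nat \<Rightarrow> nat set" where "f = (\<lambda>(u, v). {u, v})"
  have "\<forall>e \<in> set xs. \<exists>p. f p = e"
  proof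
    fix e assume "e \<in> set xs"
    then obtain u v where "e = {u, v}" using assms xs(2) by (auto simp: simple_graph_def)
    then have "f (u, v) = e" by (simp add: f_def)
    then show "\<exists>p. f p = e" ..
  qed
  then obtain g where g: "\<forall>e \<in> set xs. f (g e) = e"
    using bchoice[of "set xs" "\<lambda>e p. f p = e"] by blast
  have m: "map f (map g xs) = xs"
    unfolding map_map by (rule map_idI) (simp add: g)
  have "f ` set (map g xs) = edges G"
    using arg_cong[OF m, of set] xs(2) by (simp only: set_map)
  moreover have "distinct (map f (map g xs))"
    unfolding m by (rule xs(1))
  ultimately show ?thesis using vs unfolding graph_enc_def f_def by blast
qed

lemma bin_neq_Nil: "bin n \<noteq> []"
  by (subst bin.simps) auto

lemma Sep_notin_bin: "Sep \<notin> set (bin n)"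
  by (induction n rule: bin.induct) (subst bin.simps, auto)

lemma bin_inject: "bin m = bin n \<longleftrightarrow> m = n"
proof
  show "bin m = bin n \<Longrightarrow> m = n"
  proof (induction m arbitrary: n rule: bin.induct)
    case (1 m)
    consider "m \<le> 1" "n \<le> 1" | "m \<le> 1" "n > 1" | "m > 1" "n \<le> 1" | "m > 1" "n > 1" by linarith
    then show ?case
    proof cases
      case 1
      then show ?thesis using "1.prems" bin.simps[of m] bin.simps[of n] by (auto split: if_splits)
    next
      case 2
      then show ?thesis using "1.prems" bin.simps[of m] bin.simps[of n] bin_neq_Nil[of "n div 2"]
        by (auto split: if_splits simp: Cons_eq_append_conv)
    next
      case 3
      then show ?thesis using "1.prems" bin.simps[of m] bin.simps[of n] bin_neq_Nil[of "m div 2"]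
        by (auto split: if_splits simp: append_eq_Cons_conv)
    next
      case 4
      then have e: "bin (m div 2) = bin (n div 2)" "even m = even n"
        using "1.prems" bin.simps[of m] bin.simps[of n] by (auto split: if_splits)
      have "m div 2 = n div 2" using "1.IH"[OF _ _ e(1)] 4 by simp
      then show ?thesis using e(2) by (metis dvd_mult_div_cancel odd_two_times_div_two_succ)
    qed
  qed
qed simp

lemma bin_Sep_inject: "bin m @ Sep # x = bin n @ Sep # y \<longleftrightarrow> m = n \<and> x = y"
proof
  assume a: "bin m @ Sep # x = bin n @ Sep # y"
  have t: "takeWhile (\<lambda>s. s \<noteq> Sep) (bin k @ Sep # z) = bin k" for k z
    using Sep_notin_bin[of k] by (subst takeWhile_append2) auto
  have "bin m = bin n" using t[of m x] t[of n y] a by simp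
  then show "m = n \<and> x = y" using a by (simp add: bin_inject)
qed simp

lemma bin_append_neq_Sep: "bin n @ x \<noteq> Sep # y"
  using bin_neq_Nil[of n] Sep_notin_bin[of n] by (cases "bin n") auto

lemma vertices_word_inject: "vertices_word vs @ x = vertices_word vs' @ y \<longleftrightarrow> vs = vs' \<and> x = y"
proof
  show "vertices_word vs @ x = vertices_word vs' @ y \<Longrightarrow> vs = vs' \<and> x = y"
  proof (induction vs arbitrary: vs')
    case Nil
    then show ?case
      by (cases vs') (auto simp: vertices_word_def bin_append_neq_Sep[symmetric])
  next
    case (Cons a vs)
    then show ?case
      by (cases vs') (auto simp: vertices_word_def bin_append_neq_Sep bin_Sep_inject)
  qed
qed simp

lemma edges_word_inject: "edges_word es @ x = edges_word es' @ y \<longleftrightarrow> es = es' \<and> x = y"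
proof
  show "edges_word es @ x = edges_word es' @ y \<Longrightarrow> es = es' \<and> x = y"
  proof (induction es arbitrary: es')
    case Nil
    then show ?case
      by (cases es') (auto simp: edges_word_def bin_append_neq_Sep[symmetric] split: prod.splits)
  next
    case (Cons a es)
    then show ?case
      by (cases es') (auto simp: edges_word_def bin_append_neq_Sep bin_Sep_inject split: prod.splits)
  qed
qed simp

lemma output_enc_unique:
  assumes "pair_enc graph_enc cycle_enc (G, a) w" "pair_enc graph_enc cycle_enc (G', a') w"
  shows "G = G' \<and> a = a'"
proof -
  have "a = a'" if "cycle_enc a v" "cycle_enc a' v" for v
    using that vertices_word_inject[of _ "[]" _ "[]"] by (cases a; cases a') auto
  then show ?thesis
    using assms
    by (auto simp: pair_enc_def graph_enc_def vertices_word_inject edges_word_inject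
        intro: graph.equality)
qed

lemma graph_enc_unique:
  assumes "graph_enc G w" "graph_enc G' w"
  shows "G = G'"
proof -
  have "pair_enc graph_enc cycle_enc (H, None) (w @ [Zero])" if "graph_enc H w" for H
    using that by (auto simp: pair_enc_def)
  then show ?thesis using assms output_enc_unique by blast
qed

end

theory Submission
  imports Defs
begin

text \<open>
  Let \<open>n\<close> be the number of vertices. If some vertex has degree \<open>d\<close> with \<open>3 * (d - 1) \<le> n\<close>, deleting all
  but one of its edges leaves a graph that is not Hamiltonian. Otherwise consider a cyclic order of
  the vertices and call consecutive nonadjacent vertices a gap. Rotating the order so that
  a gap lies between the last vertex \<open>y\<close> and the first vertex \<open>x\<close>, and reversing a prefix
  \<open>x, ..., p\<close> that is followed by \<open>q\<close>, replaces the pairs \<open>y x\<close> and \<open>p q\<close> by \<open>x q\<close> and \<open>y p\<close>. If no such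
  reversal reduces the number \<open>g\<close> of gaps, then for every pair \<open>p q\<close> at most one of \<open>x q\<close> adjacent,
  \<open>y p\<close> adjacent, \<open>p q\<close> nonadjacent holds, and summing over the pairs gives
  \<open>deg x + deg y + g \<le> n\<close>. As \<open>3 * deg \<ge> n + 4\<close>, this yields \<open>3 * g \<le> n\<close>. So local search ends with
  at most \<open>n / 3\<close> gaps, and adding these as edges makes the graph Hamiltonian.

  Vertices are only compared for equality and moved around, which multitape machines do by
  treating tapes as stacks of tokens.
\<close>

section \<open>Stack programs and their compilation\<close>

text \<open>A pair \<open>p q\<close> has at most one of the three properties for this reason:
  reversal trades the gap \<open>y x\<close> and the pair \<open>p q\<close> for \<open>x q\<close>
  and \<open>y p\<close>, so it gains if both new pairs are adjacent, or if one is and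
  \<open>p q\<close> is a second gap. The degree threshold comes from the deletions: removing all
  but one of \<open>d\<close> edges is allowed if \<open>3 * d \<le> n + 3\<close>, so the other
  case has \<open>3 * d \<ge> n + 4\<close>, which is more than the counting needs.

  The algorithm never tests for progress. Each sweep ends with a rotation, so \<open>n\<close>
  sweeps without progress have tried every pair of neighbours as the gap \<open>y x\<close>; hence a
  round of \<open>n\<close> sweeps removes a gap as long as there are too many. Since there are at
  most \<open>n\<close> gaps, more than \<open>n\<close> rounds suffice. Counting, including the
  comparison of \<open>3 * d\<close> with \<open>n + 3\<close>, consumes tokens and needs no
  arithmetic.

  The obstacle for the running time is that polynomial bounds are not preserved by iteration. Sizes
  are measured so that every basic operation adds at most a constant; a loop over a body of constant
  growth is then polynomial, and a loop whose body enlarges the state is never nested in another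
  one.\<close>

type_synonym peeks = "nat \<Rightarrow> sym option"

datatype prog =
    Skip
  | Push nat "peeks \<Rightarrow> sym"
  | Pop nat
  | Seq prog prog
  | Cond "peeks \<Rightarrow> bool" prog prog
  | While "peeks \<Rightarrow> bool" prog

type_synonym stacks = "nat \<Rightarrow> sym list"

definition peek :: "'a list \<Rightarrow> 'a option" where
  "peek xs = (case xs of [] \<Rightarrow> None | x # _ \<Rightarrow> Some x)"

lemma peek_simps [simp]: "peek [] = None" "peek (x # xs) = Some x"
  by (simp_all add: peek_def)

lemma peek_eq_None_iff [simp]: "peek xs = None \<longleftrightarrow> xs = []" "None = peek xs \<longleftrightarrow> xs = []"
  by (cases xs; auto)+

abbreviation peeks :: "(nat \<Rightarrow> 'a list) \<Rightarrow> nat \<Rightarrow> 'a option" where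
  "peeks s \<equiv> (\<lambda>j. peek (s j))"

text \<open>
  A push to stack \<open>i\<close> takes two steps, and in the second one the head of tape \<open>i\<close> has already left
  the top cell; so the pushed symbol may depend on the tops of the other stacks only.
\<close>

inductive ex :: "prog \<Rightarrow> stacks \<Rightarrow> nat \<Rightarrow> stacks \<Rightarrow> bool" where
  Skip: "ex Skip s 0 s"
| Push: "ex (Push i f) s 2 (s(i := f ((peeks s)(i := None)) # s i))"
| Pop: "ex (Pop i) s 1 (s(i := tl (s i)))"
| Seq: "ex a s t s' \<Longrightarrow> ex b s' t' s'' \<Longrightarrow> ex (Seq a b) s (t + t') s''"
| CondT: "P (peeks s) \<Longrightarrow> ex a s t s' \<Longrightarrow> ex (Cond P a b) s (t + 2) s'"
| CondF: "\<not> P (peeks s) \<Longrightarrow> ex b s t s' \<Longrightarrow> ex (Cond P a b) s (t + 1) s'"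
| WhileF: "\<not> P (peeks s) \<Longrightarrow> ex (While P a) s 1 s"
| WhileT: "P (peeks s) \<Longrightarrow> ex a s t s' \<Longrightarrow> ex (While P a) s' t' s'' \<Longrightarrow>
    ex (While P a) s (t + t' + 2) s''"

primrec uses_below :: "nat \<Rightarrow> prog \<Rightarrow> bool" where
  "uses_below n Skip = True"
| "uses_below n (Push i f) = (i < n)"
| "uses_below n (Pop i) = (i < n)"
| "uses_below n (Seq a b) = (uses_below n a \<and> uses_below n b)"
| "uses_below n (Cond P a b) = (uses_below n a \<and> uses_below n b)"
| "uses_below n (While P a) = uses_below n a"

definition sym_decode :: "nat \<Rightarrow> sym option" where
  "sym_decode a = (if a = 1 then Some Zero else if a = 2 then Some One else
     if a = 3 then Some Sep else None)"

lemma sym_decode_0 [simp]: "sym_decode 0 = None"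
  by (simp add: sym_decode_def)

lemma sym_decode_code [simp]: "sym_decode (sym_code a) = Some a"
  by (cases a) (simp_all add: sym_decode_def)

definition peeks_of :: "nat list \<Rightarrow> peeks" where
  "peeks_of rs j = (if j < length rs then sym_decode (rs ! j) else None)"

type_synonym instr = "nat list \<Rightarrow> nat \<times> (nat \<times> dir) list"

definition idle :: "nat list \<Rightarrow> (nat \<times> dir) list" where
  "idle rs = map (\<lambda>a. (a, Stay)) rs"

primrec prog_len :: "prog \<Rightarrow> nat" where
  "prog_len Skip = 0"
| "prog_len (Push i f) = 2"
| "prog_len (Pop i) = 1"
| "prog_len (Seq a b) = prog_len a + prog_len b"
| "prog_len (Cond P a b) = prog_len a + prog_len b + 2"
| "prog_len (While P a) = prog_len a + 2"

text \<open>A block is entered in state \<open>k\<close> and left by reaching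
  \<open>k + prog_len c\<close>, so sequential composition is concatenation. A first branch needs a
  jump over the second one, and an iteration a jump back to the test; together with the test this is
  the summand 2 in the rules \<open>CondT\<close> and \<open>WhileT\<close>.\<close>

primrec compile :: "nat \<Rightarrow> prog \<Rightarrow> instr list" where
  "compile k Skip = []"
| "compile k (Push i f) =
    [\<lambda>rs. (k + 1, (idle rs)[i := (rs ! i, Left)]),
     \<lambda>rs. (k + 2, (idle rs)[i := (sym_code (f ((peeks_of rs)(i := None))), Stay)])]"
| "compile k (Pop i) = [\<lambda>rs. (k + 1, (idle rs)[i := (rs ! i, Right)])]"
| "compile k (Seq a b) = compile k a @ compile (k + prog_len a) b"
| "compile k (Cond P a b) =
    [\<lambda>rs. (if P (peeks_of rs) then k + 1 else k + prog_len a + 2, idle rs)] @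
    compile (k + 1) a @
    [\<lambda>rs. (k + prog_len a + prog_len b + 2, idle rs)] @
    compile (k + prog_len a + 2) b"
| "compile k (While P a) =
    [\<lambda>rs. (if P (peeks_of rs) then k + 1 else k + prog_len a + 2, idle rs)] @
    compile (k + 1) a @ [\<lambda>rs. (k, idle rs)]"

lemma length_compile [simp]: "length (compile k c) = prog_len c"
  by (induction c arbitrary: k) auto

text \<open>The one state beyond the code is the halting state, reached by running off the
  end.\<close>

definition machine :: "nat \<Rightarrow> instr list \<Rightarrow> turing_machine" where
  "machine n cs = \<lparr> num_tapes = n, num_states = length cs + 1, num_symbols = 4,
     trans = (\<lambda>q rs. if q < length cs then Some ((cs ! q) rs) else None) \<rparr>"

lemma sym_code_less [simp]: "sym_code a < 4"
  by (cases a) auto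

lemma length_idle [simp]: "length (idle rs) = length rs"
  by (simp add: idle_def)

lemma fst_set_idle: "fst ` set (idle rs) = set rs"
  by (force simp: idle_def)

lemma idle_update_less:
  assumes "(x, d) \<in> set ((idle rs)[i := (a, m)])" "set rs \<subseteq> {..<4}" "a < 4"
  shows "x < 4"
proof -
  have "(x, d) \<in> insert (a, m) (set (idle rs))"
    using assms(1) set_update_subset_insert by fast
  then show ?thesis using assms(2,3) by (auto simp: idle_def)
qed

lemma compile_wf:
  assumes "uses_below n c" "f \<in> set (compile k c)" "length rs = n" "set rs \<subseteq> {..<4}"
  shows "fst (f rs) \<le> k + prog_len c \<and> length (snd (f rs)) = n \<and>
    fst ` set (snd (f rs)) \<subseteq> {..<4}"
  using assms
proof (induction c arbitrary: k f)
  case (Push i g)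
  have "rs ! i < 4" using subsetD[OF Push.prems(4) nth_mem[of i rs]] Push.prems by auto
  then show ?case using Push by (auto dest: idle_update_less idle_update_less[OF _ _ sym_code_less])
next
  case (Pop i)
  have "rs ! i < 4" using subsetD[OF Pop.prems(4) nth_mem[of i rs]] Pop.prems by auto
  then show ?case using Pop by (auto dest: idle_update_less idle_update_less[OF _ _ sym_code_less])
next
  case (Seq a b)
  then show ?case by fastforce
next
  case (Cond P a b)
  from Cond.prems(2) consider "f \<in> set (compile (k + 1) a)" | "f \<in> set (compile (k + prog_len a + 2) b)"
    | "f = (\<lambda>rs. (if P (peeks_of rs) then k + 1 else k + prog_len a + 2, idle rs))"
    | "f = (\<lambda>rs. (k + prog_len a + prog_len b + 2, idle rs))"
    by auto
  then show ?case
  proof cases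
    case 1
    then show ?thesis using Cond.IH(1)[of f "k + 1"] Cond.prems by simp
  next
    case 2
    then show ?thesis using Cond.IH(2)[of f "k + prog_len a + 2"] Cond.prems by simp
  qed (use Cond.prems in \<open>auto simp: fst_set_idle\<close>)
next
  case (While P a)
  from While.prems(2) consider "f \<in> set (compile (k + 1) a)"
    | "f = (\<lambda>rs. (if P (peeks_of rs) then k + 1 else k + prog_len a + 2, idle rs))"
    | "f = (\<lambda>rs. (k, idle rs))"
    by auto
  then show ?case
  proof cases
    case 1
    then show ?thesis using While.IH[of f "k + 1"] While.prems by simp
  qed (use While.prems in \<open>auto simp: fst_set_idle\<close>)
qed simp_all

lemma machine_wf:
  assumes "1 \<le> n" "uses_below n c"
  shows "wf_tm (machine n (compile 0 c))"
proof -
  have "q' < prog_len c + 1 \<and> length acts = n \<and> fst ` set acts \<subseteq> {..<4}"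
    if "q < prog_len c" "length rs = n" "set rs \<subseteq> {..<4}" "(compile 0 c ! q) rs = (q', acts)"
    for q rs q' acts
    using compile_wf[OF assms(2) nth_mem[of q "compile 0 c"] that(2,3)] that(1,4) by simp
  then show ?thesis
    using assms by (simp add: wf_tm_def machine_def) blast
qed

text \<open>The cells left of the head are unconstrained: a pop leaves old symbols there and a push
  overwrites them. Blanks behind the stack become explicit when the head visits them, hence the
  padding by zeros.\<close>

definition tape_holds :: "sym list \<Rightarrow> tape \<Rightarrow> bool" where
  "tape_holds xs tp \<longleftrightarrow> (\<exists>m. snd tp = map sym_code xs @ replicate m 0)"

text \<open>Stacks without a tape are empty, so that \<open>peeks_of\<close>, which answers
  \<open>None\<close> there, agrees with \<open>peeks s\<close> everywhere.\<close>

definition tapes_hold :: "nat \<Rightarrow> stacks \<Rightarrow> tape list \<Rightarrow> bool" where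
  "tapes_hold n s ts \<longleftrightarrow> length ts = n \<and> (\<forall>i<n. tape_holds (s i) (ts ! i)) \<and> (\<forall>i\<ge>n. s i = [])"

lemma tape_read_eq: "tape_read tp = (case snd tp of [] \<Rightarrow> 0 | a # _ \<Rightarrow> a)"
  by (cases tp rule: tape_read.cases) auto

lemma tape_holds_read: "tape_holds xs tp \<Longrightarrow> sym_decode (tape_read tp) = peek xs"
proof (cases xs)
  case Nil
  assume "tape_holds xs tp"
  then obtain m where "snd tp = replicate m 0" using Nil by (auto simp: tape_holds_def)
  then show ?thesis using Nil by (cases m) (auto simp: tape_read_eq)
qed (auto simp: tape_holds_def tape_read_eq)

lemma snd_rewrite:
  "\<exists>m. snd (tape_write (tape_read tp) tp) = snd tp @ replicate m 0"
proof (cases "snd tp")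
  case Nil
  then have "snd (tape_write (tape_read tp) tp) = snd tp @ replicate 1 0"
    by (cases tp) (auto simp: tape_read_eq)
  then show ?thesis by blast
next
  case (Cons a r)
  then have "snd (tape_write (tape_read tp) tp) = snd tp @ replicate 0 0"
    by (cases tp) (auto simp: tape_read_eq)
  then show ?thesis by blast
qed

lemma tape_holds_rewrite:
  assumes "tape_holds xs tp"
  shows "tape_holds xs (tape_write (tape_read tp) tp)"
  using assms snd_rewrite[of tp]
  by (auto simp: tape_holds_def simp flip: replicate_add)

lemma tape_holds_pop:
  assumes "tape_holds xs tp"
  shows "tape_holds (tl xs) (tape_move Right tp)"
proof -
  obtain l m where tp: "tp = (l, map sym_code xs @ replicate m 0)"
    using assms by (cases tp) (auto simp: tape_holds_def)
  show ?thesis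
  proof (cases xs)
    case Nil
    then show ?thesis using tp by (cases m) (auto simp: tape_holds_def intro: exI[of _ "0::nat"])
  next
    case (Cons x xs')
    then show ?thesis using tp by (auto simp: tape_holds_def)
  qed
qed

lemma tape_move_Left_snd: "tl (snd (tape_move Left tp)) = snd tp"
  by (cases "(Left, tp)" rule: tape_move.cases) auto

text \<open>Only \<open>tl\<close> is constrained because the head has just moved onto a cell with
  stale contents.\<close>

lemma tape_holds_push:
  assumes "tl (snd tp) = map sym_code xs @ replicate m 0"
  shows "tape_holds (x # xs) (tape_write (sym_code x) tp)"
  using assms by (cases tp) (auto simp: tape_holds_def)

abbreviation act :: "nat \<times> dir \<Rightarrow> tape \<Rightarrow> tape" where
  "act \<equiv> (\<lambda>(b, m) t. tape_move m (tape_write b t))"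

lemma tm_step_machine:
  assumes "q < length cs" "(cs ! q) (map tape_read ts) = (q', acts)"
  shows "tm_step (machine n cs) (q, ts) = Some (q', map2 act acts ts)"
  using assms by (simp add: tm_step_def machine_def)

primrec steps :: "turing_machine \<Rightarrow> nat \<Rightarrow> config \<Rightarrow> config \<Rightarrow> bool" where
  "steps M 0 c c' \<longleftrightarrow> c = c'"
| "steps M (Suc t) c c' \<longleftrightarrow> (\<exists>d. tm_step M c = Some d \<and> steps M t d c')"

lemma steps_add: "steps M t c d \<Longrightarrow> steps M t' d e \<Longrightarrow> steps M (t + t') c e"
  by (induction t arbitrary: c) auto

lemma steps_run: "steps M t c d \<Longrightarrow> tm_run M t c = d"
  by (induction t arbitrary: c) auto

lemma peeks_of_read:
  assumes "tapes_hold n s ts"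
  shows "peeks_of (map tape_read ts) = peeks s"
  using assms by (auto simp: peeks_of_def tapes_hold_def fun_eq_iff tape_holds_read)

text \<open>Every transition writes on every tape, so an idle step is not the identity on
  representations: an exhausted right part gains an explicit blank.\<close>

definition rewrite :: "tape list \<Rightarrow> tape list" where
  "rewrite ts = map2 act (idle (map tape_read ts)) ts"

lemma rewrite_nth [simp]: "i < length ts \<Longrightarrow> rewrite ts ! i = tape_write (tape_read (ts ! i)) (ts ! i)"
  by (simp add: rewrite_def idle_def)

lemma length_rewrite [simp]: "length (rewrite ts) = length ts"
  by (simp add: rewrite_def)

lemma tapes_hold_rewrite:
  assumes "tapes_hold n s ts"
  shows "tapes_hold n s (rewrite ts)"
  using assms by (auto simp: tapes_hold_def intro: tape_holds_rewrite)

lemma map2_act_update: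
  "map2 act ((idle (map tape_read ts))[i := (b, m)]) ts =
     (rewrite ts)[i := tape_move m (tape_write b (ts ! i))]"
proof (rule nth_equalityI)
  fix j assume "j < length (map2 act ((idle (map tape_read ts))[i := (b, m)]) ts)"
  then show "map2 act ((idle (map tape_read ts))[i := (b, m)]) ts ! j =
      (rewrite ts)[i := tape_move m (tape_write b (ts ! i))] ! j"
    by (cases "i = j") (auto simp: idle_def)
qed simp

lemma steps_goto:
  assumes "tapes_hold n s ts" "q < length cs"
    "(cs ! q) (map tape_read ts) = (q', idle (map tape_read ts))"
  shows "steps (machine n cs) 1 (q, ts) (q', rewrite ts)" "tapes_hold n s (rewrite ts)"
  using assms tapes_hold_rewrite[OF assms(1)] by (auto simp: tm_step_machine rewrite_def)

lemma tapes_hold_update: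
  assumes "tapes_hold n s ts" "i < n" "tape_holds xs tp"
  shows "tapes_hold n (s(i := xs)) (ts[i := tp])"
  using assms by (auto simp: tapes_hold_def nth_list_update)

text \<open>The induction follows the execution rather than the program, since a loop runs the same
  code again. The surrounding code \<open>pre\<close> and \<open>post\<close> is arbitrary so that
  the hypotheses apply to blocks inside a larger program.\<close>

lemma compile_correct:
  assumes "ex c s t s'" "uses_below n c" "tapes_hold n s ts"
    "cs = pre @ compile k c @ post" "length pre = k"
  shows "\<exists>ts'. tapes_hold n s' ts' \<and> steps (machine n cs) t (k, ts) (k + prog_len c, ts')"
  using assms
proof (induction arbitrary: pre post k ts rule: ex.induct)
  case (Skip s)
  then show ?case by auto
next
  case (Push i f s)
  let ?rs = "map tape_read ts"
  let ?tp = "tape_move Left (tape_write (tape_read (ts ! i)) (ts ! i))"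
  let ?ts1 = "(rewrite ts)[i := ?tp]"
  let ?x = "f ((peeks s)(i := None))"
  have i: "i < n" "length ts = n" using Push by (auto simp: tapes_hold_def)
  have "(cs ! k) ?rs = (k + 1, (idle ?rs)[i := (tape_read (ts ! i), Left)])"
    using Push.prems(3,4) i by (simp add: nth_append)
  then have s1: "tm_step (machine n cs) (k, ts) = Some (k + 1, ?ts1)"
    using Push.prems(3,4) by (subst tm_step_machine) (auto simp: map2_act_update)
  have "peeks_of (map tape_read ?ts1) j = peeks s j" if "j \<noteq> i" for j
    using that tapes_hold_rewrite[OF Push.prems(2)] i
    by (auto simp: peeks_of_def tapes_hold_def tape_holds_read simp del: rewrite_nth)
  then have "(peeks_of (map tape_read ?ts1))(i := None) = (peeks s)(i := None)"
    by auto
  then have "(cs ! (k + 1)) (map tape_read ?ts1) =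
      (k + 2, (idle (map tape_read ?ts1))[i := (sym_code ?x, Stay)])"
    using Push.prems(3,4) i by (simp add: nth_append)
  then have s2: "tm_step (machine n cs) (k + 1, ?ts1) =
      Some (k + 2, (rewrite ?ts1)[i := tape_write (sym_code ?x) ?tp])"
    using Push.prems(3,4) i by (subst tm_step_machine) (auto simp: map2_act_update)
  have "tape_holds (s i) (tape_write (tape_read (ts ! i)) (ts ! i))"
    using Push.prems(2) i by (auto simp: tapes_hold_def intro: tape_holds_rewrite)
  then obtain m where "tl (snd ?tp) = map sym_code (s i) @ replicate m 0"
    by (auto simp: tape_move_Left_snd tape_holds_def)
  then have "tape_holds (?x # s i) (tape_write (sym_code ?x) ?tp)"
    by (rule tape_holds_push)
  then have "tapes_hold n (s(i := ?x # s i)) ((rewrite (rewrite ts))[i := tape_write (sym_code ?x) ?tp])"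
    using Push.prems(2) i by (intro tapes_hold_update tapes_hold_rewrite)
  moreover have "(rewrite (rewrite ts))[i := tape_write (sym_code ?x) ?tp] =
      (rewrite ?ts1)[i := tape_write (sym_code ?x) ?tp]"
    (is "?l = ?r")
  proof (rule nth_equalityI)
    fix j assume "j < length ?l"
    then show "?l ! j = ?r ! j" by (cases "i = j") auto
  qed simp
  moreover have "steps (machine n cs) 2 (k, ts)
      (k + prog_len (Push i f), (rewrite ?ts1)[i := tape_write (sym_code ?x) ?tp])"
    using s1 s2 by (simp add: numeral_2_eq_2)
  ultimately show ?case by metis
next
  case (Pop i s)
  let ?rs = "map tape_read ts"
  let ?tp = "tape_move Right (tape_write (tape_read (ts ! i)) (ts ! i))"
  have i: "i < n" "length ts = n" using Pop by (auto simp: tapes_hold_def)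
  have "(cs ! k) ?rs = (k + 1, (idle ?rs)[i := (tape_read (ts ! i), Right)])"
    using Pop.prems(3,4) i by (simp add: nth_append)
  then have s1: "tm_step (machine n cs) (k, ts) = Some (k + 1, (rewrite ts)[i := ?tp])"
    using Pop.prems(3,4) by (subst tm_step_machine) (auto simp: map2_act_update)
  have "tape_holds (tl (s i)) ?tp"
    using Pop.prems(2) i by (auto simp: tapes_hold_def intro!: tape_holds_rewrite tape_holds_pop)
  then have "tapes_hold n (s(i := tl (s i))) ((rewrite ts)[i := ?tp])"
    using Pop.prems(2) i by (intro tapes_hold_update tapes_hold_rewrite)
  moreover have "steps (machine n cs) 1 (k, ts) (k + prog_len (Pop i), (rewrite ts)[i := ?tp])"
    using s1 by simp
  ultimately show ?case by metis
next
  case (Seq a s t s' b t' s'')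
  obtain ts1 where 1: "tapes_hold n s' ts1" "steps (machine n cs) t (k, ts) (k + prog_len a, ts1)"
    using Seq.IH(1)[of ts pre k "compile (k + prog_len a) b @ post"] Seq.prems by auto
  obtain ts2 where "tapes_hold n s'' ts2"
      "steps (machine n cs) t' (k + prog_len a, ts1) (k + prog_len a + prog_len b, ts2)"
    using Seq.IH(2)[of ts1 "pre @ compile k a" "k + prog_len a" post] Seq.prems 1 by auto
  then show ?case using steps_add[OF 1(2)] by (auto simp: add.assoc)
next
  case (CondT P s a t s' b)
  have th: "peeks_of (map tape_read ts) = peeks s" using CondT.prems by (simp add: peeks_of_read)
  have 0: "(cs ! k) (map tape_read ts) = (k + 1, idle (map tape_read ts))"
    using CondT.prems(3,4) CondT.hyps th by (simp add: nth_append)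
  have g: "steps (machine n cs) 1 (k, ts) (k + 1, rewrite ts)" "tapes_hold n s (rewrite ts)"
    using steps_goto[OF CondT.prems(2) _ 0] CondT.prems(3,4) by auto
  obtain ts1 where 1: "tapes_hold n s' ts1"
      "steps (machine n cs) t (k + 1, rewrite ts) (k + 1 + prog_len a, ts1)"
    using CondT.IH[of "rewrite ts" "pre @ [hd (compile k (Cond P a b))]" "k + 1"
        "[\<lambda>rs. (k + prog_len a + prog_len b + 2, idle rs)] @
          compile (k + prog_len a + 2) b @ post"]
      CondT.prems g by auto
  have 2: "(cs ! (k + 1 + prog_len a)) (map tape_read ts1) =
      (k + prog_len a + prog_len b + 2, idle (map tape_read ts1))"
    using CondT.prems(3,4) by (simp add: nth_append)
  have h: "steps (machine n cs) 1 (k + 1 + prog_len a, ts1)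
      (k + prog_len a + prog_len b + 2, rewrite ts1)" "tapes_hold n s' (rewrite ts1)"
    using steps_goto[OF 1(1) _ 2] CondT.prems(3,4) by auto
  show ?case
    using steps_add[OF steps_add[OF g(1) 1(2)] h(1)] h(2) by (auto simp: add.assoc)
next
  case (CondF P s b t s' a)
  have th: "peeks_of (map tape_read ts) = peeks s" using CondF.prems by (simp add: peeks_of_read)
  have 0: "(cs ! k) (map tape_read ts) = (k + prog_len a + 2, idle (map tape_read ts))"
    using CondF.prems(3,4) CondF.hyps th by (simp add: nth_append)
  have g: "steps (machine n cs) 1 (k, ts) (k + prog_len a + 2, rewrite ts)"
      "tapes_hold n s (rewrite ts)"
    using steps_goto[OF CondF.prems(2) _ 0] CondF.prems(3,4) by auto
  obtain ts1 where 1: "tapes_hold n s' ts1"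
      "steps (machine n cs) t (k + prog_len a + 2, rewrite ts) (k + prog_len a + 2 + prog_len b, ts1)"
    using CondF.IH[of "rewrite ts" "pre @ [hd (compile k (Cond P a b))] @ compile (k + 1) a @
        [\<lambda>rs. (k + prog_len a + prog_len b + 2, idle rs)]" "k + prog_len a + 2" post]
      CondF.prems g by auto
  show ?case
    using steps_add[OF g(1) 1(2)] 1(1) by (auto simp: ac_simps)
next
  case (WhileF P s a)
  have th: "peeks_of (map tape_read ts) = peeks s" using WhileF.prems by (simp add: peeks_of_read)
  have 0: "(cs ! k) (map tape_read ts) = (k + prog_len a + 2, idle (map tape_read ts))"
    using WhileF.prems(3,4) WhileF.hyps th by (simp add: nth_append)
  show ?case
    using steps_goto[OF WhileF.prems(2) _ 0] WhileF.prems(3,4) by (auto simp: add.assoc)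
next
  case (WhileT P s a t s' t' s'')
  have th: "peeks_of (map tape_read ts) = peeks s" using WhileT.prems by (simp add: peeks_of_read)
  have 0: "(cs ! k) (map tape_read ts) = (k + 1, idle (map tape_read ts))"
    using WhileT.prems(3,4) WhileT.hyps th by (simp add: nth_append)
  have g: "steps (machine n cs) 1 (k, ts) (k + 1, rewrite ts)" "tapes_hold n s (rewrite ts)"
    using steps_goto[OF WhileT.prems(2) _ 0] WhileT.prems(3,4) by auto
  obtain ts1 where 1: "tapes_hold n s' ts1"
      "steps (machine n cs) t (k + 1, rewrite ts) (k + 1 + prog_len a, ts1)"
    using WhileT.IH(1)[of "rewrite ts" "pre @ [hd (compile k (While P a))]" "k + 1"
        "[\<lambda>rs. (k, idle rs)] @ post"]
      WhileT.prems g by auto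
  have 2: "(cs ! (k + 1 + prog_len a)) (map tape_read ts1) = (k, idle (map tape_read ts1))"
    using WhileT.prems(3,4) by (simp add: nth_append)
  have h: "steps (machine n cs) 1 (k + 1 + prog_len a, ts1) (k, rewrite ts1)"
      "tapes_hold n s' (rewrite ts1)"
    using steps_goto[OF 1(1) _ 2] WhileT.prems(3,4) by auto
  obtain ts2 where 3: "tapes_hold n s'' ts2"
      "steps (machine n cs) t' (k, rewrite ts1) (k + prog_len (While P a), ts2)"
    using WhileT.IH(2)[OF WhileT.prems(1) h(2) WhileT.prems(3,4)] by auto
  have "1 + t + 1 + t' = t + t' + 2" by simp
  then show ?case
    using steps_add[OF steps_add[OF steps_add[OF g(1) 1(2)] h(1)] 3(2)] 3(1) by metis
qed

lemma compile_computes: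
  assumes "ex c ((\<lambda>_. [])(0 := w)) t s'" "uses_below n c" "1 \<le> n" "s' 0 = v"
  shows "tm_computes (machine n (compile 0 c)) w t v"
proof -
  let ?M = "machine n (compile 0 c)"
  let ?ts = "([], map sym_code w) # replicate (n - 1) ([], [])"
  have "tapes_hold n ((\<lambda>_. [])(0 := w)) ?ts"
    using assms(3) by (auto simp: tapes_hold_def tape_holds_def nth_Cons')
  then obtain ts' where ts': "tapes_hold n s' ts'" "steps ?M t (0, ?ts) (prog_len c, ts')"
    using compile_correct[OF assms(1,2), of ?ts "compile 0 c" "[]" 0 "[]"] by auto
  have r: "tm_run ?M t (tm_init ?M w) = (prog_len c, ts')"
    using steps_run[OF ts'(2)] by (simp add: tm_init_def machine_def)
  have "tape_holds v (hd ts')" using ts'(1) assms(3,4)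
    by (cases ts') (auto simp: tapes_hold_def)
  then obtain m where m: "snd (hd ts') = map sym_code v @ replicate m 0"
    by (auto simp: tape_holds_def)
  \<comment> \<open>Nonzero codes keep \<open>tm_output\<close> from stopping inside
    \<open>v\<close>; the padding behind it is cut off.\<close>
  have nz: "sym_code a \<noteq> 0" for a by (cases a) auto
  have "tm_output (prog_len c, ts') = map sym_code v"
    unfolding tm_output_def by (simp add: m takeWhile_append nz)
  moreover have "tm_step ?M (prog_len c, ts') = None"
    by (simp add: tm_step_def machine_def)
  ultimately show ?thesis by (simp add: tm_computes_def r Let_def)
qed

section \<open>Polynomial-time operations on stacks of tokens\<close>

text \<open>
  A token is a word without separators, and a stack of tokens is written on a tape with a separator
  after each token. The encoding of a graph thus is itself a stack of tokens, in which the empty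
  token ends a list.
\<close>

type_synonym state = "nat \<Rightarrow> sym list list"

definition word :: "sym list list \<Rightarrow> sym list" where
  "word ws = concat (map (\<lambda>w. w @ [Sep]) ws)"

lemma word_simps [simp]: "word [] = []" "word (w # ws) = w @ Sep # word ws"
  "word (ws @ ws') = word ws @ word ws'"
  by (simp_all add: word_def)

lemma word_eq_Nil_iff [simp]: "word ws = [] \<longleftrightarrow> ws = []"
  by (cases ws) auto

text \<open>The scratch tapes are empty here, so every operation has to clean them up before it
  ends.\<close>

definition enc :: "nat \<Rightarrow> state \<Rightarrow> stacks" where
  "enc K s = (\<lambda>i. if i < K then word (s i) else [])"

text \<open>\<open>B\<close> bounds the number of tokens and the length of each, not the total
  length of the words. Copying a token then raises the bound by 1 only, however long the token is,
  and this constant growth is what makes loops tractable.\<close>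

definition bd :: "nat \<Rightarrow> nat \<Rightarrow> state \<Rightarrow> bool" where
  "bd K B s \<longleftrightarrow> (\<Sum>i<K. length (s i)) \<le> B \<and>
    (\<forall>i<K. \<forall>w \<in> set (s i). length w \<le> B \<and> Sep \<notin> set w)"

lemma bd_mono: "bd K B s \<Longrightarrow> B \<le> B' \<Longrightarrow> bd K B' s"
  by (fastforce simp: bd_def)

lemma bd_length: "bd K B s \<Longrightarrow> i < K \<Longrightarrow> length (s i) \<le> B"
  using member_le_sum[of i "{..<K}" "\<lambda>i. length (s i)"] by (auto simp: bd_def)

lemma bd_token: "bd K B s \<Longrightarrow> i < K \<Longrightarrow> s i = w # ws \<Longrightarrow> length w \<le> B \<and> Sep \<notin> set w"
  by (auto simp: bd_def)

lemma sum_length_update: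
  fixes s :: state
  assumes "i < K"
  shows "(\<Sum>a<K. length ((s(i := x)) a)) + length (s i) = (\<Sum>a<K. length (s a)) + length x"
proof -
  have "(\<Sum>a<K. length ((s(i := x)) a)) = length x + (\<Sum>a\<in>{..<K} - {i}. length (s a))"
    by (subst sum.remove[of _ i]) (use assms in \<open>auto intro!: sum.cong\<close>)
  moreover have "(\<Sum>a<K. length (s a)) = length (s i) + (\<Sum>a\<in>{..<K} - {i}. length (s a))"
    by (rule sum.remove) (use assms in auto)
  ultimately show ?thesis by linarith
qed

lemma poly_nat_mono: "x \<le> y \<Longrightarrow> poly p x \<le> poly (p :: nat poly) y"
  by (induction p) (auto intro: add_mono mult_mono)

text \<open>
  The polynomial \<open>q\<close> bounds the size of the state after \<open>f\<close>; the tapes \<open>K\<close> and \<open>K + 1\<close> are scratch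
  space.
\<close>

definition ptime :: "nat \<Rightarrow> nat poly \<Rightarrow> (state \<Rightarrow> state) \<Rightarrow> bool" where
  "ptime K q f \<longleftrightarrow> (\<exists>c p. uses_below (K + 2) c \<and>
     (\<forall>B s. bd K B s \<longrightarrow> bd K (poly q B) (f s) \<and>
        (\<exists>t \<le> poly p B. ex c (enc K s) t (enc K (f s)))))"

lemma ptimeI:
  assumes "uses_below (K + 2) c"
    "\<And>B s. bd K B s \<Longrightarrow> bd K (poly q B) (f s)"
    "\<And>B s. bd K B s \<Longrightarrow> \<exists>t \<le> poly p B. ex c (enc K s) t (enc K (f s))"
  shows "ptime K q f"
  using assms unfolding ptime_def by blast

lemma ptimeE:
  assumes "ptime K q f"
  obtains c p where "uses_below (K + 2) c"
    "\<And>B s. bd K B s \<Longrightarrow> bd K (poly q B) (f s)"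
    "\<And>B s. bd K B s \<Longrightarrow> \<exists>t \<le> poly p B. ex c (enc K s) t (enc K (f s))"
  using assms unfolding ptime_def by blast

lemma ptime_weaken:
  assumes "ptime K q f" "\<And>B. poly q B \<le> poly q' B"
  shows "ptime K q' f"
  using assms(1)
proof (rule ptimeE)
  fix c p
  assume "uses_below (K + 2) c" "\<And>B s. bd K B s \<Longrightarrow> bd K (poly q B) (f s)"
    "\<And>B s. bd K B s \<Longrightarrow> \<exists>t \<le> poly p B. ex c (enc K s) t (enc K (f s))"
  then show ?thesis using bd_mono assms(2) by (intro ptimeI[of K c q' f p]) blast+
qed

section \<open>Programs that transfer, copy and compare tokens\<close>

definition xfer :: "sym set \<Rightarrow> nat \<Rightarrow> nat \<Rightarrow> prog" where
  "xfer S i j = While (\<lambda>t. case t i of None \<Rightarrow> False | Some a \<Rightarrow> a \<notin> S)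
     (Seq (Push j (\<lambda>t. the (t i))) (Pop i))"

text \<open>Symbols move one at a time, so a transferred word arrives reversed; going through the
  scratch tape and back restores its order.\<close>

lemma ex_xfer:
  assumes "i \<noteq> j" "\<sigma> i = w @ r" "set w \<inter> S = {}" "r = [] \<or> hd r \<in> S"
  shows "ex (xfer S i j) \<sigma> (5 * length w + 1) (\<sigma>(i := r, j := rev w @ \<sigma> j))"
  using assms(2,3)
proof (induction w arbitrary: \<sigma>)
  case Nil
  then have "\<sigma>(i := r, j := rev [] @ \<sigma> j) = \<sigma>" by auto
  moreover have "ex (xfer S i j) \<sigma> 1 \<sigma>"
    unfolding xfer_def by (rule ex.WhileF) (use Nil assms(4) in \<open>cases r; auto\<close>)
  ultimately show ?case by (simp del: fun_upd_apply)
next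
  case (Cons a w)
  let ?b = "Seq (Push j (\<lambda>t. the (t i))) (Pop i)"
  let ?s1 = "\<sigma>(j := a # \<sigma> j)" and ?s2 = "\<sigma>(j := a # \<sigma> j, i := w @ r)"
  have "ex (Push j (\<lambda>t. the (t i))) \<sigma> 2 ?s1"
    using ex.Push[of j "\<lambda>t. the (t i)" \<sigma>] Cons.prems assms(1) by simp
  moreover have "ex (Pop i) ?s1 1 ?s2"
    using ex.Pop[of i ?s1] Cons.prems assms(1) by simp
  ultimately have 1: "ex ?b \<sigma> 3 ?s2"
    using ex.Seq by fastforce
  have 2: "ex (xfer S i j) ?s2 (5 * length w + 1) (?s2(i := r, j := rev w @ ?s2 j))"
    by (rule Cons.IH) (use Cons.prems assms(1) in auto)
  have 3: "?s2(i := r, j := rev w @ ?s2 j) = \<sigma>(i := r, j := rev (a # w) @ \<sigma> j)"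
    using assms(1) by auto
  have "ex (xfer S i j) \<sigma> (3 + (5 * length w + 1) + 2) (\<sigma>(i := r, j := rev (a # w) @ \<sigma> j))"
    using 1 2 unfolding 3 unfolding xfer_def by (intro ex.WhileT) (use Cons.prems in auto)
  moreover have "3 + (5 * length w + 1) + 2 = 5 * length (a # w) + 1" by simp
  ultimately show ?case by metis
qed

text \<open>The way back from the scratch tape, onto two stacks at once: the source is restored
  while a copy is made, or two compared stacks recover their common prefix.\<close>

definition spread :: "nat \<Rightarrow> nat \<Rightarrow> nat \<Rightarrow> prog" where
  "spread T i j = While (\<lambda>t. t T \<noteq> None)
     (Seq (Push i (\<lambda>t. the (t T))) (Seq (Push j (\<lambda>t. the (t T))) (Pop T)))"

lemma ex_spread:
  assumes "i \<noteq> j" "T \<noteq> i" "T \<noteq> j" "\<sigma> T = w"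
  shows "ex (spread T i j) \<sigma> (7 * length w + 1)
    (\<sigma>(T := [], i := rev w @ \<sigma> i, j := rev w @ \<sigma> j))"
  using assms(4)
proof (induction w arbitrary: \<sigma>)
  case Nil
  then have "\<sigma>(T := [], i := rev [] @ \<sigma> i, j := rev [] @ \<sigma> j) = \<sigma>" by auto
  moreover have "ex (spread T i j) \<sigma> 1 \<sigma>"
    unfolding spread_def by (rule ex.WhileF) (use Nil in auto)
  ultimately show ?case by (simp del: fun_upd_apply)
next
  case (Cons a w)
  let ?s1 = "\<sigma>(i := a # \<sigma> i)" and ?s2 = "\<sigma>(i := a # \<sigma> i, j := a # \<sigma> j)"
  let ?s3 = "\<sigma>(i := a # \<sigma> i, j := a # \<sigma> j, T := w)"
  have "ex (Push i (\<lambda>t. the (t T))) \<sigma> 2 ?s1"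
    using ex.Push[of i "\<lambda>t. the (t T)" \<sigma>] Cons.prems assms by simp
  moreover have "ex (Push j (\<lambda>t. the (t T))) ?s1 2 ?s2"
    using ex.Push[of j "\<lambda>t. the (t T)" ?s1] Cons.prems assms by simp
  moreover have "ex (Pop T) ?s2 1 ?s3"
    using ex.Pop[of T ?s2] Cons.prems assms by simp
  ultimately have 1: "ex (Seq (Push i (\<lambda>t. the (t T))) (Seq (Push j (\<lambda>t. the (t T))) (Pop T)))
      \<sigma> (2 + (2 + 1)) ?s3"
    by (blast intro: ex.Seq)
  have 2: "ex (spread T i j) ?s3 (7 * length w + 1)
      (?s3(T := [], i := rev w @ ?s3 i, j := rev w @ ?s3 j))"
    by (rule Cons.IH) simp
  have 3: "?s3(T := [], i := rev w @ ?s3 i, j := rev w @ ?s3 j) =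
      \<sigma>(T := [], i := rev (a # w) @ \<sigma> i, j := rev (a # w) @ \<sigma> j)"
    using assms by auto
  have "ex (spread T i j) \<sigma> (2 + (2 + 1) + (7 * length w + 1) + 2)
      (\<sigma>(T := [], i := rev (a # w) @ \<sigma> i, j := rev (a # w) @ \<sigma> j))"
    using 1 2 unfolding 3 unfolding spread_def by (intro ex.WhileT) (use Cons.prems in auto)
  moreover have "2 + (2 + 1) + (7 * length w + 1) + 2 = 7 * length (a # w) + 1" by simp
  ultimately show ?case by metis
qed

text \<open>The comparison eats the common prefix on both stacks but keeps it on \<open>T\<close>,
  from where \<open>spread\<close> can restore both.\<close>

definition strip_common :: "nat \<Rightarrow> nat \<Rightarrow> nat \<Rightarrow> prog" where
  "strip_common T i j = While (\<lambda>t. t i \<noteq> None \<and> t i = t j \<and> t i \<noteq> Some Sep)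
     (Seq (Push T (\<lambda>t. the (t i))) (Seq (Pop i) (Pop j)))"

lemma ex_strip_common:
  assumes "i \<noteq> j" "T \<noteq> i" "T \<noteq> j" "\<sigma> i = w @ r" "\<sigma> j = w @ r'" "Sep \<notin> set w"
    "peek r = None \<or> peek r = Some Sep \<or> peek r \<noteq> peek r'"
  shows "ex (strip_common T i j) \<sigma> (6 * length w + 1)
    (\<sigma>(T := rev w @ \<sigma> T, i := r, j := r'))"
  using assms(4-6)
proof (induction w arbitrary: \<sigma>)
  case Nil
  then have "\<sigma>(T := rev [] @ \<sigma> T, i := r, j := r') = \<sigma>" by auto
  moreover have "ex (strip_common T i j) \<sigma> 1 \<sigma>"
    unfolding strip_common_def by (rule ex.WhileF) (use Nil assms(7) in auto)
  ultimately show ?case by (simp del: fun_upd_apply)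
next
  case (Cons a w)
  let ?s1 = "\<sigma>(T := a # \<sigma> T)" and ?s2 = "\<sigma>(T := a # \<sigma> T, i := w @ r)"
  let ?s3 = "\<sigma>(T := a # \<sigma> T, i := w @ r, j := w @ r')"
  have "ex (Push T (\<lambda>t. the (t i))) \<sigma> 2 ?s1"
    using ex.Push[of T "\<lambda>t. the (t i)" \<sigma>] Cons.prems assms by simp
  moreover have "ex (Pop i) ?s1 1 ?s2"
    using ex.Pop[of i ?s1] Cons.prems assms by simp
  moreover have "ex (Pop j) ?s2 1 ?s3"
    using ex.Pop[of j ?s2] Cons.prems assms by simp
  ultimately have 1: "ex (Seq (Push T (\<lambda>t. the (t i))) (Seq (Pop i) (Pop j))) \<sigma> (2 + (1 + 1)) ?s3"
    by (blast intro: ex.Seq)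
  have 2: "ex (strip_common T i j) ?s3 (6 * length w + 1)
      (?s3(T := rev w @ ?s3 T, i := r, j := r'))"
    by (rule Cons.IH) (use Cons.prems assms in auto)
  have 3: "?s3(T := rev w @ ?s3 T, i := r, j := r') = \<sigma>(T := rev (a # w) @ \<sigma> T, i := r, j := r')"
    using assms(1-3) by auto
  have "ex (strip_common T i j) \<sigma> (2 + (1 + 1) + (6 * length w + 1) + 2)
      (\<sigma>(T := rev (a # w) @ \<sigma> T, i := r, j := r'))"
    using 1 2 unfolding 3 unfolding strip_common_def
    by (intro ex.WhileT) (use Cons.prems in auto)
  moreover have "2 + (1 + 1) + (6 * length w + 1) + 2 = 6 * length (a # w) + 1" by simp
  ultimately show ?case by metis
qed

text \<open>On an empty source stack nothing happens. Since no operation can fail,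
  \<open>ptime\<close> needs no precondition besides \<open>bd\<close>; setting a flag that is
  already set relies on this convention too.\<close>

definition move :: "nat \<Rightarrow> nat \<Rightarrow> state \<Rightarrow> state" where
  "move i j s = (case s i of [] \<Rightarrow> s | w # ws \<Rightarrow> s(i := ws, j := w # s j))"

definition copy :: "nat \<Rightarrow> nat \<Rightarrow> state \<Rightarrow> state" where
  "copy i j s = (case s i of [] \<Rightarrow> s | w # ws \<Rightarrow> s(j := w # s j))"

definition new :: "nat \<Rightarrow> state \<Rightarrow> state" where
  "new i s = s(i := [] # s i)"

definition emit :: "sym \<Rightarrow> nat \<Rightarrow> state \<Rightarrow> state" where
  "emit a i s = (case s i of [] \<Rightarrow> s | w # ws \<Rightarrow> s(i := (a # w) # ws))"

definition skip :: "state \<Rightarrow> state" where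
  "skip s = s"

definition andthen :: "(state \<Rightarrow> state) \<Rightarrow> (state \<Rightarrow> state) \<Rightarrow> state \<Rightarrow> state" (infixr ";;" 60) where
  "(f ;; g) s = g (f s)"

definition branch :: "(state \<Rightarrow> bool) \<Rightarrow> (state \<Rightarrow> state) \<Rightarrow> (state \<Rightarrow> state) \<Rightarrow> state \<Rightarrow> state" where
  "branch P f g s = (if P s then f s else g s)"

lemma bd_move:
  assumes "bd K B s" "i < K" "j < K" "i \<noteq> j"
  shows "bd K B (move i j s)"
proof (cases "s i")
  case (Cons w ws)
  have "(\<Sum>a<K. length ((s(i := ws, j := w # s j)) a)) = (\<Sum>a<K. length (s a))"
    using sum_length_update[OF assms(2), of s ws]
      sum_length_update[OF assms(3), of "s(i := ws)" "w # s j"] Cons assms(4) by simp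
  then show ?thesis using assms Cons by (auto simp: bd_def move_def)
qed (use assms in \<open>simp add: move_def\<close>)

lemma bd_push:
  assumes "bd K B s" "j < K" "length w \<le> Suc B" "Sep \<notin> set w"
  shows "bd K (Suc B) (s(j := w # s j))"
  using sum_length_update[OF assms(2), of s "w # s j"] assms
  by (auto simp: bd_def le_SucI)

lemma bd_copy:
  assumes "bd K B s" "i < K" "j < K"
  shows "bd K (Suc B) (copy i j s)"
proof (cases "s i")
  case (Cons w ws)
  then show ?thesis using assms bd_push[OF assms(1,3), of w] bd_token[OF assms(1,2) Cons]
    by (simp add: copy_def)
qed (use assms in \<open>auto simp add: copy_def intro: bd_mono\<close>)

lemma bd_emit:
  assumes "bd K B s" "i < K" "a \<noteq> Sep"
  shows "bd K (Suc B) (emit a i s)"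
proof (cases "s i")
  case (Cons w ws)
  then show ?thesis using assms bd_token[OF assms(1,2) Cons]
      sum_length_update[OF assms(2), of s "(a # w) # ws"]
    by (auto simp: emit_def bd_def le_SucI)
qed (use assms in \<open>auto simp add: emit_def intro: bd_mono\<close>)

lemma ptime_skip [intro]: "ptime K [:0, 1:] skip"
  by (rule ptimeI[of _ Skip _ _ 0]) (auto simp: skip_def intro: ex.Skip)

lemma enc_Cons: "i < K \<Longrightarrow> s i = w # ws \<Longrightarrow> enc K s i = w @ Sep # word ws"
  by (simp add: enc_def)

lemma ex_xfer_token:
  assumes "bd K B s" "i < K" "s i = w # ws"
  shows "ex (xfer {Sep} i K) (enc K s) (5 * length w + 1) ((enc K s)(i := Sep # word ws, K := rev w))"
  using ex_xfer[of i K "enc K s" w "Sep # word ws" "{Sep}"] bd_token[OF assms] assms(2,3)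
  by (simp add: enc_Cons) (simp add: enc_def)

lemma ex_xfer_Nil:
  assumes "i < K" "s i = []"
  shows "ex (xfer S i K) (enc K s) 1 (enc K s)"
proof -
  have "(enc K s)(i := [], K := rev [] @ enc K s K) = enc K s"
    using assms by (auto simp: enc_def)
  then show ?thesis using ex_xfer[of i K "enc K s" "[]" "[]" S] assms by (simp add: enc_def)
qed

text \<open>The token travels through tape \<open>K\<close> in order to arrive unreversed. After the
  first transfer a separator on top of stack \<open>i\<close> tells that the stack was nonempty,
  even if the token was empty.\<close>

lemma ptime_move:
  assumes "i < K" "j < K" "i \<noteq> j"
  shows "ptime K [:0, 1:] (move i j)"
proof -
  define c where "c = Seq (xfer {Sep} i K) (Cond (\<lambda>t. t i = Some Sep)
    (Seq (Pop i) (Seq (Push j (\<lambda>_. Sep)) (xfer {} K j))) Skip)"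
  have "uses_below (K + 2) c" using assms by (simp add: c_def xfer_def)
  then show ?thesis
  proof (rule ptimeI[of _ _ _ _ "[:10, 10:]"])
    fix B s assume b: "bd K B s"
    then show "bd K (poly [:0, 1:] B) (move i j s)" using bd_move[OF b assms] by simp
    show "\<exists>t \<le> poly [:10, 10:] B. ex c (enc K s) t (enc K (move i j s))"
    proof (cases "s i")
      case Nil
      have "ex c (enc K s) (1 + (0 + 1)) (enc K (move i j s))"
        unfolding c_def
        by (rule ex.Seq[OF ex_xfer_Nil[of i K s, OF assms(1) Nil]], rule ex.CondF)
          (use Nil assms in \<open>auto simp: enc_def move_def intro: ex.Skip\<close>)
      moreover have "1 + (0 + 1) \<le> poly [:10, 10:] B" by simp
      ultimately show ?thesis by blast
    next
      case (Cons w ws)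
      let ?s1 = "(enc K s)(i := Sep # word ws, K := rev w)"
      let ?s2 = "(enc K s)(i := word ws, K := rev w)"
      let ?s3 = "(enc K s)(i := word ws, K := rev w, j := Sep # enc K s j)"
      have 1: "ex (xfer {Sep} i K) (enc K s) (5 * length w + 1) ?s1"
        by (rule ex_xfer_token[OF b assms(1) Cons])
      have "?s1(i := tl (?s1 i)) = ?s2" using assms by auto
      then have 2: "ex (Pop i) ?s1 1 ?s2" using ex.Pop[of i ?s1] by simp
      have "?s2(j := Sep # ?s2 j) = ?s3" using assms by auto
      then have 3: "ex (Push j (\<lambda>_. Sep)) ?s2 2 ?s3" using ex.Push[of j "\<lambda>_. Sep" ?s2] by simp
      have e: "?s3(K := [], j := rev (rev w) @ ?s3 j) = enc K (move i j s)"
        using assms Cons by (auto simp: enc_def move_def fun_eq_iff)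
      have 4: "ex (xfer {} K j) ?s3 (5 * length w + 1) (enc K (move i j s))"
        using ex_xfer[of K j ?s3 "rev w" "[]" "{}"] assms unfolding e by simp
      have "ex c (enc K s) (5 * length w + 1 + (1 + (2 + (5 * length w + 1)) + 2))
          (enc K (move i j s))"
        unfolding c_def
        by (rule ex.Seq[OF 1], rule ex.CondT, use assms in simp, intro ex.Seq[OF 2] ex.Seq[OF 3] 4)
      moreover have "5 * length w + 1 + (1 + (2 + (5 * length w + 1)) + 2) \<le> poly [:10, 10:] B"
        using bd_token[OF b assms(1) Cons] by simp
      ultimately show ?thesis by blast
    qed
  qed
qed

lemma ptime_copy:
  assumes "i < K" "j < K" "i \<noteq> j"
  shows "ptime K [:1, 1:] (copy i j)"
proof -
  define c where "c = Seq (xfer {Sep} i K) (Cond (\<lambda>t. t i = Some Sep)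
    (Seq (Push j (\<lambda>_. Sep)) (spread K i j)) Skip)"
  have "uses_below (K + 2) c" using assms by (simp add: c_def xfer_def spread_def)
  then show ?thesis
  proof (rule ptimeI[of _ _ _ _ "[:10, 12:]"])
    fix B s assume b: "bd K B s"
    then show "bd K (poly [:1, 1:] B) (copy i j s)" using bd_copy[OF b] assms by simp
    show "\<exists>t \<le> poly [:10, 12:] B. ex c (enc K s) t (enc K (copy i j s))"
    proof (cases "s i")
      case Nil
      have "ex c (enc K s) (1 + (0 + 1)) (enc K (copy i j s))"
        unfolding c_def
        by (rule ex.Seq[OF ex_xfer_Nil[of i K s, OF assms(1) Nil]], rule ex.CondF)
          (use Nil assms in \<open>auto simp: enc_def copy_def intro: ex.Skip\<close>)
      moreover have "1 + (0 + 1) \<le> poly [:10, 12:] B" by simp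
      ultimately show ?thesis by blast
    next
      case (Cons w ws)
      let ?s1 = "(enc K s)(i := Sep # word ws, K := rev w)"
      let ?s3 = "(enc K s)(i := Sep # word ws, K := rev w, j := Sep # enc K s j)"
      have 1: "ex (xfer {Sep} i K) (enc K s) (5 * length w + 1) ?s1"
        by (rule ex_xfer_token[OF b assms(1) Cons])
      have "?s1(j := Sep # ?s1 j) = ?s3" using assms by auto
      then have 3: "ex (Push j (\<lambda>_. Sep)) ?s1 2 ?s3" using ex.Push[of j "\<lambda>_. Sep" ?s1] by simp
      have e: "?s3(K := [], i := rev (rev w) @ ?s3 i, j := rev (rev w) @ ?s3 j) = enc K (copy i j s)"
        using assms Cons by (auto simp: enc_def copy_def fun_eq_iff)
      have 4: "ex (spread K i j) ?s3 (7 * length w + 1) (enc K (copy i j s))"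
        using ex_spread[of i j K ?s3 "rev w"] assms unfolding e by simp
      have "ex c (enc K s) (5 * length w + 1 + (2 + (7 * length w + 1) + 2)) (enc K (copy i j s))"
        unfolding c_def
        by (rule ex.Seq[OF 1], rule ex.CondT, use assms in simp, intro ex.Seq[OF 3] 4)
      moreover have "5 * length w + 1 + (2 + (7 * length w + 1) + 2) \<le> poly [:10, 12:] B"
        using bd_token[OF b assms(1) Cons] by simp
      ultimately show ?thesis by blast
    qed
  qed
qed

lemma ptime_new:
  assumes "i < K"
  shows "ptime K [:1, 1:] (new i)"
proof (rule ptimeI[of _ "Push i (\<lambda>_. Sep)" _ _ "[:2:]"])
  fix B s assume b: "bd K B s"
  then show "bd K (poly [:1, 1:] B) (new i s)" using bd_push[OF b assms, of "[]"] by (simp add: new_def)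
  have "(enc K s)(i := Sep # enc K s i) = enc K (new i s)"
    using assms by (auto simp: enc_def new_def)
  then show "\<exists>t \<le> poly [:2:] B. ex (Push i (\<lambda>_. Sep)) (enc K s) t (enc K (new i s))"
    using ex.Push[of i "\<lambda>_. Sep" "enc K s"] by (intro exI[of _ 2]) simp
qed (use assms in simp)

text \<open>On an empty stack the pushed symbol would form a token without a separator, hence the
  test.\<close>

lemma ptime_emit:
  assumes "i < K" "a \<noteq> Sep"
  shows "ptime K [:1, 1:] (emit a i)"
proof (rule ptimeI[of _ "Cond (\<lambda>t. t i = None) Skip (Push i (\<lambda>_. a))" _ _ "[:3:]"])
  fix B s assume b: "bd K B s"
  then show "bd K (poly [:1, 1:] B) (emit a i s)" using bd_emit[OF b assms] by simp
  show "\<exists>t \<le> poly [:3:] B.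
      ex (Cond (\<lambda>t. t i = None) Skip (Push i (\<lambda>_. a))) (enc K s) t (enc K (emit a i s))"
  proof (cases "s i")
    case Nil
    then have "ex (Cond (\<lambda>t. t i = None) Skip (Push i (\<lambda>_. a))) (enc K s) (0 + 2) (enc K (emit a i s))"
      by (intro ex.CondT) (auto simp: enc_def emit_def intro: ex.Skip)
    then show ?thesis by (intro exI[of _ "0 + 2"]) auto
  next
    case (Cons w ws)
    have "(enc K s)(i := a # enc K s i) = enc K (emit a i s)"
      using assms Cons by (auto simp: enc_def emit_def)
    then have "ex (Cond (\<lambda>t. t i = None) Skip (Push i (\<lambda>_. a))) (enc K s) (2 + 1) (enc K (emit a i s))"
      using ex.Push[of i "\<lambda>_. a" "enc K s"] Cons assms(1)
      by (intro ex.CondF) (auto simp: enc_def)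
    then show ?thesis by (intro exI[of _ "2 + 1"]) auto
  qed
qed (use assms in simp)

section \<open>Closure under composition, and polynomial-time tests\<close>

lemma ptime_andthen:
  assumes "ptime K q f" "ptime K r g"
  shows "ptime K (pcompose r q) (f ;; g)"
proof -
  obtain c p where 1: "uses_below (K + 2) c"
    "\<And>B s. bd K B s \<Longrightarrow> bd K (poly q B) (f s)"
    "\<And>B s. bd K B s \<Longrightarrow> \<exists>t \<le> poly p B. ex c (enc K s) t (enc K (f s))"
    using assms(1) by (rule ptimeE) (rule that)
  obtain d p' where 2: "uses_below (K + 2) d"
    "\<And>B s. bd K B s \<Longrightarrow> bd K (poly r B) (g s)"
    "\<And>B s. bd K B s \<Longrightarrow> \<exists>t \<le> poly p' B. ex d (enc K s) t (enc K (g s))"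
    using assms(2) by (rule ptimeE) (rule that)
  show ?thesis
  proof (rule ptimeI[of _ "Seq c d" _ _ "p + pcompose p' q"])
    fix B s assume b: "bd K B s"
    show "bd K (poly (pcompose r q) B) ((f ;; g) s)"
      using 2(2)[OF 1(2)[OF b]] by (simp add: andthen_def poly_pcompose)
    show "\<exists>t \<le> poly (p + pcompose p' q) B. ex (Seq c d) (enc K s) t (enc K ((f ;; g) s))"
      using 1(3)[OF b] 2(3)[OF 1(2)[OF b]]
      by (auto simp: andthen_def poly_pcompose intro: ex.Seq add_mono)
  qed (use 1 2 in simp)
qed

lemma ptime_andthen_additive:
  assumes "ptime K [:k, 1:] f" "ptime K [:l, 1:] g"
  shows "ptime K [:k + l, 1:] (f ;; g)"
  using ptime_andthen[OF assms] by (simp add: pcompose_pCons add.commute)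

text \<open>A test is specified by its use in branching, which admits tests that must rewrite tapes
  before the answer is known, such as equality of tokens. Boolean connectives then reduce to nested
  branches.\<close>

definition ptest :: "nat \<Rightarrow> (state \<Rightarrow> bool) \<Rightarrow> bool" where
  "ptest K P \<longleftrightarrow> (\<forall>q f g. ptime K q f \<longrightarrow> ptime K q g \<longrightarrow> ptime K q (branch P f g))"

lemma ptime_branch: "ptest K P \<Longrightarrow> ptime K q f \<Longrightarrow> ptime K q g \<Longrightarrow> ptime K q (branch P f g)"
  by (simp add: ptest_def)

lemma ptest_not:
  assumes "ptest K P"
  shows "ptest K (\<lambda>s. \<not> P s)"
proof -
  have "branch (\<lambda>s. \<not> P s) f g = branch P g f" for f g by (auto simp: branch_def)
  then show ?thesis using assms by (simp add: ptest_def)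
qed

lemma ptest_conj:
  assumes "ptest K P" "ptest K Q"
  shows "ptest K (\<lambda>s. P s \<and> Q s)"
proof -
  have "branch (\<lambda>s. P s \<and> Q s) f g = branch P (branch Q f g) g" for f g by (auto simp: branch_def)
  then show ?thesis using assms by (simp add: ptest_def)
qed

lemma ptest_disj:
  assumes "ptest K P" "ptest K Q"
  shows "ptest K (\<lambda>s. P s \<or> Q s)"
proof -
  have "branch (\<lambda>s. P s \<or> Q s) f g = branch P f (branch Q f g)" for f g by (auto simp: branch_def)
  then show ?thesis using assms by (simp add: ptest_def)
qed

lemma ptest_peeks:
  assumes "\<And>B s. bd K B s \<Longrightarrow> P s \<longleftrightarrow> Q (peeks (enc K s))"
  shows "ptest K P"
  unfolding ptest_def
proof (intro allI impI)
  fix q f g assume f: "ptime K q f" and g: "ptime K q g"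
  obtain c p where 1: "uses_below (K + 2) c"
    "\<And>B s. bd K B s \<Longrightarrow> bd K (poly q B) (f s)"
    "\<And>B s. bd K B s \<Longrightarrow> \<exists>t \<le> poly p B. ex c (enc K s) t (enc K (f s))"
    using f by (rule ptimeE) (rule that)
  obtain d p' where 2: "uses_below (K + 2) d"
    "\<And>B s. bd K B s \<Longrightarrow> bd K (poly q B) (g s)"
    "\<And>B s. bd K B s \<Longrightarrow> \<exists>t \<le> poly p' B. ex d (enc K s) t (enc K (g s))"
    using g by (rule ptimeE) (rule that)
  show "ptime K q (branch P f g)"
  proof (rule ptimeI[of _ "Cond Q c d" _ _ "p + p' + [:2:]"])
    fix B s assume b: "bd K B s"
    then show "bd K (poly q B) (branch P f g s)" using 1(2) 2(2) by (simp add: branch_def)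
    obtain t t' where t: "t \<le> poly p B" "ex c (enc K s) t (enc K (f s))"
      "t' \<le> poly p' B" "ex d (enc K s) t' (enc K (g s))"
      using 1(3)[OF b] 2(3)[OF b] by blast
    have "ex (Cond Q c d) (enc K s) (if P s then t + 2 else t' + 1) (enc K (branch P f g s))"
    proof (cases "P s")
      case True
      then show ?thesis using t ex.CondT[of Q "enc K s" c t] assms[OF b] by (simp add: branch_def)
    next
      case False
      then show ?thesis using t ex.CondF[of Q "enc K s" d t'] assms[OF b] by (simp add: branch_def)
    qed
    then show "\<exists>t \<le> poly (p + p' + [:2:]) B. ex (Cond Q c d) (enc K s) t (enc K (branch P f g s))"
      by (intro exI conjI) (use t in \<open>auto split: if_splits\<close>)
  qed (use 1 2 in simp)
qed

lemma ptest_empty: "i < K \<Longrightarrow> ptest K (\<lambda>s. s i = [])"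
  by (rule ptest_peeks[of _ _ "\<lambda>t. t i = None"]) (simp add: enc_def)

text \<open>A token contains no separator, so a separator on top can only be the end of an empty
  token.\<close>

lemma ptest_empty_token:
  assumes "i < K"
  shows "ptest K (\<lambda>s. peek (s i) = Some [])"
proof (rule ptest_peeks[of _ _ "\<lambda>t. t i = Some Sep"])
  fix B s assume b: "bd K B s"
  show "peek (s i) = Some [] \<longleftrightarrow> peeks (enc K s) i = Some Sep"
  proof (cases "s i")
    case (Cons w ws)
    then show ?thesis using bd_token[OF b assms Cons] assms by (cases w) (auto simp: enc_def)
  qed (use assms in \<open>simp add: enc_def\<close>)
qed

lemma peek_append: "peek (xs @ y # ys) = Some (if xs = [] then y else hd xs)"
  by (cases xs) auto

lemma common_prefix:
  "\<exists>w u v. xs = w @ u \<and> ys = w @ v \<and> (u = [] \<or> v = [] \<or> hd u \<noteq> hd v)"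
proof (induction xs arbitrary: ys)
  case (Cons x xs)
  show ?case
  proof (cases "ys \<noteq> [] \<and> hd ys = x")
    case True
    then obtain ys' where ys: "ys = x # ys'" by (cases ys) auto
    obtain w u v where "xs = w @ u \<and> ys' = w @ v \<and> (u = [] \<or> v = [] \<or> hd u \<noteq> hd v)"
      using Cons.IH by blast
    then show ?thesis unfolding ys by (intro exI[of _ "x # w"] exI[of _ u] exI[of _ v]) auto
  next
    case False
    then show ?thesis by (intro exI[of _ "[]"] exI[of _ "x # xs"] exI[of _ ys]) auto
  qed
qed simp

text \<open>The separator acts as an end marker: if one token is a proper prefix of the other, the
  separator meets a different symbol. So once the common prefix is gone, the two top symbols decide
  equality.\<close>

lemma enc_common_prefix:
  assumes "bd K B s" "i < K" "j < K"
  shows "\<exists>w r r'. enc K s i = w @ r \<and> enc K s j = w @ r' \<and> Sep \<notin> set w \<and> length w \<le> B \<and>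
    (peek r = None \<or> peek r = Some Sep \<or> peek r \<noteq> peek r') \<and>
    (peek r = peek r' \<longleftrightarrow> peek (s i) = peek (s j))"
proof (cases "s i = [] \<or> s j = []")
  case True
  then show ?thesis
    by (intro exI[of _ "[]"] exI[of _ "enc K s i"] exI[of _ "enc K s j"])
      (cases "s i"; cases "s j"; use assms in \<open>auto simp: enc_def\<close>)
next
  case False
  then obtain x xs y ys where s: "s i = x # xs" "s j = y # ys" by (meson neq_Nil_conv)
  obtain w u v where w: "x = w @ u" "y = w @ v" "u = [] \<or> v = [] \<or> hd u \<noteq> hd v"
    using common_prefix by blast
  have x: "length x \<le> B" "Sep \<notin> set x" using bd_token[OF assms(1,2) s(1)] by auto
  have y: "Sep \<notin> set y" using bd_token[OF assms(1,3) s(2)] by auto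
  have "hd u \<noteq> Sep" if "u \<noteq> []" using that x(2) w(1) hd_in_set[of u] by (metis UnI2 set_append)
  moreover have "hd v \<noteq> Sep" if "v \<noteq> []"
    using that y w(2) hd_in_set[of v] by (metis UnI2 set_append)
  ultimately show ?thesis
    by (intro exI[of _ w] exI[of _ "u @ Sep # word xs"] exI[of _ "v @ Sep # word ys"])
      (use assms s w x in \<open>cases "u = []"; cases "v = []"; auto simp: enc_def peek_append\<close>)
qed

lemma ptest_eq:
  assumes "i < K" "j < K" "i \<noteq> j"
  shows "ptest K (\<lambda>s. peek (s i) = peek (s j))"
  unfolding ptest_def
proof (intro allI impI)
  let ?P = "\<lambda>s :: state. peek (s i) = peek (s j)"
  fix q f g assume f: "ptime K q f" and g: "ptime K q g"
  obtain c p where 1: "uses_below (K + 2) c"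
    "\<And>B s. bd K B s \<Longrightarrow> bd K (poly q B) (f s)"
    "\<And>B s. bd K B s \<Longrightarrow> \<exists>t \<le> poly p B. ex c (enc K s) t (enc K (f s))"
    using f by (rule ptimeE) (rule that)
  obtain d p' where 2: "uses_below (K + 2) d"
    "\<And>B s. bd K B s \<Longrightarrow> bd K (poly q B) (g s)"
    "\<And>B s. bd K B s \<Longrightarrow> \<exists>t \<le> poly p' B. ex d (enc K s) t (enc K (g s))"
    using g by (rule ptimeE) (rule that)
  \<comment> \<open>The verdict must survive while both stacks are restored from tape
    \<open>K\<close>; this is the purpose of the second scratch tape.\<close>
  define F where "F = K + 1"
  define fin where "fin = Cond (\<lambda>t. t F = Some One) (Seq (Pop F) c) (Seq (Pop F) d)"
  define e where "e = Seq (strip_common K i j) (Seq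
    (Cond (\<lambda>t. t i = t j) (Push F (\<lambda>_. One)) (Push F (\<lambda>_. Zero))) (Seq (spread K i j) fin))"
  have F: "F \<noteq> i" "F \<noteq> j" "F \<noteq> K" using assms by (auto simp: F_def)
  show "ptime K q (branch ?P f g)"
  proof (rule ptimeI[of _ e _ _ "p + p' + [:20, 20:]"])
    fix B s assume b: "bd K B s"
    then show "bd K (poly q B) (branch ?P f g s)" using 1(2) 2(2) by (simp add: branch_def)
    obtain t t' where t: "t \<le> poly p B" "ex c (enc K s) t (enc K (f s))"
      "t' \<le> poly p' B" "ex d (enc K s) t' (enc K (g s))"
      using 1(3)[OF b] 2(3)[OF b] by blast
    obtain w r r' where w: "enc K s i = w @ r" "enc K s j = w @ r'" "Sep \<notin> set w" "length w \<le> B"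
      "peek r = None \<or> peek r = Some Sep \<or> peek r \<noteq> peek r'" "peek r = peek r' \<longleftrightarrow> ?P s"
      using enc_common_prefix[OF b assms(1,2)] by blast
    let ?s1 = "(enc K s)(K := rev w, i := r, j := r')"
    define b where "b = (if ?P s then One else Zero)"
    let ?s2 = "(enc K s)(K := rev w, i := r, j := r', F := [b])"
    let ?s3 = "(enc K s)(F := [b])"
    have encK: "enc K s K = []" "enc K s F = []" by (simp_all add: enc_def F_def)
    have a: "ex (strip_common K i j) (enc K s) (6 * length w + 1) ?s1"
      using ex_strip_common[of i j K "enc K s" w r r'] assms w encK by simp
    have p: "ex (Push F (\<lambda>_. x)) ?s1 2 (?s1(F := [x]))" for x
      using ex.Push[of F "\<lambda>_. x" ?s1] encK F by simp
    have bb: "ex (Cond (\<lambda>t. t i = t j) (Push F (\<lambda>_. One)) (Push F (\<lambda>_. Zero))) ?s1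
        (if ?P s then 2 + 2 else 2 + 1) ?s2"
    proof (cases "?P s")
      case True
      then have "ex (Cond (\<lambda>t. t i = t j) (Push F (\<lambda>_. One)) (Push F (\<lambda>_. Zero))) ?s1 (2 + 2) ?s2"
        by (intro ex.CondT) (use p[of One] w(6) assms in \<open>auto simp: b_def\<close>)
      then show ?thesis using True by simp
    next
      case False
      then have "ex (Cond (\<lambda>t. t i = t j) (Push F (\<lambda>_. One)) (Push F (\<lambda>_. Zero))) ?s1 (2 + 1) ?s2"
        by (intro ex.CondF) (use p[of Zero] w(6) assms in \<open>auto simp: b_def\<close>)
      then show ?thesis using False by simp
    qed
    have eq: "?s2(K := [], i := rev (rev w) @ ?s2 i, j := rev (rev w) @ ?s2 j) = ?s3"
      using assms w F encK by (auto simp: fun_eq_iff)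
    have cc: "ex (spread K i j) ?s2 (7 * length w + 1) ?s3"
      using ex_spread[of i j K ?s2 "rev w"] assms F unfolding eq by simp
    have "?s3(F := tl (?s3 F)) = enc K s" using encK by auto
    then have pop: "ex (Pop F) ?s3 1 (enc K s)" using ex.Pop[of F ?s3] by simp
    have dd: "ex fin ?s3 (if ?P s then 1 + t + 2 else 1 + t' + 1) (enc K (branch ?P f g s))"
    proof (cases "?P s")
      case True
      then have "ex fin ?s3 (1 + t + 2) (enc K (f s))"
        unfolding fin_def by (intro ex.CondT ex.Seq[OF pop]) (use t in \<open>auto simp: b_def\<close>)
      then show ?thesis using True by (simp add: branch_def)
    next
      case False
      then have "ex fin ?s3 (1 + t' + 1) (enc K (g s))"
        unfolding fin_def by (intro ex.CondF ex.Seq[OF pop]) (use t in \<open>auto simp: b_def\<close>)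
      then show ?thesis using False by (simp add: branch_def)
    qed
    have "ex e (enc K s) (6 * length w + 1 + ((if ?P s then 2 + 2 else 2 + 1) +
        (7 * length w + 1 + (if ?P s then 1 + t + 2 else 1 + t' + 1)))) (enc K (branch ?P f g s))"
      unfolding e_def by (intro ex.Seq[OF a] ex.Seq[OF bb] ex.Seq[OF cc] dd)
    moreover have "6 * length w + 1 + ((if ?P s then 2 + 2 else 2 + 1) +
        (7 * length w + 1 + (if ?P s then 1 + t + 2 else 1 + t' + 1))) \<le> poly (p + p' + [:20, 20:]) B"
      using t w(4) by auto
    ultimately show "\<exists>t \<le> poly (p + p' + [:20, 20:]) B. ex e (enc K s) t (enc K (branch ?P f g s))"
      by blast
  qed (use 1 2 assms in \<open>auto simp: e_def fin_def F_def strip_common_def spread_def\<close>)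
qed

text \<open>
  The loop runs while stack \<open>i\<close> is nonempty. It is a total function since, for the bodies in use,
  every iteration shortens that stack.
\<close>

definition loop :: "nat \<Rightarrow> nat \<Rightarrow> (state \<Rightarrow> state) \<Rightarrow> state \<Rightarrow> state" where
  "loop i j f s = ((\<lambda>s. if s i = [] then s else f (move i j s)) ^^ length (s i)) s"

definition keeps_length :: "nat \<Rightarrow> (state \<Rightarrow> state) \<Rightarrow> bool" where
  "keeps_length i f \<longleftrightarrow> (\<forall>s. length (f s i) \<le> length (s i))"

lemma loop_Nil [simp]: "s i = [] \<Longrightarrow> loop i j f s = s"
  by (simp add: loop_def)

lemma length_move_less: "s i \<noteq> [] \<Longrightarrow> i \<noteq> j \<Longrightarrow> length (move i j s i) < length (s i)"
  by (cases "s i") (auto simp: move_def)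

text \<open>Iterations on an empty stack change nothing, so all iteration counts from the length of
  the stack on give the same result. This turns the fixed count in \<open>loop\<close> into the
  unfolding rule of a while loop, although the body may shorten the stack further.\<close>

lemma loop_step:
  assumes "keeps_length i f" "i \<noteq> j" "s i \<noteq> []"
  shows "loop i j f s = loop i j f (f (move i j s))"
proof -
  define h where "h = (\<lambda>s :: state. if s i = [] then s else f (move i j s))"
  have stop: "(h ^^ n) s = s" if "s i = []" for n s
    using that by (induction n) (auto simp: h_def)
  have dec: "length (h s i) < length (s i)" if "s i \<noteq> []" for s
  proof -
    have "length (f (move i j s) i) \<le> length (move i j s i)"
      using assms(1) by (simp add: keeps_length_def)
    then show ?thesis using length_move_less[of s i j, OF that assms(2)] that by (simp add: h_def)
  qed
  have eq: "(h ^^ n) s = (h ^^ m) s" if "length (s i) \<le> n" "length (s i) \<le> m" for n m s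
    using that
  proof (induction n arbitrary: m s)
    case (Suc n)
    show ?case
    proof (cases "s i = []")
      case False
      then obtain m' where m: "m = Suc m'" using Suc.prems by (cases m) auto
      then have "(h ^^ n) (h s) = (h ^^ m') (h s)"
        using Suc.IH[of "h s" m'] Suc.prems dec[of s, OF False] by linarith
      then show ?thesis by (simp add: m funpow_swap1)
    qed (simp only: stop)
  qed (simp add: stop)
  obtain l where l: "length (s i) = Suc l" using assms(3) by (cases "s i") auto
  have "loop i j f s = (h ^^ l) (h s)"
    by (simp add: loop_def l h_def[symmetric] funpow_swap1)
  also have "\<dots> = (h ^^ length (h s i)) (h s)"
    using dec[of s, OF assms(3)] l by (intro eq) auto
  also have "\<dots> = loop i j f (h s)" by (simp add: loop_def h_def[symmetric])
  finally show ?thesis using assms(3) by (simp add: h_def)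
qed

text \<open>There are at most \<open>B\<close> iterations and each adds at most \<open>k\<close> to
  the bound, which gives \<open>B + k * B\<close>. For \<open>k > 0\<close> the result no longer has
  the additive form of the hypothesis; for \<open>k = 0\<close> it has, so such loops can be
  nested.\<close>

lemma ptime_loop:
  assumes "ptime K [:k, 1:] f" "keeps_length i f" "i < K" "j < K" "i \<noteq> j"
  shows "ptime K [:0, Suc k:] (loop i j f)"
proof -
  have "ptime K [:k, 1:] (move i j ;; f)"
    using ptime_andthen_additive[OF ptime_move[OF assms(3-5)] assms(1)] by simp
  then obtain c p where c: "uses_below (K + 2) c"
    "\<And>B s. bd K B s \<Longrightarrow> bd K (poly [:k, 1:] B) ((move i j ;; f) s)"
    "\<And>B s. bd K B s \<Longrightarrow> \<exists>t \<le> poly p B. ex c (enc K s) t (enc K ((move i j ;; f) s))"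
    by (rule ptimeE) (rule that)
  \<comment> \<open>The bound refers to the current length of stack \<open>i\<close>: an iteration
    raises \<open>B\<close> by \<open>k\<close>, and the shorter stack pays for it.\<close>
  have main: "bd K (B + k * length (s i)) (loop i j f s) \<and>
      (\<exists>t \<le> length (s i) * (poly p (B + k * length (s i)) + 2) + 1.
        ex (While (\<lambda>t. t i \<noteq> None) c) (enc K s) t (enc K (loop i j f s)))" if "bd K B s" for B s
    using that
  proof (induction "length (s i)" arbitrary: B s rule: less_induct)
    case less
    show ?case
    proof (cases "s i = []")
      case True
      then have "ex (While (\<lambda>t. t i \<noteq> None) c) (enc K s) 1 (enc K s)"
        using assms(3) by (intro ex.WhileF) (simp add: enc_def)
      then show ?thesis using True less.prems by auto
    next
      case False
      let ?s' = "f (move i j s)"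
      let ?l = "length (s i)" and ?l' = "length (?s' i)"
      have l: "Suc ?l' \<le> ?l"
        using assms(2) length_move_less[of s i j, OF False assms(5)] le_less_trans
        unfolding keeps_length_def Suc_le_eq by blast
      have b': "bd K (B + k) ?s'" using c(2)[OF less.prems] by (simp add: andthen_def add.commute)
      obtain t where t: "t \<le> poly p B" "ex c (enc K s) t (enc K ?s')"
        using c(3)[OF less.prems] by (auto simp: andthen_def)
      obtain t' where t': "bd K (B + k + k * ?l') (loop i j f ?s')"
          "t' \<le> ?l' * (poly p (B + k + k * ?l') + 2) + 1"
          "ex (While (\<lambda>t. t i \<noteq> None) c) (enc K ?s') t' (enc K (loop i j f ?s'))"
        using less.hyps[of ?s' "B + k"] l b' by auto
      have "k * Suc ?l' \<le> k * ?l" using l by (rule mult_le_mono2)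
      then have le: "B + k + k * ?l' \<le> B + k * ?l" by simp
      have "t + t' + 2 \<le> poly p (B + k * ?l) + (?l' * (poly p (B + k * ?l) + 2) + 1) + 2"
        using t(1) poly_nat_mono[of B "B + k * ?l" p] t'(2)
          mult_le_mono2[OF add_le_mono1[OF poly_nat_mono[OF le, of p]], of ?l' 2]
        by linarith
      also have "\<dots> = Suc ?l' * (poly p (B + k * ?l) + 2) + 1" by simp
      also have "\<dots> \<le> ?l * (poly p (B + k * ?l) + 2) + 1"
        using mult_le_mono1[OF l, of "poly p (B + k * ?l) + 2"] by simp
      finally have "t + t' + 2 \<le> ?l * (poly p (B + k * ?l) + 2) + 1" .
      moreover have "ex (While (\<lambda>t. t i \<noteq> None) c) (enc K s) (t + t' + 2) (enc K (loop i j f ?s'))"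
        using False assms(3) by (intro ex.WhileT[OF _ t(2) t'(3)]) (simp add: enc_def)
      ultimately show ?thesis
        using bd_mono[OF t'(1) le] loop_step[of i f j s, OF assms(2,5) False] by auto
    qed
  qed
  show ?thesis
  proof (rule ptimeI[of _ "While (\<lambda>t. t i \<noteq> None) c" _ _
        "[:0, 1:] * (pcompose p [:0, Suc k:] + [:2:]) + [:1:]"])
    fix B s assume b: "bd K B s"
    let ?l = "length (s i)"
    have l: "?l \<le> B" by (rule bd_length[OF b assms(3)])
    then have le: "B + k * ?l \<le> B * Suc k" using mult_le_mono2[OF l, of k] by (simp add: mult.commute)
    show "bd K (poly [:0, Suc k:] B) (loop i j f s)"
      using main[OF b] le by (auto intro: bd_mono)
    have "?l * (poly p (B + k * ?l) + 2) + 1 \<le> B * (poly p (B * Suc k) + 2) + 1"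
      using mult_le_mono[OF l add_le_mono1[OF poly_nat_mono[OF le, of p], of 2]] by linarith
    also have "\<dots> = poly ([:0, 1:] * (pcompose p [:0, Suc k:] + [:2:]) + [:1:]) B"
      by (simp add: poly_pcompose)
    finally show "\<exists>t \<le> poly ([:0, 1:] * (pcompose p [:0, Suc k:] + [:2:]) + [:1:]) B.
        ex (While (\<lambda>t. t i \<noteq> None) c) (enc K s) t (enc K (loop i j f s))"
      using main[OF b] order_trans by blast
  qed (use c in simp)
qed

lemma keeps_length_skip: "keeps_length i skip"
  by (simp add: keeps_length_def skip_def)

lemma keeps_length_move: "i \<noteq> b \<Longrightarrow> keeps_length i (move a b)"
  by (auto simp: keeps_length_def move_def split: list.splits)

lemma keeps_length_copy: "i \<noteq> b \<Longrightarrow> keeps_length i (copy a b)"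
  by (auto simp: keeps_length_def copy_def split: list.splits)

lemma keeps_length_new: "i \<noteq> b \<Longrightarrow> keeps_length i (new b)"
  by (auto simp: keeps_length_def new_def)

lemma keeps_length_andthen: "keeps_length i f \<Longrightarrow> keeps_length i g \<Longrightarrow> keeps_length i (f ;; g)"
  unfolding keeps_length_def andthen_def using le_trans by blast

lemma keeps_length_branch: "keeps_length i f \<Longrightarrow> keeps_length i g \<Longrightarrow> keeps_length i (branch P f g)"
  by (simp add: keeps_length_def branch_def)

lemma keeps_length_loop:
  assumes "keeps_length i f" "i \<noteq> b"
  shows "keeps_length i (loop a b f)"
proof -
  have g: "length ((if s a = [] then s else f (move a b s)) i) \<le> length (s i)" for s
  proof -
    have "length (f (move a b s) i) \<le> length (move a b s i)"
      "length (move a b s i) \<le> length (s i)"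
      using assms(1) keeps_length_move[OF assms(2)] by (auto simp: keeps_length_def)
    then show ?thesis by simp
  qed
  have "length (((\<lambda>s. if s a = [] then s else f (move a b s)) ^^ n) s i) \<le> length (s i)" for n s
  proof (induction n)
    case (Suc n)
    show ?case using le_trans[OF g[of "(_ ^^ n) s"] Suc.IH] by simp
  qed simp
  then show ?thesis by (simp add: keeps_length_def loop_def)
qed

lemmas keeps_length_intros = keeps_length_skip keeps_length_move keeps_length_copy keeps_length_new
  keeps_length_andthen keeps_length_branch keeps_length_loop

text \<open>Programs that create no tokens do not increase the size of the state, so their loops
  can be nested.\<close>

abbreviation ptime_pure :: "nat \<Rightarrow> (state \<Rightarrow> state) \<Rightarrow> bool" where
  "ptime_pure K \<equiv> ptime K [:0, 1:]"

lemma ptime_pure_andthen: "ptime_pure K f \<Longrightarrow> ptime_pure K g \<Longrightarrow> ptime_pure K (f ;; g)"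
  using ptime_andthen_additive[of K 0 f 0 g] by simp

lemma ptime_pure_loop:
  "ptime_pure K f \<Longrightarrow> keeps_length i f \<Longrightarrow> i < K \<Longrightarrow> j < K \<Longrightarrow> i \<noteq> j \<Longrightarrow> ptime_pure K (loop i j f)"
  using ptime_loop[of K 0 f i j] by simp

lemmas ptest_intros = ptest_not ptest_conj ptest_disj ptest_empty ptest_empty_token ptest_eq

lemmas ptime_pure_intros = ptime_skip ptime_move ptime_pure_andthen ptime_branch ptime_pure_loop
  ptest_intros keeps_length_intros

section \<open>Cyclic orders with few gaps\<close>

definition adj :: "('a \<times> 'a) list \<Rightarrow> 'a \<Rightarrow> 'a \<Rightarrow> bool" where
  "adj es u v \<longleftrightarrow> (u, v) \<in> set es \<or> (v, u) \<in> set es"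

lemma adj_sym: "adj es u v \<longleftrightarrow> adj es v u"
  by (auto simp: adj_def)

definition gap :: "('a \<times> 'a) list \<Rightarrow> 'a \<Rightarrow> 'a \<Rightarrow> nat" where
  "gap es u v = (if adj es u v then 0 else 1)"

lemma gap_sym: "gap es u v = gap es v u"
  by (simp add: gap_def adj_sym)

section \<open>Sums over consecutive pairs, and gaps of a cyclic order\<close>

fun psum :: "('a \<Rightarrow> 'a \<Rightarrow> nat) \<Rightarrow> 'a list \<Rightarrow> nat" where
  "psum f (x # y # r) = f x y + psum f (y # r)"
| "psum f _ = 0"

lemma psum_append: "psum f (xs @ y # ys) = psum f (xs @ [y]) + psum f (y # ys)"
proof (induction xs)
  case (Cons x xs)
  then show ?case by (cases xs) auto
qed simp

lemma psum_rev:
  assumes "\<And>x y. f x y = f y x"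
  shows "psum f (rev xs) = psum f xs"
proof (induction xs rule: induct_list012)
  case (3 x y r)
  have "psum f (rev (x # y # r)) = psum f (rev (y # r)) + f y x"
    using psum_append[of f "rev r" y "[x]"] by simp
  then show ?case using 3 assms by simp
qed simp_all

lemma psum_add: "psum (\<lambda>p q. f p q + g p q) xs = psum f xs + psum g xs"
  by (induction xs rule: induct_list012) auto

lemma psum_snd: "psum (\<lambda>p q. g q) (x # r) = sum_list (map g r)"
  by (induction r arbitrary: x) auto

lemma psum_fst: "psum (\<lambda>p q. g p) (r @ [y]) = sum_list (map g r)"
proof (induction r)
  case (Cons a r)
  then show ?case by (cases r) auto
qed simp

lemma psum_le:
  assumes "\<And>xs p q ys. c = xs @ p # q # ys \<Longrightarrow> f p q \<le> 1"
  shows "psum f c \<le> length c - 1"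
  using assms
proof (induction c rule: induct_list012)
  case (3 x y r)
  have "f x y \<le> 1" using "3.prems"[of "[]"] by simp
  moreover have "psum f (y # r) \<le> length (y # r) - 1"
  proof (rule "3.IH"(2))
    fix xs p q ys assume "y # r = xs @ p # q # ys"
    then show "f p q \<le> 1" using "3.prems"[of "x # xs"] by simp
  qed
  ultimately show ?case by simp
qed simp_all

definition gaps :: "('a \<times> 'a) list \<Rightarrow> 'a list \<Rightarrow> nat" where
  "gaps es c = psum (gap es) (c @ [hd c])"

lemma mset_rotate1: "mset (rotate1 c) = mset c"
  by (cases c) auto

lemma gaps_rotate1: "gaps es (rotate1 c) = gaps es c"
proof (cases c)
  case (Cons x r)
  then show ?thesis
    using psum_append[of "gap es" r x "[hd r]"] by (cases r) (auto simp: gaps_def)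
qed simp

lemma gaps_ends: "gaps es (x # r @ [y]) = psum (gap es) (x # r @ [y]) + gap es y x"
  using psum_append[of "gap es" "x # r" y "[x]"] by (simp add: gaps_def)

lemma gaps_le_length: "gaps es c \<le> length c"
proof -
  have "psum (gap es) (c @ [hd c]) \<le> length (c @ [hd c]) - 1"
    by (rule psum_le) (simp add: gap_def)
  then show ?thesis by (simp add: gaps_def)
qed

text \<open>The first conjunct confines reversals to orders with a gap between their ends, the
  situation of \<open>stuck_bound\<close>; any other order passes through a scan unchanged.\<close>

definition improves :: "('a \<times> 'a) list \<Rightarrow> 'a \<Rightarrow> 'a \<Rightarrow> 'a \<Rightarrow> 'a \<Rightarrow> bool" where
  "improves es x y p q \<longleftrightarrow>
     \<not> adj es y x \<and> gap es x q + gap es y p < gap es p q + gap es y x"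

text \<open>Since \<open>gap\<close> is symmetric, the reversed segment keeps its inner gaps, and
  only the two pairs at its ends matter.\<close>

lemma gaps_reverse_prefix:
  assumes "improves es x y p q"
  shows "gaps es (p # rev (x # r) @ q # r' @ [y]) < gaps es (x # r @ p # q # r' @ [y])"
proof -
  let ?f = "psum (gap es)"
  have 1: "?f (x # r @ p # q # r' @ [y]) = ?f (x # r @ [p]) + gap es p q + ?f (q # r' @ [y])"
    using psum_append[of "gap es" "x # r" p "q # r' @ [y]"] by simp
  have "?f (p # rev (x # r) @ q # r' @ [y]) =
      ?f (p # rev r @ [x]) + gap es x q + ?f (q # r' @ [y])"
    using psum_append[of "gap es" "p # rev r" x "q # r' @ [y]"] by simp
  moreover have "?f (p # rev r @ [x]) = ?f (x # r @ [p])"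
    using psum_rev[of "gap es" "x # r @ [p]", OF gap_sym] by simp
  ultimately show ?thesis
    using assms 1 gaps_ends[of es p "rev (x # r) @ q # r'" y] gaps_ends[of es x "r @ p # q # r'" y]
    by (simp add: improves_def)
qed

text \<open>One pass over the cyclic order \<open>x # rev P @ R @ [y]\<close>, where \<open>P\<close> has been passed.\<close>

fun scan :: "('a \<times> 'a) list \<Rightarrow> 'a \<Rightarrow> 'a \<Rightarrow> 'a list \<Rightarrow> 'a list \<Rightarrow> 'a \<times> 'a list" where
  "scan es y x P [] = (x, P)"
| "scan es y x P [p] = (x, p # P)"
| "scan es y x P (p # q # R) =
    (if improves es x y p q then scan es y p (x # rev P) (q # R) else scan es y x (p # P) (q # R))"

text \<open>Every reversal strictly lowers the number of gaps. If the number is the same in the end,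
  no reversal took place, so the order is unchanged and all pairs were tested against the same
  \<open>x\<close> and \<open>y\<close>.\<close>

lemma scan_correct:
  assumes "scan es y x P R = (x', P')"
  defines "c \<equiv> x # rev P @ R @ [y]" and "c' \<equiv> x' # rev P' @ [y]"
  shows "mset c' = mset c \<and> gaps es c' \<le> gaps es c \<and> (gaps es c' = gaps es c \<longrightarrow>
    c' = c \<and> (\<forall>R1 p q R2. R = R1 @ p # q # R2 \<longrightarrow> \<not> improves es x y p q))"
  using assms(1) unfolding c_def c'_def
proof (induction es y x P R arbitrary: x' P' rule: scan.induct)
  case (3 es y x P p q R)
  show ?case
  proof (cases "improves es x y p q")
    case True
    have "gaps es (x' # rev P' @ [y]) \<le> gaps es (p # rev (x # rev P) @ (q # R) @ [y])"
        "mset (x' # rev P' @ [y]) = mset (p # rev (x # rev P) @ (q # R) @ [y])"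
      using "3.IH"(1)[OF True, of x' P'] "3.prems" True by auto
    then show ?thesis using gaps_reverse_prefix[OF True, of "rev P" R] by auto
  next
    case False
    have "\<not> improves es x y p' q'"
      if "\<forall>R1 p' q' R2. q # R = R1 @ p' # q' # R2 \<longrightarrow> \<not> improves es x y p' q'"
        "p # q # R = R1 @ p' # q' # R2" for R1 p' q' R2 using that False by (cases R1) auto
    then show ?thesis using "3.IH"(2)[OF False, of x' P'] "3.prems" False by auto
  qed
qed (auto simp: Cons_eq_append_conv)

definition stuck :: "('a \<times> 'a) list \<Rightarrow> 'a list \<Rightarrow> bool" where
  "stuck es c \<longleftrightarrow> (\<forall>x y R1 p q R2. c = x # R1 @ p # q # R2 @ [y] \<longrightarrow> \<not> improves es x y p q)"

text \<open>The closing rotation makes the next sweep start at another place, so that successive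
  sweeps bring every pair of neighbours into the position of \<open>y x\<close>.\<close>

definition sweep :: "('a \<times> 'a) list \<Rightarrow> 'a list \<Rightarrow> 'a list" where
  "sweep es c = (case scan es (last c) (hd c) [] (butlast (tl c)) of
     (x, P) \<Rightarrow> rotate1 (x # rev P @ [last c]))"

lemma sweep_correct:
  assumes "2 \<le> length c"
  shows "mset (sweep es c) = mset c" "gaps es (sweep es c) \<le> gaps es c"
    "gaps es (sweep es c) = gaps es c \<Longrightarrow> sweep es c = rotate1 c \<and> stuck es c"
proof -
  obtain x r y where c: "c = x # r @ [y]"
    using assms by (cases c; cases "tl c" rule: rev_cases) auto
  obtain x' P' where s: "scan es y x [] r = (x', P')" by fastforce
  have "sweep es c = rotate1 (x' # rev P' @ [y])" using s c by (simp add: sweep_def)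
  then show "mset (sweep es c) = mset c" "gaps es (sweep es c) \<le> gaps es c"
    "gaps es (sweep es c) = gaps es c \<Longrightarrow> sweep es c = rotate1 c \<and> stuck es c"
    using scan_correct[OF s] c gaps_rotate1[of es "x' # rev P' @ [y]"]
    by (auto simp: stuck_def)
qed

definition degree_in :: "('a \<times> 'a) list \<Rightarrow> 'a list \<Rightarrow> 'a \<Rightarrow> nat" where
  "degree_in es c v = length (filter (adj es v) c)"

lemma length_filter_sum: "length (filter P xs) = sum_list (map (\<lambda>x. if P x then 1 else 0) xs)"
  by (induction xs) auto

text \<open>As in Ore's theorem, the degree of \<open>x\<close> is counted at the second and that of
  \<open>y\<close> at the first members of the consecutive pairs; irreflexivity ensures that the end
  missed in each count is no neighbour. The \<open>length - 1\<close> pairs contribute at most 1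
  each, and the gap \<open>y x\<close> is the remaining unit.\<close>

lemma stuck_bound:
  assumes "stuck es (x # r @ [y])" "\<not> adj es y x" "\<not> adj es x x" "\<not> adj es y y"
  shows "degree_in es (x # r @ [y]) x + degree_in es (x # r @ [y]) y + gaps es (x # r @ [y])
    \<le> length (x # r @ [y])"
proof -
  let ?c = "x # r @ [y]"
  let ?i = "\<lambda>b. if b then 1 else 0 :: nat"
  have "degree_in es ?c x = psum (\<lambda>p q. ?i (adj es x q)) ?c"
    unfolding psum_snd using assms(3) by (simp add: degree_in_def length_filter_sum)
  moreover have "degree_in es ?c y = psum (\<lambda>p q. ?i (adj es y p)) ?c"
    using psum_fst[of "\<lambda>p. ?i (adj es y p)" "x # r" y] assms(4)
    by (simp add: degree_in_def length_filter_sum)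
  moreover have "gaps es ?c = psum (gap es) ?c + 1"
    using assms(2) unfolding gaps_ends by (simp add: gap_def)
  moreover have "psum (\<lambda>p q. ?i (adj es x q) + ?i (adj es y p) + gap es p q) ?c \<le> length ?c - 1"
  proof (rule psum_le)
    fix xs p q ys assume c: "?c = xs @ p # q # ys"
    \<comment> \<open>The outermost pairs are not covered by \<open>stuck\<close>. There
      \<open>p = x\<close> or \<open>q = y\<close>, so one adjacency fails because
      \<open>y x\<close> is a gap, and the other one excludes a gap at \<open>p q\<close>.\<close>
    consider "xs = []" | "ys = []" | xs' ys' where "xs = x # xs'" "ys = ys' @ [y]"
    proof (cases xs; cases ys rule: rev_cases)
      fix a xs' ys' b assume "xs = a # xs'" "ys = ys' @ [b]"
      moreover from this have "a = x" "b = y"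
        using arg_cong[OF c, of hd] arg_cong[OF c, of last] by auto
      ultimately show ?thesis using that by simp
    qed (use that in auto)
    then show "?i (adj es x q) + ?i (adj es y p) + gap es p q \<le> 1"
    proof cases
      case 1
      then have "p = x" using c by simp
      then show ?thesis using assms(2) by (auto simp: gap_def)
    next
      case 2
      then have "q = y" using arg_cong[OF c, of last] by simp
      then show ?thesis using assms(2) adj_sym[of es x y] by (auto simp: gap_def adj_sym[of es y p])
    next
      case 3
      \<comment> \<open>With \<open>gap es y x = 1\<close>, failure of the inequality in
        \<open>improves\<close> says precisely that the three terms sum to at most 1.\<close>
      then have "\<not> improves es x y p q" using assms(1) c by (auto simp: stuck_def)
      then show ?thesis using assms(2)
        by (auto simp: improves_def gap_def split: if_splits)
    qed
  qed
  ultimately show ?thesis unfolding psum_add by simp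
qed

text \<open>The bound on \<open>k\<close> matters: it limits the number of sweeps that are needed to
  meet this rotation.\<close>

lemma gap_rotation:
  assumes "gaps es c > 0" "2 \<le> length c"
  shows "\<exists>k < length c. \<exists>x r y. rotate k c = x # r @ [y] \<and> \<not> adj es y x"
proof -
  have ends: "\<exists>x r y. xs = x # r @ [y]" if "2 \<le> length xs" for xs :: "'a list"
    using that by (cases xs; cases "tl xs" rule: rev_cases) auto
  obtain x r y where c: "c = x # r @ [y]" using ends[OF assms(2)] by blast
  show ?thesis
  proof (cases "adj es y x")
    case True
    then have pos: "psum (gap es) c > 0" using assms(1) unfolding c gaps_ends by (simp add: gap_def)
    have cl: "psum (gap es) xs = 0 \<or> (\<exists>as p q bs. xs = as @ p # q # bs \<and> \<not> adj es p q)" for xs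
    proof (induction xs rule: induct_list012)
      case (3 u v w)
      show ?case
      proof (cases "adj es u v")
        case True
        show ?thesis
        proof (cases "psum (gap es) (v # w) = 0")
          case False
          then obtain as p q bs where "v # w = as @ p # q # bs" "\<not> adj es p q"
            using "3.IH"(2) by metis
          then have "u # v # w = (u # as) @ p # q # bs \<and> \<not> adj es p q" by simp
          then show ?thesis by blast
        qed (use True in \<open>simp add: gap_def[of es u v]\<close>)
      next
        case False
        then show ?thesis by (metis append_Nil)
      qed
    qed simp_all
    obtain as p q bs where s: "c = as @ p # q # bs" "\<not> adj es p q" using cl[of c] pos by auto
    then have "rotate (length (as @ [p])) c = q # (bs @ as) @ [p]"
      using rotate_append[of "as @ [p]" "q # bs"] by simp
    moreover have "length (as @ [p]) < length c" using s by simp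
    ultimately show ?thesis using s(2) by blast
  next
    case False
    then show ?thesis using c assms(2) by (intro exI[of _ 0]) auto
  qed
qed

text \<open>If the number of gaps stays the same, each sweep was a mere rotation, so
  \<open>m\<close> sweeps show that \<open>m\<close> successive rotations of one order are
  stuck.\<close>

lemma sweeps_correct:
  assumes "2 \<le> length c"
  shows "mset ((sweep es ^^ m) c) = mset c" "gaps es ((sweep es ^^ m) c) \<le> gaps es c"
    "gaps es ((sweep es ^^ m) c) = gaps es c \<Longrightarrow>
      (sweep es ^^ m) c = rotate m c \<and> (\<forall>k<m. stuck es (rotate k c))"
proof (induction m)
  case (Suc m)
  let ?d = "(sweep es ^^ m) c"
  have l: "2 \<le> length ?d" using assms mset_eq_length[OF Suc(1)] by simp
  note r = sweep_correct[OF l, of es]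
  {
    case 1
    show ?case using r(1) Suc(1) by simp
  next
    case 2
    show ?case using r(2) Suc(2) by simp
  next
    case 3
    then have "gaps es (sweep es ?d) = gaps es ?d" "gaps es ?d = gaps es c"
      using r(2) Suc(2) by auto
    then show ?case using r(3) Suc(3) by (auto simp: less_Suc_eq)
  }
qed (use assms in auto)

text \<open>Otherwise all rotations of \<open>c\<close> are stuck, among them one with a gap between
  its ends, where \<open>stuck_bound\<close> contradicts the degrees.\<close>

lemma sweeps_decrease:
  assumes "2 \<le> length c" "length c \<le> m" "\<And>v. \<not> adj es v v"
    "\<And>v. v \<in> set c \<Longrightarrow> length c + 3 < 3 * degree_in es c v" "length c < 3 * gaps es c"
  shows "gaps es ((sweep es ^^ m) c) < gaps es c"
proof (rule ccontr)
  assume "\<not> gaps es ((sweep es ^^ m) c) < gaps es c"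
  then have "gaps es ((sweep es ^^ m) c) = gaps es c"
    using sweeps_correct(2)[OF assms(1), of es m] by simp
  then have st: "\<forall>k<m. stuck es (rotate k c)" using sweeps_correct(3)[OF assms(1)] by blast
  obtain k x r y where k: "k < length c" "rotate k c = x # r @ [y]" "\<not> adj es y x"
    using gap_rotation[OF _ assms(1), of es] assms(5) by auto
  have stk: "stuck es (rotate k c)" using st k(1) assms(2) by auto
  have ms: "mset (rotate k c) = mset c" by (induction k) (auto simp: rotate_def mset_rotate1)
  have g: "gaps es (rotate k c) = gaps es c"
    by (induction k) (auto simp: gaps_rotate1 rotate_def)
  have d: "degree_in es (rotate k c) v = degree_in es c v" for v
    unfolding degree_in_def using ms by (metis mset_filter size_mset)
  have xy: "x \<in> set c" "y \<in> set c" using k(2) set_rotate[of k c] by auto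
  have "degree_in es c x + degree_in es c y + gaps es c \<le> length c"
    using stuck_bound[of es x r y] stk assms(3) k g d length_rotate[of k c] by simp
  \<comment> \<open>Tripled, each degree is at least \<open>length c + 4\<close> and the number of
    gaps exceeds \<open>length c\<close>, so the sum is too large.\<close>
  then show False using assms(4)[OF xy(1)] assms(4)[OF xy(2)] assms(5) by simp
qed

text \<open>Each round removes a gap until there are few enough, and later rounds do no harm. As
  \<open>k\<close> exceeds the initial number of gaps, the alternative
  \<open>gaps + k \<le> gaps es c\<close> in the induction is impossible in the end.\<close>

lemma few_gaps:
  fixes c :: "'a list"
  assumes "2 \<le> length c" "length c \<le> m" "length c < k" "\<And>v. \<not> adj es v v"
    "\<And>v. v \<in> set c \<Longrightarrow> length c + 3 < 3 * degree_in es c v"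
  shows "3 * gaps es (((sweep es ^^ m) ^^ k) c) \<le> length c"
    "mset (((sweep es ^^ m) ^^ k) c) = mset c"
proof -
  let ?d = "\<lambda>k. ((sweep es ^^ m) ^^ k) c"
  have "mset (?d k) = mset c \<and> (3 * gaps es (?d k) \<le> length c \<or> gaps es (?d k) + k \<le> gaps es c)" for k
  proof (induction k)
    case (Suc k)
    have l: "length (?d k) = length c" using Suc mset_eq_length by blast
    then have l2: "2 \<le> length (?d k)" using assms(1) by simp
    have d: "degree_in es (?d k) v = degree_in es c v" for v
      unfolding degree_in_def using Suc by (metis mset_filter size_mset)
    have s: "set (?d k) = set c" using Suc mset_eq_setD by blast
    show ?case
    proof (cases "3 * gaps es (?d k) \<le> length c")
      case True
      then show ?thesis
        using Suc sweeps_correct[OF l2, where es = es and m = m] by auto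
    next
      case False
      have "gaps es ((sweep es ^^ m) (?d k)) < gaps es (?d k)"
        by (rule sweeps_decrease[OF l2]) (use assms l d s False in auto)
      then show ?thesis
        using Suc sweeps_correct(1)[OF l2, where es = es and m = m] False by auto
    qed
  qed simp
  from this[of k] show "3 * gaps es (?d k) \<le> length c" "mset (?d k) = mset c"
    using gaps_le_length[of es c] assms(3) by auto
qed

section \<open>Edge lists: degrees, thinning at a vertex, and completion by gaps\<close>

abbreviation edge_set :: "'a \<times> 'a \<Rightarrow> 'a set" where
  "edge_set \<equiv> (\<lambda>(u, v). {u, v})"

definition incident :: "'a \<Rightarrow> 'a \<times> 'a \<Rightarrow> bool" where
  "incident v e \<longleftrightarrow> fst e = v \<or> snd e = v"

definition simple_edges :: "'a set \<Rightarrow> ('a \<times> 'a) list \<Rightarrow> bool" where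
  "simple_edges V es \<longleftrightarrow> distinct (map edge_set es) \<and>
     (\<forall>(u, v) \<in> set es. u \<noteq> v \<and> u \<in> V \<and> v \<in> V)"

lemma edge_set_in_iff: "{u, v} \<in> edge_set ` set es \<longleftrightarrow> adj es u v"
  by (force simp: adj_def doubleton_eq_iff)

text \<open>The program counts list entries at \<open>v\<close>, the combinatorial argument counts
  neighbours. Distinct edges at \<open>v\<close> have distinct other ends, so a large count of
  entries guarantees a large degree.\<close>

lemma incident_le_degree:
  assumes "simple_edges (set c) es"
  shows "length (filter (incident v) es) \<le> degree_in es c v"
proof -
  let ?I = "filter (incident v) es"
  have "distinct (map edge_set ?I)"
    using assms distinct_map_filter unfolding simple_edges_def by blast
  then have "length ?I = card (edge_set ` set ?I)"
    using distinct_card[of "map edge_set ?I"] by simp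
  also have "\<dots> \<le> card ((\<lambda>u. {v, u}) ` set (filter (adj es v) c))"
  proof (rule card_mono)
    show "edge_set ` set ?I \<subseteq> (\<lambda>u. {v, u}) ` set (filter (adj es v) c)"
    proof (clarify)
      fix a b assume ab: "(a, b) \<in> set ?I"
      then have "a \<in> set c" "b \<in> set c" "(a, b) \<in> set es" "a = v \<or> b = v"
        using assms by (auto simp: simple_edges_def incident_def)
      then show "{a, b} \<in> (\<lambda>u. {v, u}) ` set (filter (adj es v) c)"
        by (auto simp: adj_def image_iff doubleton_eq_iff)
    qed
  qed simp
  also have "\<dots> \<le> card (set (filter (adj es v) c))" by (rule card_image_le) simp
  also have "\<dots> \<le> degree_in es c v" unfolding degree_in_def by (rule card_length)
  finally show ?thesis .
qed

text \<open>The flag tells whether an edge at \<open>v\<close> has been met.\<close>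

fun thin :: "'a \<Rightarrow> bool \<Rightarrow> ('a \<times> 'a) list \<Rightarrow> ('a \<times> 'a) list" where
  "thin v b [] = []"
| "thin v b (e # es) =
    (if incident v e then (if b then thin v b es else e # thin v True es) else e # thin v b es)"

lemma set_thin: "set (thin v b es) \<subseteq> set es"
  by (induction es arbitrary: b) (auto split: if_splits)

lemma simple_edges_thin: "simple_edges V es \<Longrightarrow> simple_edges V (thin v b es)"
proof (induction es arbitrary: b)
  case (Cons e es)
  have "edge_set e \<notin> edge_set ` set (thin v b' es)" for b'
  proof -
    have "edge_set e \<notin> edge_set ` set es" using Cons.prems by (simp add: simple_edges_def)
    then show ?thesis using subsetD[OF image_mono[OF set_thin[of v b' es], of edge_set]] by (rule contrapos_nn)
  qed
  moreover have "simple_edges V es" using Cons.prems by (auto simp: simple_edges_def)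
  ultimately show ?case using Cons.IH Cons.prems by (auto simp: simple_edges_def)
qed (simp add: simple_edges_def)

text \<open>For an unset flag the truncated subtraction also covers a vertex without edges, where
  nothing is removed.\<close>

lemma length_thin:
  "length es \<le> length (thin v b es) + (length (filter (incident v) es) - (if b then 0 else 1))"
proof (induction es arbitrary: b)
  case (Cons e es)
  show ?case using Cons.IH[of b] Cons.IH[of True] by (cases b) (auto split: if_splits)
qed simp

lemma incident_thin: "length (filter (incident v) (thin v b es)) \<le> (if b then 0 else 1)"
proof (induction es arbitrary: b)
  case (Cons e es)
  show ?case using Cons.IH[of b] Cons.IH[of True] by (cases b) auto
qed simp

text \<open>The two neighbours are the predecessor and the successor on the cycle, which differ
  because the length is at least three.\<close>

lemma hamiltonian_two_edges:
  assumes "hamiltonian_cycle G c" "v \<in> verts G"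
  shows "\<exists>a b. a \<noteq> b \<and> {v, a} \<in> edges G \<and> {v, b} \<in> edges G"
proof -
  let ?n = "length c"
  have c: "distinct c" "set c = verts G" "3 \<le> ?n"
    "\<And>i. i < ?n \<Longrightarrow> {c ! i, c ! (Suc i mod ?n)} \<in> edges G"
    using assms by (auto simp: hamiltonian_cycle_def)
  obtain i where i: "i < ?n" "c ! i = v" using c(2) assms(2) by (metis in_set_conv_nth)
  define j where "j = (if i = 0 then ?n - 1 else i - 1)"
  have j: "j < ?n" "Suc j mod ?n = i" using i c(3) by (auto simp: j_def)
  have "Suc i mod ?n \<noteq> j"
    using i c(3) by (cases "Suc i = ?n") (auto simp: j_def)
  moreover have "Suc i mod ?n < ?n" using c(3) by (intro mod_less_divisor) linarith
  ultimately have "c ! (Suc i mod ?n) \<noteq> c ! j" using c(1) j(1) by (simp add: nth_eq_iff_index_eq)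
  moreover have "{v, c ! j} \<in> edges G" using c(4)[OF j(1)] j(2) i by (simp add: insert_commute)
  ultimately show ?thesis using c(4)[OF i(1)] i(2) by blast
qed

lemma not_hamiltonian:
  assumes "edges G = edge_set ` set es" "length (filter (incident v) es) \<le> 1" "v \<in> verts G"
  shows "\<not> hamiltonian_cycle G c"
proof
  assume "hamiltonian_cycle G c"
  then obtain a b where ab: "a \<noteq> b" "adj es v a" "adj es v b"
    using hamiltonian_two_edges[OF _ assms(3)] unfolding assms(1) edge_set_in_iff by blast
  obtain e where e: "e \<in> set es" "incident v e" "edge_set e = {v, a}"
    using ab(2) by (fastforce simp: adj_def incident_def)
  obtain e' where e': "e' \<in> set es" "incident v e'" "edge_set e' = {v, b}"
    using ab(3) by (fastforce simp: adj_def incident_def)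
  have "e \<noteq> e'" using e(3) e'(3) ab(1) by (metis doubleton_eq_iff)
  moreover have "e \<in> set (filter (incident v) es)" "e' \<in> set (filter (incident v) es)"
    using e e' by auto
  moreover have "card (set (filter (incident v) es)) \<le> 1"
    using assms(2) card_length[of "filter (incident v) es"] by linarith
  ultimately show False
    using card_le_Suc0_iff_eq[of "set (filter (incident v) es)"] by (metis One_nat_def finite_set)
qed

definition gap_pairs :: "('a \<times> 'a) list \<Rightarrow> 'a list \<Rightarrow> ('a \<times> 'a) list" where
  "gap_pairs es c = filter (\<lambda>(u, v). \<not> adj es u v) (zip c (rotate1 c))"

lemma length_gap_pairs: "length (gap_pairs es c) = gaps es c"
proof -
  have "psum (gap es) (x # r) = length (filter (\<lambda>(u, v). \<not> adj es u v) (zip (x # r) r))" for x r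
    by (induction r arbitrary: x) (auto simp: gap_def)
  moreover have "zip (x # r @ [x]) (r @ [x]) = zip (x # r) (r @ [x])" for x :: 'a and r
    using zip_append[of "x # r" "r @ [x]" "[x]" "[]"] by simp
  ultimately show ?thesis by (cases c) (auto simp: gaps_def gap_pairs_def)
qed

text \<open>Two positions with the same unordered pair would be successors of each other, which is
  impossible on a cycle of length at least three.\<close>

lemma distinct_cyclic_pairs:
  assumes "distinct c" "3 \<le> length c"
  shows "distinct (map edge_set (zip c (rotate1 c)))"
  unfolding distinct_conv_nth
proof (intro allI impI)
  let ?n = "length c"
  fix i j assume a: "i < length (map edge_set (zip c (rotate1 c)))"
    "j < length (map edge_set (zip c (rotate1 c)))" "i \<noteq> j"
  then have ij: "i < ?n" "j < ?n" by auto
  have *: "map edge_set (zip c (rotate1 c)) ! k = {c ! k, c ! (Suc k mod ?n)}" if "k < ?n" for k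
    using that by (simp add: nth_rotate1)
  have m: "Suc k mod ?n < ?n" for k using assms(2) by (intro mod_less_divisor) linarith
  show "map edge_set (zip c (rotate1 c)) ! i \<noteq> map edge_set (zip c (rotate1 c)) ! j"
  proof
    assume "map edge_set (zip c (rotate1 c)) ! i = map edge_set (zip c (rotate1 c)) ! j"
    then have "c ! i = c ! (Suc j mod ?n)" "c ! j = c ! (Suc i mod ?n)"
      using a(3) assms(1) ij unfolding *[OF ij(1)] *[OF ij(2)]
      by (auto simp: doubleton_eq_iff nth_eq_iff_index_eq)
    then have "i = Suc j mod ?n" "j = Suc i mod ?n"
      using assms(1) ij m by (simp_all add: nth_eq_iff_index_eq)
    moreover have "Suc k = ?n \<and> Suc k mod ?n = 0 \<or> Suc k mod ?n = Suc k" if "k < ?n" for k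
      using that by (cases "Suc k = ?n") simp_all
    ultimately have "Suc j = ?n \<and> i = 0 \<or> i = Suc j" "Suc i = ?n \<and> j = 0 \<or> j = Suc i"
      using ij by metis+
    then show False using assms(2) by linarith
  qed
qed

text \<open>Encodings must not repeat an edge in either direction, so the appended gaps have to be
  new and distinct as sets. This also makes the distance equal to their number.\<close>

lemma simple_edges_add_gaps:
  assumes "simple_edges (set c) es" "distinct c" "3 \<le> length c"
  shows "simple_edges (set c) (es @ gap_pairs es c)"
proof -
  have "distinct (map edge_set (gap_pairs es c))"
    unfolding gap_pairs_def using distinct_cyclic_pairs[OF assms(2,3)] by (rule distinct_map_filter)
  moreover have "edge_set ` set es \<inter> edge_set ` set (gap_pairs es c) = {}"
  proof -
    have "edge_set e \<notin> edge_set ` set es" if "e \<in> set (gap_pairs es c)" for e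
    proof -
      obtain u v where e: "e = (u, v)" by (cases e)
      have "\<not> adj es u v" using that unfolding e by (simp add: gap_pairs_def)
      then show ?thesis unfolding e prod.case edge_set_in_iff .
    qed
    then show ?thesis by (metis (no_types, lifting) disjoint_iff imageE)
  qed
  moreover have "u \<noteq> v \<and> u \<in> set c \<and> v \<in> set c" if "(u, v) \<in> set (zip c (rotate1 c))" for u v
  proof -
    obtain i where "i < length (zip c (rotate1 c))" "zip c (rotate1 c) ! i = (u, v)"
      using \<open>(u, v) \<in> _\<close> unfolding in_set_conv_nth by blast
    then have i: "i < length c" "u = c ! i" "v = c ! (Suc i mod length c)"
      by (auto simp: nth_rotate1)
    have "Suc i mod length c < length c" using assms(3) by (intro mod_less_divisor) linarith
    moreover have "Suc i mod length c \<noteq> i" using i assms(3) by (cases "Suc i = length c") auto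
    ultimately show ?thesis using i assms(2) by (simp add: nth_eq_iff_index_eq)
  qed
  ultimately show ?thesis using assms(1) by (auto simp: simple_edges_def gap_pairs_def)
qed

lemma hamiltonian_add_gaps:
  assumes "edges J = edge_set ` set (es @ gap_pairs es c)" "distinct c" "3 \<le> length c"
    "verts J = set c"
  shows "hamiltonian_cycle J c"
proof -
  have "{c ! i, c ! (Suc i mod length c)} \<in> edges J" if i: "i < length c" for i
  proof -
    let ?u = "c ! i" and ?v = "c ! (Suc i mod length c)"
    have "(?u, ?v) \<in> set (zip c (rotate1 c))" using i by (auto simp: set_zip nth_rotate1)
    then have "adj es ?u ?v \<or> (?u, ?v) \<in> set (gap_pairs es c)" by (auto simp: gap_pairs_def)
    then have "{?u, ?v} \<in> edge_set ` set es \<or> {?u, ?v} \<in> edge_set ` set (gap_pairs es c)"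
      unfolding edge_set_in_iff by (auto simp: adj_def)
    then show ?thesis unfolding assms(1) by (simp add: image_Un)
  qed
  then show ?thesis using assms by (simp add: hamiltonian_cycle_def)
qed

section \<open>The algorithm\<close>

text \<open>
  Input \<open>I\<close>, vertices \<open>V\<close>, edges \<open>E\<close>, new edges \<open>N\<close>, output \<open>O\<close>; vertices of low degree \<open>L\<close>; the cyclic
  order is \<open>X @ R @ Y\<close> between passes and \<open>X @ rev P @ R @ Y\<close> during a pass. The loops over
  vertices consume \<open>C\<close>, those that merely count consume \<open>V\<close> and \<open>Q\<close>. Tokens on \<open>T\<close> are discarded.
\<close>

abbreviation (input) rI :: nat where "rI \<equiv> 0"
abbreviation (input) rV :: nat where "rV \<equiv> 2"
abbreviation (input) rE :: nat where "rE \<equiv> 3"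
abbreviation (input) rC :: nat where "rC \<equiv> 4"
abbreviation (input) rR :: nat where "rR \<equiv> 5"
abbreviation (input) rQ :: nat where "rQ \<equiv> 6"
abbreviation (input) rQ' :: nat where "rQ' \<equiv> 7"
abbreviation (input) rF :: nat where "rF \<equiv> 8"
abbreviation (input) rG :: nat where "rG \<equiv> 9"
abbreviation (input) rA :: nat where "rA \<equiv> 10"
abbreviation (input) rB :: nat where "rB \<equiv> 11"
abbreviation (input) rX :: nat where "rX \<equiv> 12"
abbreviation (input) rY :: nat where "rY \<equiv> 13"
abbreviation (input) rP :: nat where "rP \<equiv> 14"
abbreviation (input) rZ :: nat where "rZ \<equiv> 15"
abbreviation (input) rN :: nat where "rN \<equiv> 16"
abbreviation (input) rL :: nat where "rL \<equiv> 17"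
abbreviation (input) rV' :: nat where "rV' \<equiv> 18"
abbreviation (input) rO :: nat where "rO \<equiv> 19"
abbreviation (input) rT :: nat where "rT \<equiv> 20"
abbreviation (input) nregs :: nat where "nregs \<equiv> 21"

definition flat :: "('a \<times> 'a) list \<Rightarrow> 'a list" where
  "flat es = concat (map (\<lambda>(u, v). [u, v]) es)"

lemma flat_simps [simp]: "flat [] = []" "flat ((u, v) # es) = u # v # flat es"
  "flat (es @ es') = flat es @ flat es'"
  by (simp_all add: flat_def)

text \<open>Pouring a stack of edges onto another one also exchanges the ends of each edge; this is
  the source of all occurrences of \<open>prod.swap\<close>.\<close>

lemma rev_flat: "rev (flat es) = flat (map prod.swap (rev es))"
  by (induction es) auto

lemma move_Cons: "s i = x # xs \<Longrightarrow> move i j s = s(i := xs, j := x # s j)"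
  by (simp add: move_def)

lemma move_Nil: "s i = [] \<Longrightarrow> move i j s = s"
  by (simp add: move_def)

lemma copy_Cons: "s i = x # xs \<Longrightarrow> copy i j s = s(j := x # s j)"
  by (simp add: copy_def)

lemma emit_Cons: "s i = x # xs \<Longrightarrow> emit a i s = s(i := (a # x) # xs)"
  by (simp add: emit_def)

lemma loop_skip_eq:
  assumes "i \<noteq> j"
  shows "loop i j skip s = s(i := [], j := rev (s i) @ s j)"
proof (induction "s i" arbitrary: s)
  case Nil
  then show ?case by (simp add: fun_upd_idem)
next
  case (Cons x xs)
  have "loop i j skip s = loop i j skip (s(i := xs, j := x # s j))"
    using loop_step[of i skip j s] assms Cons(2)[symmetric]
    by (simp add: keeps_length_skip move_Cons skip_def)
  also have "\<dots> = s(i := [], j := rev (s i) @ s j)"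
    using Cons(1)[of "s(i := xs, j := x # s j)"] Cons(2)[symmetric] assms
    by (auto simp: fun_eq_iff)
  finally show ?case .
qed

lemmas exec_simps = andthen_def branch_def skip_def move_Cons move_Nil copy_Cons emit_Cons new_def
  loop_skip_eq

text \<open>
  A list of edges is scanned by splitting it into its two components on stacks \<open>A\<close> and \<open>B\<close>, from
  which it is restored afterwards.
\<close>

lemma loop_zip:
  assumes "length (s rA) = length (s rB)" "t \<noteq> rA" "t \<noteq> rB"
  shows "loop rB t (move rA t) s =
    s(rA := [], rB := [], t := flat (rev (zip (s rA) (s rB))) @ s t)"
  using assms(1)
proof (induction "s rB" arbitrary: s)
  case Nil
  then show ?case by (auto simp: fun_eq_iff)
next
  case (Cons b bs)
  then obtain a as where a: "s rA = a # as" by (cases "s rA") auto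
  let ?s' = "s(rB := bs, rA := as, t := a # b # s t)"
  have "loop rB t (move rA t) s = loop rB t (move rA t) ?s'"
    using loop_step[of rB "move rA t" t s] assms(2,3) Cons(2)[symmetric] a
    by (simp add: keeps_length_move move_Cons fun_upd_twist)
  also have "\<dots> = ?s'(rA := [], rB := [], t := flat (rev (zip as bs)) @ ?s' t)"
    using Cons(1)[of ?s'] Cons(2,3) a assms(2,3) by (metis (no_types, lifting) Suc_inject
        fun_upd_other fun_upd_same length_Cons num.distinct(1) numeral_eq_iff semiring_norm(89))
  also have "\<dots> = s(rA := [], rB := [], t := flat (rev (zip (s rA) (s rB))) @ s t)"
    using Cons(2)[symmetric] a assms(2,3) by (auto simp: fun_eq_iff)
  finally show ?case .
qed

text \<open>The flag is the position of a single token: on \<open>F\<close> when unset, on \<open>G\<close> when set.\<close>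

definition unset :: "bool \<Rightarrow> sym list list" where
  "unset b = (if b then [] else [[]])"

lemma unset_simps [simp]: "unset True = []" "unset False = [[]]" "unset b = [] \<longleftrightarrow> b"
  by (simp_all add: unset_def)

definition ready :: "(sym list \<times> sym list) list \<Rightarrow> state \<Rightarrow> bool" where
  "ready es s \<longleftrightarrow> s rE = flat es \<and> s rA = [] \<and> s rB = [] \<and> s rF = [[]] \<and> s rG = []"

definition same_edge :: "nat \<Rightarrow> nat \<Rightarrow> state \<Rightarrow> bool" where
  "same_edge a b = (\<lambda>s. peek (s rA) = peek (s a) \<and> peek (s rB) = peek (s b) \<or>
     peek (s rA) = peek (s b) \<and> peek (s rB) = peek (s a))"

text \<open>After the first hit stack \<open>F\<close> is empty, so a further hit does nothing and
  the flag stays set.\<close>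

definition adj_body :: "nat \<Rightarrow> nat \<Rightarrow> state \<Rightarrow> state" where
  "adj_body a b = move rE rB ;; branch (same_edge a b) (move rF rG) skip"

definition adj_flag :: "nat \<Rightarrow> nat \<Rightarrow> state \<Rightarrow> state" where
  "adj_flag a b = loop rE rA (adj_body a b) ;; loop rB rE (move rA rE)"

text \<open>The edge list is restored and the flag is reset before \<open>f\<close> or
  \<open>g\<close> starts, so this behaves as a conditional without side effects.\<close>

definition if_adj :: "nat \<Rightarrow> nat \<Rightarrow> (state \<Rightarrow> state) \<Rightarrow> (state \<Rightarrow> state) \<Rightarrow> state \<Rightarrow> state" where
  "if_adj a b f g = adj_flag a b ;; branch (\<lambda>s. s rG = []) g (move rG rF ;; f)"

abbreviation "scratch \<equiv> {rE, rA, rB, rF, rG} :: nat set"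

lemma keeps_length_adj_body: "i \<noteq> rB \<Longrightarrow> i \<noteq> rG \<Longrightarrow> keeps_length i (adj_body a b)"
  unfolding adj_body_def by (intro keeps_length_intros) auto

lemma adj_loop:
  assumes "a \<notin> scratch" "b \<notin> scratch" "s a = u # us" "s b = v # vs"
    "s rE = flat es" "s rF = unset d" "s rG = unset (\<not> d)"
  shows "loop rE rA (adj_body a b) s = s(rE := [], rA := rev (map fst es) @ s rA,
    rB := rev (map snd es) @ s rB, rF := unset (d \<or> adj es u v), rG := unset (\<not> (d \<or> adj es u v)))"
  using assms(3-)
proof (induction es arbitrary: s d)
  case Nil
  then show ?case by (auto simp: fun_eq_iff adj_def)
next
  case (Cons e es)
  obtain p q where e: "e = (p, q)" by (cases e)
  define m where "m = (p = u \<and> q = v \<or> p = v \<and> q = u)"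
  let ?s' = "s(rE := flat es, rA := p # s rA, rB := q # s rB, rF := unset (d \<or> m),
    rG := unset (\<not> (d \<or> m)))"
  have "loop rE rA (adj_body a b) s = loop rE rA (adj_body a b) (adj_body a b (move rE rA s))"
    using Cons.prems e by (intro loop_step keeps_length_adj_body) auto
  also have "adj_body a b (move rE rA s) = ?s'"
    using Cons.prems e assms(1,2)
    by (cases d) (auto simp: adj_body_def exec_simps same_edge_def m_def fun_eq_iff)
  also have "loop rE rA (adj_body a b) ?s' = ?s'(rE := [], rA := rev (map fst es) @ ?s' rA,
    rB := rev (map snd es) @ ?s' rB, rF := unset ((d \<or> m) \<or> adj es u v),
    rG := unset (\<not> ((d \<or> m) \<or> adj es u v)))"
    by (rule Cons.IH) (use Cons.prems assms(1,2) in auto)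
  also have "\<dots> = s(rE := [], rA := rev (map fst (e # es)) @ s rA,
    rB := rev (map snd (e # es)) @ s rB, rF := unset (d \<or> adj (e # es) u v),
    rG := unset (\<not> (d \<or> adj (e # es) u v)))"
  proof -
    have "adj (e # es) u v \<longleftrightarrow> m \<or> adj es u v" by (auto simp: adj_def m_def e)
    then show ?thesis by (auto simp: fun_eq_iff e)
  qed
  finally show ?case .
qed

lemma if_adj_eq:
  assumes "ready es s" "a \<notin> scratch" "b \<notin> scratch" "s a = u # us" "s b = v # vs"
  shows "if_adj a b f g s = (if adj es u v then f s else g s)"
proof -
  have r: "s rE = flat es" "s rA = []" "s rB = []" "s rF = [[]]" "s rG = []"
    using assms(1) by (auto simp: ready_def)
  have "loop rE rA (adj_body a b) s = s(rE := [], rA := rev (map fst es),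
      rB := rev (map snd es), rF := unset (adj es u v), rG := unset (\<not> adj es u v))"
    using adj_loop[OF assms(2-5), of es False] r by simp
  moreover have "zip (rev (map fst es)) (rev (map snd es)) = rev es"
    by (simp add: rev_map zip_map_fst_snd)
  ultimately have "adj_flag a b s = s(rF := unset (adj es u v), rG := unset (\<not> adj es u v))"
    using r by (auto simp: adj_flag_def andthen_def loop_zip fun_eq_iff)
  moreover have "s(rF := [[]], rG := []) = s" using r by auto
  moreover have "s(rG := [], rF := [[]]) = s" using r by auto
  ultimately show ?thesis using r by (auto simp: if_adj_def exec_simps)
qed

text \<open>A stack is reversed in place by an odd number of pourings, here three, through the
  stacks \<open>A\<close> and \<open>B\<close> that are empty between edge scans. Since
  \<open>P\<close> already stores the prefix backwards, \<open>p\<close> and \<open>x\<close> then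
  only trade places.\<close>

definition reverse_prefix :: "state \<Rightarrow> state" where
  "reverse_prefix = move rP rZ ;; loop rP rA skip ;; loop rA rB skip ;; loop rB rP skip ;;
     move rX rP ;; move rZ rX"

lemma reverse_prefix_eq:
  assumes "s rX = [x]" "s rP = p # ps" "s rZ = []" "s rA = []" "s rB = []"
  shows "reverse_prefix s = s(rX := [p], rP := x # rev ps)"
  using assms by (auto simp: reverse_prefix_def exec_simps fun_eq_iff)

text \<open>The decision tree of \<open>improves\<close> for nonadjacent \<open>x\<close> and
  \<open>y\<close>: two adjacent new pairs always suffice, one suffices if \<open>p q\<close> is a
  gap, none never does. The vertex \<open>p\<close> is already on \<open>P\<close>; an empty
  \<open>R\<close> means that there is no \<open>q\<close>.\<close>

definition scan_body :: "state \<Rightarrow> state" where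
  "scan_body = branch (\<lambda>s. s rR = []) skip (if_adj rX rY skip
     (if_adj rX rR
       (if_adj rY rP reverse_prefix (if_adj rP rR skip reverse_prefix))
       (if_adj rY rP (if_adj rP rR skip reverse_prefix) skip)))"

lemma scan_body_eq:
  assumes "ready es s" "s rX = [x]" "s rY = [y]" "s rP = p # ps" "s rZ = []"
  shows "scan_body s = (case s rR of [] \<Rightarrow> s
    | q # _ \<Rightarrow> if improves es x y p q then s(rX := [p], rP := x # rev ps) else s)"
proof (cases "s rR")
  case Nil
  then show ?thesis by (simp add: scan_body_def exec_simps)
next
  case (Cons q qs)
  have r: "reverse_prefix s = s(rX := [p], rP := x # rev ps)"
    using assms by (intro reverse_prefix_eq) (auto simp: ready_def)
  have "if_adj rX rY f g s = (if adj es x y then f s else g s)" for f g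
    by (rule if_adj_eq[OF assms(1)]) (use assms in auto)
  moreover have "if_adj rX rR f g s = (if adj es x q then f s else g s)" for f g
    by (rule if_adj_eq[OF assms(1)]) (use assms Cons in auto)
  moreover have "if_adj rY rP f g s = (if adj es y p then f s else g s)" for f g
    by (rule if_adj_eq[OF assms(1)]) (use assms Cons in auto)
  moreover have "if_adj rP rR f g s = (if adj es p q then f s else g s)" for f g
    by (rule if_adj_eq[OF assms(1)]) (use assms Cons in auto)
  ultimately show ?thesis using Cons adj_sym[of es x y]
    by (simp add: scan_body_def branch_def r skip_def improves_def gap_def)
qed

lemma keeps_length_if_adj:
  assumes "keeps_length i f" "keeps_length i g" "i \<notin> scratch"
  shows "keeps_length i (if_adj a b f g)"
  unfolding if_adj_def adj_flag_def adj_body_def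
  by (intro keeps_length_intros) (use assms in auto)

lemma keeps_length_scan_body: "i \<notin> scratch \<Longrightarrow> i \<notin> {rX, rP, rZ} \<Longrightarrow> keeps_length i scan_body"
  unfolding scan_body_def reverse_prefix_def
  by (intro keeps_length_intros keeps_length_if_adj) auto

lemma scan_loop:
  assumes "ready es s" "s rX = [x]" "s rY = [y]" "s rZ = []"
  shows "loop rR rP scan_body s =
    s(rR := [], rX := [fst (scan es y x (s rP) (s rR))], rP := snd (scan es y x (s rP) (s rR)))"
  using assms
proof (induction "s rR" arbitrary: s x)
  case Nil
  then show ?case by (auto simp: fun_eq_iff)
next
  case (Cons p R)
  note sR = Cons(2)[symmetric]
  let ?m = "move rR rP s"
  have m: "?m = s(rR := R, rP := p # s rP)" using sR by (simp add: move_Cons)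
  have b: "scan_body ?m = (case R of [] \<Rightarrow> ?m
    | q # _ \<Rightarrow> if improves es x y p q then ?m(rX := [p], rP := x # rev (s rP)) else ?m)"
    using scan_body_eq[of es ?m x y p "s rP"] Cons.prems by (simp add: m ready_def)
  have "loop rR rP scan_body s = loop rR rP scan_body (scan_body ?m)"
    using sR by (intro loop_step keeps_length_scan_body) auto
  also have "\<dots> = s(rR := [], rX := [fst (scan es y x (s rP) (s rR))],
      rP := snd (scan es y x (s rP) (s rR)))"
  proof (cases R)
    case Nil
    then show ?thesis using Cons.prems sR unfolding b by (auto simp: m fun_eq_iff)
  next
    case R: (Cons q R')
    show ?thesis
    proof (cases "improves es x y p q")
      case True
      have "loop rR rP scan_body (?m(rX := [p], rP := x # rev (s rP))) =
        (?m(rX := [p], rP := x # rev (s rP)))(rR := [],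
          rX := [fst (scan es y p (x # rev (s rP)) R)], rP := snd (scan es y p (x # rev (s rP)) R))"
        using Cons(1)[of "?m(rX := [p], rP := x # rev (s rP))" p] Cons.prems
        by (simp add: m ready_def)
      then show ?thesis using R True sR unfolding b by (auto simp: m fun_eq_iff)
    next
      case False
      have "loop rR rP scan_body ?m = ?m(rR := [],
          rX := [fst (scan es y x (p # s rP) R)], rP := snd (scan es y x (p # s rP) R))"
        using Cons(1)[of ?m x] Cons.prems by (simp add: m ready_def)
      then show ?thesis using R False sR unfolding b by (auto simp: m fun_eq_iff)
    qed
  qed
  finally show ?case .
qed

definition put :: "sym list list \<Rightarrow> state \<Rightarrow> state" where
  "put c s = s(rX := [hd c], rR := butlast (tl c), rY := [last c])"

text \<open>Putting \<open>y\<close> on top of \<open>P\<close> and storing \<open>x\<close> in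
  \<open>Y\<close> carries out the rotation; the last pouring turns \<open>P\<close> round
  again.\<close>

definition sweep_prog :: "state \<Rightarrow> state" where
  "sweep_prog = loop rR rP scan_body ;; move rY rP ;; move rX rY ;; loop rP rR skip ;; move rR rX"

lemma sweep_prog_eq:
  assumes "ready es s" "s rP = []" "s rZ = []" "2 \<le> length c"
  shows "sweep_prog (put c s) = put (sweep es c) s"
proof -
  obtain x r y where c: "c = x # r @ [y]"
    using assms(4) by (cases c; cases "tl c" rule: rev_cases) auto
  obtain x' P' where sc: "scan es y x [] r = (x', P')" by fastforce
  have 1: "loop rR rP scan_body (put c s) = s(rX := [x'], rP := P', rR := [], rY := [y])"
    using scan_loop[of es "put c s" x y] assms sc c by (auto simp: put_def ready_def fun_eq_iff)
  obtain z zs where z: "rev P' @ [y] = z # zs" by (cases "rev P' @ [y]") auto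
  have "sweep es c = z # zs @ [x']" using sc c z by (simp add: sweep_def)
  then show ?thesis
    unfolding sweep_prog_def andthen_def 1
    using z assms by (auto simp: exec_simps put_def fun_eq_iff)
qed

lemma keeps_length_sweep_prog:
  "i \<notin> scratch \<Longrightarrow> i \<notin> {rX, rY, rR, rP, rZ} \<Longrightarrow> keeps_length i sweep_prog"
  unfolding sweep_prog_def by (intro keeps_length_intros keeps_length_scan_body) auto

text \<open>For loops in which the tokens on \<open>i\<close> merely count: the body acts on the
  stored order as \<open>g\<close> does. It serves the sweeps of a round as well as the
  rounds.\<close>

lemma loop_put:
  assumes "keeps_length i f" "i \<noteq> j" "i \<notin> {rX, rR, rY}" "j \<notin> {rX, rR, rY}"
    "\<And>c s. I c \<Longrightarrow> J s \<Longrightarrow> f (put c s) = put (g c) s" "\<And>c. I c \<Longrightarrow> I (g c)"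
    "\<And>s a b. J s \<Longrightarrow> J (s(i := a, j := b))" "I c" "J s"
  shows "loop i j f (put c s) = put ((g ^^ length (s i)) c) (s(i := [], j := rev (s i) @ s j))"
  using assms(8,9)
proof (induction "s i" arbitrary: s c)
  case Nil
  have "s(i := [], j := rev (s i) @ s j) = s" using Nil(1) by auto
  moreover have "put c s i = []" using Nil(1)[symmetric] assms(3) by (simp add: put_def)
  ultimately show ?case using Nil(1)[symmetric] by (simp del: fun_upd_apply)
next
  case (Cons x xs)
  note si = Cons(2)[symmetric]
  let ?s' = "s(i := xs, j := x # s j)"
  have p: "put c s i = x # xs" "put c s j = s j" using si assms(3,4) by (simp_all add: put_def)
  have "loop i j f (put c s) = loop i j f (f (move i j (put c s)))"
    using p by (intro loop_step assms(1,2)) simp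
  also have "move i j (put c s) = put c ?s'"
    using p assms(2,3,4) by (auto simp: move_Cons put_def fun_eq_iff)
  also have "f (put c ?s') = put (g c) ?s'" using assms(5,7) Cons.prems by blast
  also have "loop i j f (put (g c) ?s') =
      put ((g ^^ length (?s' i)) (g c)) (?s'(i := [], j := rev (?s' i) @ ?s' j))"
    by (rule Cons(1)) (use assms(2,6,7) Cons.prems in auto)
  also have "?s'(i := [], j := rev (?s' i) @ ?s' j) = s(i := [], j := rev (s i) @ s j)"
    using si assms(2) by auto
  also have "(g ^^ length (?s' i)) (g c) = (g ^^ length (s i)) c"
    using si assms(2) by (simp add: funpow_swap1)
  finally show ?case .
qed

definition sweeps_prog :: "state \<Rightarrow> state" where
  "sweeps_prog = loop rV rV' sweep_prog ;; loop rV' rV skip"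

lemma length_sweeps: "2 \<le> length c \<Longrightarrow> 2 \<le> length ((sweep es ^^ m) c)"
  using sweeps_correct(1)[of c m es] by (metis size_mset)

lemma sweeps_prog_eq:
  assumes "ready es s" "s rP = []" "s rZ = []" "s rV' = []" "2 \<le> length c"
  shows "sweeps_prog (put c s) = put ((sweep es ^^ length (s rV)) c) s"
proof -
  have "loop rV rV' sweep_prog (put c s) =
      put ((sweep es ^^ length (s rV)) c) (s(rV := [], rV' := rev (s rV) @ s rV'))"
  proof (rule loop_put[where I = "\<lambda>c. 2 \<le> length c"
        and J = "\<lambda>s. ready es s \<and> s rP = [] \<and> s rZ = []"])
    show "2 \<le> length c \<Longrightarrow> 2 \<le> length (sweep es c)" for c :: "sym list list"
      using length_sweeps[of c 1 es] by simp
  qed (use assms in \<open>auto simp: ready_def intro!: sweep_prog_eq keeps_length_sweep_prog\<close>)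
  then show ?thesis
    using assms by (auto simp: sweeps_prog_def exec_simps put_def fun_eq_iff)
qed

lemma keeps_length_sweeps_prog: "keeps_length rQ sweeps_prog"
  unfolding sweeps_prog_def by (intro keeps_length_intros keeps_length_sweep_prog) auto

lemma sweeps_loop:
  assumes "ready es s" "s rP = []" "s rZ = []" "s rV' = []" "2 \<le> length c"
  shows "loop rQ rQ' sweeps_prog (put c s) =
    put (((sweep es ^^ length (s rV)) ^^ length (s rQ)) c) (s(rQ := [], rQ' := rev (s rQ) @ s rQ'))"
proof (rule loop_put[where I = "\<lambda>c. 2 \<le> length c" and
      J = "\<lambda>s'. ready es s' \<and> s' rP = [] \<and> s' rZ = [] \<and> s' rV' = [] \<and> s' rV = s rV"])
  fix c :: "sym list list" and s' assume "2 \<le> length c"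
    "ready es s' \<and> s' rP = [] \<and> s' rZ = [] \<and> s' rV' = [] \<and> s' rV = s rV"
  then show "sweeps_prog (put c s') = put ((sweep es ^^ length (s rV)) c) s'"
    using sweeps_prog_eq[of es s' c] by simp
qed (use assms in \<open>auto simp: ready_def intro: length_sweeps keeps_length_sweeps_prog\<close>)

section \<open>Collecting the gaps and writing the answers\<close>

definition gap_step :: "state \<Rightarrow> state" where
  "gap_step = if_adj rP rZ skip (copy rP rN ;; copy rZ rN) ;; move rZ rP"

lemma keeps_length_gap_step: "keeps_length rR gap_step"
  unfolding gap_step_def by (intro keeps_length_intros keeps_length_if_adj) auto

text \<open>Pushing \<open>p\<close> and then \<open>z\<close> stores the pairs swapped and in
  reverse; pouring them onto the output undoes both.\<close>

lemma gap_loop: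
  assumes "ready es s" "s rP = p # ps" "s rZ = []" "s rR = zs"
  shows "loop rR rZ gap_step s = s(rR := [], rP := rev zs @ p # ps,
    rN := flat (map prod.swap (rev (filter (\<lambda>(u, v). \<not> adj es u v) (zip (p # zs) zs)))) @ s rN)"
  using assms
proof (induction zs arbitrary: s p ps)
  case Nil
  then show ?case by (auto simp: fun_eq_iff)
next
  case (Cons z zs)
  let ?m = "s(rR := zs, rZ := [z])"
  let ?s' = "s(rR := zs, rP := z # p # ps, rN := (if adj es p z then s rN else z # p # s rN))"
  have m: "move rR rZ s = ?m" using Cons.prems by (simp add: move_Cons)
  have ia: "if_adj rP rZ f g ?m = (if adj es p z then f ?m else g ?m)" for f g
    by (rule if_adj_eq) (use Cons.prems in \<open>auto simp: ready_def\<close>)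
  have "gap_step ?m = move rZ rP (if adj es p z then skip ?m else (copy rP rN ;; copy rZ rN) ?m)"
    by (simp only: gap_step_def andthen_def ia)
  also have "\<dots> = ?s'"
    using Cons.prems by (auto simp: exec_simps fun_eq_iff)
  finally have g: "gap_step ?m = ?s'" .
  have "loop rR rZ gap_step s = loop rR rZ gap_step (gap_step (move rR rZ s))"
    by (rule loop_step) (use Cons.prems keeps_length_gap_step in auto)
  also have "\<dots> = ?s'(rR := [], rP := rev zs @ z # p # ps,
      rN := flat (map prod.swap (rev (filter (\<lambda>(u, v). \<not> adj es u v) (zip (z # zs) zs)))) @ ?s' rN)"
    unfolding m g by (rule Cons.IH) (use Cons.prems in \<open>auto simp: ready_def\<close>)
  also have "\<dots> = s(rR := [], rP := rev (z # zs) @ p # ps,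
      rN := flat (map prod.swap (rev (filter (\<lambda>(u, v). \<not> adj es u v)
        (zip (p # z # zs) (z # zs))))) @ s rN)"
    by (auto simp: fun_eq_iff)
  finally show ?case .
qed

text \<open>A second copy of the first vertex behind the last one turns cyclic pairs into
  consecutive ones; it is discarded at the end.\<close>

definition collect_gaps :: "state \<Rightarrow> state" where
  "collect_gaps = loop rR rP skip ;; move rY rP ;; copy rX rP ;; loop rP rR skip ;; move rX rP ;;
     loop rR rZ gap_step ;; move rP rT"

lemma collect_gaps_eq:
  assumes "ready es s" "s rP = []" "s rZ = []" "2 \<le> length c"
  shows "\<exists>t. collect_gaps (put c s) = s(rX := [], rR := [], rY := [], rP := rev c,
    rN := flat (map prod.swap (rev (gap_pairs es c))) @ s rN, rT := t)"
proof -
  obtain x r y where c: "c = x # r @ [y]"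
    using assms(4) by (cases c; cases "tl c" rule: rev_cases) auto
  let ?s1 = "s(rX := [], rY := [], rR := r @ [y, x], rP := [x])"
  have l: "loop rR rZ gap_step ?s1 = ?s1(rR := [], rP := rev (r @ [y, x]) @ [x],
      rN := flat (map prod.swap (rev (filter (\<lambda>(u, v). \<not> adj es u v)
        (zip (x # r @ [y, x]) (r @ [y, x]))))) @ ?s1 rN)"
    by (rule gap_loop) (use assms in \<open>auto simp: ready_def\<close>)
  have "(loop rR rP skip ;; move rY rP ;; copy rX rP ;; loop rP rR skip ;; move rX rP) (put c s) = ?s1"
    using assms c by (auto simp: exec_simps put_def fun_eq_iff)
  then have "collect_gaps (put c s) = move rP rT (loop rR rZ gap_step ?s1)"
    by (simp add: collect_gaps_def andthen_def)
  moreover have "zip (x # r @ [y, x]) (r @ [y, x]) = zip c (rotate1 c)"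
    using zip_append[of c "rotate1 c" "[x]" "[]"] c by simp
  ultimately show ?thesis
    unfolding l by (intro exI[of _ "x # s rT"])
      (use c in \<open>auto simp: exec_simps gap_pairs_def fun_eq_iff\<close>)
qed

text \<open>The output is assembled from its end. No separator follows the marker
  \<open>One\<close>, so it is prepended to the first vertex. The lowest empty token is deliberately
  surplus: the answer nil does not end in a separator but stacks of tokens do, so both answers are
  written with one separator too many, to be stripped by \<open>ptime_machine\<close>.\<close>

definition write_cycle :: "state \<Rightarrow> state" where
  "write_cycle = new rO ;; new rO ;; loop rP rO skip ;; emit One rO ;; new rO ;; loop rN rO skip ;;
     loop rE rO skip ;; new rO ;; loop rV rO skip"

lemma write_cycle_eq:
  assumes "s rP = rev c" "c \<noteq> []" "s rO = []" "s rN = flat (map prod.swap (rev ns))" "s rE = flat es"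
  shows "write_cycle s rO = rev (s rV) @ [] # flat (map prod.swap (rev es) @ ns) @
      [] # (One # hd c) # tl c @ [[], []]" "write_cycle s rI = s rI"
proof -
  obtain x r where c: "c = x # r" using assms(2) by (cases c) auto
  show "write_cycle s rO = rev (s rV) @ [] # flat (map prod.swap (rev es) @ ns) @
      [] # (One # hd c) # tl c @ [[], []]" "write_cycle s rI = s rI"
    using assms c by (auto simp: write_cycle_def exec_simps rev_flat rev_map)
qed

definition at_vertex :: "state \<Rightarrow> bool" where
  "at_vertex = (\<lambda>s. peek (s rA) = peek (s rX) \<or> peek (s rB) = peek (s rX))"

definition thin_body :: "state \<Rightarrow> state" where
  "thin_body = move rE rB ;; branch at_vertex
     (branch (\<lambda>s. s rG = []) (move rF rG) (move rA rT ;; move rB rT)) skip"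

lemma keeps_length_thin_body: "keeps_length rE thin_body"
  unfolding thin_body_def by (intro keeps_length_intros) auto

lemma thin_loop:
  assumes "s rE = flat es" "s rX = [v]" "s rF = unset d" "s rG = unset (\<not> d)"
  shows "\<exists>f g t. loop rE rA thin_body s = s(rE := [], rA := rev (map fst (thin v d es)) @ s rA,
    rB := rev (map snd (thin v d es)) @ s rB, rF := f, rG := g, rT := t)"
  using assms
proof (induction es arbitrary: s d)
  case Nil
  then have "loop rE rA thin_body s = s(rE := [], rA := rev (map fst (thin v d [])) @ s rA,
    rB := rev (map snd (thin v d [])) @ s rB, rF := s rF, rG := s rG, rT := s rT)"
    by (auto simp: fun_eq_iff)
  then show ?case by blast
next
  case (Cons e es)
  obtain p q where e: "e = (p, q)" by (cases e)
  let ?i = "incident v e"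
  define s' where "s' = thin_body (move rE rA s)"
  have s': "s' = s(rE := flat es, rA := (if ?i \<and> d then s rA else p # s rA),
      rB := (if ?i \<and> d then s rB else q # s rB), rF := unset (d \<or> ?i), rG := unset (\<not> (d \<or> ?i)),
      rT := (if ?i \<and> d then q # p # s rT else s rT))"
    using Cons.prems unfolding s'_def
    by (cases d) (auto simp: thin_body_def exec_simps at_vertex_def incident_def e fun_eq_iff)
  have "loop rE rA thin_body s = loop rE rA thin_body s'"
    unfolding s'_def by (rule loop_step) (use Cons.prems keeps_length_thin_body e in auto)
  moreover obtain f g t where "loop rE rA thin_body s' = s'(rE := [],
      rA := rev (map fst (thin v (d \<or> ?i) es)) @ s' rA,
      rB := rev (map snd (thin v (d \<or> ?i) es)) @ s' rB, rF := f, rG := g, rT := t)"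
  proof -
    have "s' rE = flat es" "s' rX = [v]" "s' rF = unset (d \<or> ?i)" "s' rG = unset (\<not> (d \<or> ?i))"
      using Cons.prems by (simp_all add: s')
    from Cons.IH[OF this] show thesis using that by blast
  qed
  moreover have "s'(rE := [],
      rA := rev (map fst (thin v (d \<or> ?i) es)) @ s' rA,
      rB := rev (map snd (thin v (d \<or> ?i) es)) @ s' rB, rF := f, rG := g, rT := t) =
    s(rE := [], rA := rev (map fst (thin v d (e # es))) @ s rA,
      rB := rev (map snd (thin v d (e # es))) @ s rB, rF := f, rG := g, rT := t)"
    by (cases d; cases ?i) (auto simp: s' e fun_eq_iff)
  ultimately show ?case by metis
qed

definition write_nil :: "state \<Rightarrow> state" where
  "write_nil = loop rE rA thin_body ;; new rO ;; emit Zero rO ;; new rO ;; loop rB rO (move rA rO) ;;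
     new rO ;; loop rV rO skip"

text \<open>The alternative \<open>es = []\<close> is for the graph without vertices, where there is
  nothing to put on \<open>X\<close>.\<close>

lemma write_nil_eq:
  assumes "ready es s" "s rX = [v] \<or> es = []" "s rO = []"
  shows "write_nil s rO = rev (s rV) @ [] # flat (thin v False es) @ [[], [Zero]]"
    "write_nil s rI = s rI"
proof -
  have "\<exists>f g t. loop rE rA thin_body s = s(rE := [], rA := rev (map fst (thin v False es)),
      rB := rev (map snd (thin v False es)), rF := f, rG := g, rT := t)"
  proof (cases "es = []")
    case True
    then have "loop rE rA thin_body s = s(rE := [], rA := rev (map fst (thin v False es)),
      rB := rev (map snd (thin v False es)), rF := s rF, rG := s rG, rT := s rT)"
      using assms(1) by (auto simp: ready_def fun_eq_iff)
    then show ?thesis by blast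
  next
    case False
    then show ?thesis using thin_loop[of s es v False] assms by (simp add: ready_def)
  qed
  then obtain f g t where l: "loop rE rA thin_body s = s(rE := [],
      rA := rev (map fst (thin v False es)), rB := rev (map snd (thin v False es)),
      rF := f, rG := g, rT := t)"
    by blast
  have "rev (zip (rev (map fst xs)) (rev (map snd xs))) = xs" for xs :: "(sym list \<times> sym list) list"
    by (simp add: rev_map zip_map_fst_snd)
  then show "write_nil s rO = rev (s rV) @ [] # flat (thin v False es) @ [[], [Zero]]"
    "write_nil s rI = s rI"
    using assms(3) by (simp_all add: write_nil_def l exec_simps loop_zip)
qed

text \<open>
  The stack \<open>Q\<close> holds \<open>n + 3\<close> tokens, and every edge at the current vertex takes three of them; the
  flag is set if they do not suffice.
\<close>

definition take_token :: "state \<Rightarrow> state" where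
  "take_token = branch (\<lambda>s. s rQ = []) (move rF rG) (move rQ rQ')"

definition degree_body :: "state \<Rightarrow> state" where
  "degree_body = move rE rB ;; branch at_vertex (take_token ;; take_token ;; take_token) skip"

text \<open>Spent tokens wait on \<open>Q'\<close> and are poured back, so each vertex is measured
  against the same supply.\<close>

definition degree_flag :: "state \<Rightarrow> state" where
  "degree_flag = loop rE rA degree_body ;; loop rB rE (move rA rE) ;; loop rQ' rQ skip"

lemma take_tokens:
  assumes "s rF = unset d" "s rG = unset (\<not> d)"
  shows "(take_token ;; take_token ;; take_token) s = s(rQ := drop 3 (s rQ),
    rQ' := rev (take 3 (s rQ)) @ s rQ', rF := unset (d \<or> length (s rQ) < 3),
    rG := unset (\<not> (d \<or> length (s rQ) < 3)))"
proof -
  consider "s rQ = []" | a where "s rQ = [a]" | a b where "s rQ = [a, b]"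
    | a b c Q where "s rQ = a # b # c # Q"
    by (metis list.exhaust)
  then show ?thesis
    using assms by cases (cases d; auto simp: take_token_def exec_simps fun_eq_iff)+
qed

lemma keeps_length_degree_body: "i \<notin> {rB, rG, rQ'} \<Longrightarrow> keeps_length i degree_body"
  unfolding degree_body_def take_token_def by (intro keeps_length_intros) auto

lemma degree_loop:
  assumes "s rE = flat es" "s rX = [v]" "s rF = unset d" "s rG = unset (\<not> d)"
  defines "k \<equiv> 3 * length (filter (incident v) es)"
  shows "loop rE rA degree_body s = s(rE := [], rA := rev (map fst es) @ s rA,
    rB := rev (map snd es) @ s rB, rQ := drop k (s rQ), rQ' := rev (take k (s rQ)) @ s rQ',
    rF := unset (d \<or> length (s rQ) < k), rG := unset (\<not> (d \<or> length (s rQ) < k)))"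
  using assms(1-4) unfolding k_def
proof (induction es arbitrary: s d)
  case Nil
  then show ?case by (auto simp: fun_eq_iff)
next
  case (Cons e es)
  obtain p q where e: "e = (p, q)" by (cases e)
  let ?k = "3 * length (filter (incident v) es)"
  let ?m = "s(rE := flat es, rA := p # s rA, rB := q # s rB)"
  define s' where "s' = degree_body (move rE rA s)"
  define j where "j = (if incident v e then 3 else 0 :: nat)"
  have "s' = (if incident v e then (take_token ;; take_token ;; take_token) ?m else ?m)"
    using Cons.prems unfolding s'_def
    by (auto simp: degree_body_def andthen_def branch_def skip_def move_Cons at_vertex_def
        incident_def e fun_upd_twist)
  also have "\<dots> = ?m(rQ := drop j (s rQ), rQ' := rev (take j (s rQ)) @ s rQ',
      rF := unset (d \<or> length (s rQ) < j), rG := unset (\<not> (d \<or> length (s rQ) < j)))"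
    using take_tokens[of ?m d] Cons.prems by (auto simp: j_def fun_eq_iff)
  finally have s': "s' = \<dots>" .
  have "loop rE rA degree_body s = loop rE rA degree_body s'"
    unfolding s'_def by (rule loop_step) (use Cons.prems e in \<open>auto intro: keeps_length_degree_body\<close>)
  also have "\<dots> = s'(rE := [], rA := rev (map fst es) @ s' rA,
    rB := rev (map snd es) @ s' rB, rQ := drop ?k (s' rQ), rQ' := rev (take ?k (s' rQ)) @ s' rQ',
    rF := unset ((d \<or> length (s rQ) < j) \<or> length (s' rQ) < ?k),
    rG := unset (\<not> ((d \<or> length (s rQ) < j) \<or> length (s' rQ) < ?k)))"
    by (rule Cons.IH) (use Cons.prems in \<open>auto simp: s'\<close>)
  also have "\<dots> = s(rE := [], rA := rev (map fst (e # es)) @ s rA,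
    rB := rev (map snd (e # es)) @ s rB, rQ := drop (j + ?k) (s rQ),
    rQ' := rev (take (j + ?k) (s rQ)) @ s rQ',
    rF := unset (d \<or> length (s rQ) < j + ?k), rG := unset (\<not> (d \<or> length (s rQ) < j + ?k)))"
  proof -
    have "(d \<or> length (s rQ) < j) \<or> length (drop j (s rQ)) < ?k \<longleftrightarrow> d \<or> length (s rQ) < j + ?k"
      by auto
    then show ?thesis by (auto simp: s' e fun_eq_iff take_add add.commute)
  qed
  also have "j + ?k = 3 * length (filter (incident v) (e # es))" by (simp add: j_def)
  finally show ?case .
qed

lemma degree_flag_eq:
  assumes "ready es s" "s rX = [v]" "s rQ' = []"
  defines "h \<equiv> length (s rQ) < 3 * length (filter (incident v) es)"
  shows "degree_flag s = s(rF := unset h, rG := unset (\<not> h))"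
proof -
  have "rev (zip (rev (map fst xs)) (rev (map snd xs))) = xs" for xs :: "(sym list \<times> sym list) list"
    by (simp add: rev_map zip_map_fst_snd)
  then show ?thesis
    using assms degree_loop[of s es v False]
    by (auto simp: ready_def degree_flag_def andthen_def loop_zip loop_skip_eq fun_eq_iff)
qed

definition classify_body :: "state \<Rightarrow> state" where
  "classify_body = degree_flag ;; branch (\<lambda>s. s rG = []) (move rX rL) (move rG rF ;; move rX rP)"

lemma keeps_length_classify_body: "keeps_length rC classify_body"
  unfolding classify_body_def degree_flag_def
  by (intro keeps_length_intros keeps_length_degree_body) auto

lemma classify_loop:
  assumes "ready es s" "s rX = []" "s rQ' = []" "s rC = cs"
  defines "high \<equiv> (\<lambda>v. length (s rQ) < 3 * length (filter (incident v) es))"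
  shows "loop rC rX classify_body s = s(rC := [], rL := rev (filter (\<lambda>v. \<not> high v) cs) @ s rL,
    rP := rev (filter high cs) @ s rP)"
  using assms(1-4) unfolding high_def
proof (induction cs arbitrary: s)
  case Nil
  then show ?case by (auto simp: fun_eq_iff)
next
  case (Cons v cs)
  let ?h = "length (s rQ) < 3 * length (filter (incident v) es)"
  let ?m = "s(rC := cs, rX := [v])"
  let ?s' = "s(rC := cs, rL := (if ?h then s rL else v # s rL), rP := (if ?h then v # s rP else s rP))"
  have "degree_flag ?m = ?m(rF := unset ?h, rG := unset (\<not> ?h))"
    using degree_flag_eq[of es ?m v] Cons.prems by (simp add: ready_def)
  then have b: "classify_body ?m = ?s'"
    using Cons.prems by (auto simp: classify_body_def exec_simps ready_def fun_eq_iff)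
  have "loop rC rX classify_body s = loop rC rX classify_body (classify_body (move rC rX s))"
    by (rule loop_step) (use Cons.prems keeps_length_classify_body in auto)
  also have "move rC rX s = ?m" using Cons.prems by (simp add: move_Cons)
  also have "loop rC rX classify_body (classify_body ?m) = ?s'(rC := [],
      rL := rev (filter (\<lambda>v. \<not> length (?s' rQ) < 3 * length (filter (incident v) es)) cs) @ ?s' rL,
      rP := rev (filter (\<lambda>v. length (?s' rQ) < 3 * length (filter (incident v) es)) cs) @ ?s' rP)"
    unfolding b by (rule Cons.IH) (use Cons.prems in \<open>auto simp: ready_def\<close>)
  also have "\<dots> = s(rC := [],
      rL := rev (filter (\<lambda>v. \<not> length (s rQ) < 3 * length (filter (incident v) es)) (v # cs)) @ s rL,
      rP := rev (filter (\<lambda>v. length (s rQ) < 3 * length (filter (incident v) es)) (v # cs)) @ s rP)"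
    by (auto simp: fun_eq_iff)
  finally show ?case .
qed

text \<open>The empty token behind the vertices goes to \<open>F\<close>, where it records that
  edges follow and afterwards serves as the flag token demanded by \<open>ready\<close>. The one
  behind the edges ends up on top of \<open>E\<close> and is thrown away by
  \<open>parse\<close>.\<close>

definition parse_body :: "state \<Rightarrow> state" where
  "parse_body = branch (\<lambda>s. s rF = [])
     (branch (\<lambda>s. peek (s rZ) = Some []) (move rZ rF) (move rZ rV)) (move rZ rE)"

definition parse :: "state \<Rightarrow> state" where
  "parse = loop rI rZ parse_body ;; move rE rT"

lemma keeps_length_parse_body: "keeps_length rI parse_body"
  unfolding parse_body_def by (intro keeps_length_intros) auto

lemma parse_edges:
  assumes "s rI = ys" "s rZ = []" "s rF \<noteq> []"
  shows "loop rI rZ parse_body s = s(rI := [], rE := rev ys @ s rE)"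
  using assms
proof (induction ys arbitrary: s)
  case Nil
  then show ?case by (auto simp: fun_eq_iff)
next
  case (Cons y ys)
  have "loop rI rZ parse_body s = loop rI rZ parse_body (parse_body (move rI rZ s))"
    by (rule loop_step) (use Cons.prems keeps_length_parse_body in auto)
  also have "parse_body (move rI rZ s) = s(rI := ys, rE := y # s rE)"
    using Cons.prems by (auto simp: parse_body_def exec_simps fun_eq_iff)
  also have "loop rI rZ parse_body (s(rI := ys, rE := y # s rE)) =
      (s(rI := ys, rE := y # s rE))(rI := [], rE := rev ys @ (s(rI := ys, rE := y # s rE)) rE)"
    by (rule Cons.IH) (use Cons.prems in auto)
  finally show ?case by (auto simp: fun_eq_iff)
qed

lemma parse_loop:
  assumes "s rI = xs @ [] # ys" "[] \<notin> set xs" "s rZ = []" "s rF = []"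
  shows "loop rI rZ parse_body s =
    s(rI := [], rV := rev xs @ s rV, rF := [[]], rE := rev ys @ s rE)"
  using assms
proof (induction xs arbitrary: s)
  case Nil
  have "loop rI rZ parse_body s = loop rI rZ parse_body (parse_body (move rI rZ s))"
    by (rule loop_step) (use Nil.prems keeps_length_parse_body in auto)
  also have "parse_body (move rI rZ s) = s(rI := ys, rF := [[]])"
    using Nil.prems by (auto simp: parse_body_def exec_simps fun_eq_iff)
  also have "loop rI rZ parse_body (s(rI := ys, rF := [[]])) =
      (s(rI := ys, rF := [[]]))(rI := [], rE := rev ys @ (s(rI := ys, rF := [[]])) rE)"
    by (rule parse_edges) (use Nil.prems in auto)
  finally show ?case by (auto simp: fun_eq_iff)
next
  case (Cons x xs)
  let ?s' = "s(rI := xs @ [] # ys, rV := x # s rV)"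
  have "loop rI rZ parse_body s = loop rI rZ parse_body (parse_body (move rI rZ s))"
    by (rule loop_step) (use Cons.prems keeps_length_parse_body in auto)
  also have "parse_body (move rI rZ s) = ?s'"
    using Cons.prems by (auto simp: parse_body_def exec_simps fun_eq_iff)
  also have "loop rI rZ parse_body ?s' =
      ?s'(rI := [], rV := rev xs @ ?s' rV, rF := [[]], rE := rev ys @ ?s' rE)"
    by (rule Cons.IH) (use Cons.prems in auto)
  finally show ?case by (auto simp: fun_eq_iff)
qed

text \<open>The three additional tokens are the 3 in the comparison of \<open>n + 3\<close> with
  three times the degree; they also make the number of rounds exceed \<open>n\<close>.\<close>

definition duplicate :: "state \<Rightarrow> state" where
  "duplicate = loop rV rA (copy rA rC ;; copy rA rQ) ;; loop rA rV skip ;; new rQ ;; new rQ ;; new rQ"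

lemma copy_loop:
  assumes "s rV = vs"
  shows "loop rV rA (copy rA rC ;; copy rA rQ) s =
    s(rV := [], rA := rev vs @ s rA, rC := rev vs @ s rC, rQ := rev vs @ s rQ)"
  using assms
proof (induction vs arbitrary: s)
  case Nil
  then show ?case by (auto simp: fun_eq_iff)
next
  case (Cons v vs)
  let ?f = "copy rA rC ;; copy rA rQ"
  let ?s' = "s(rV := vs, rA := v # s rA, rC := v # s rC, rQ := v # s rQ)"
  have "loop rV rA ?f s = loop rV rA ?f (?f (move rV rA s))"
    by (rule loop_step) (use Cons.prems in \<open>auto intro!: keeps_length_intros\<close>)
  also have "?f (move rV rA s) = ?s'"
    using Cons.prems by (auto simp: exec_simps fun_eq_iff)
  also have "loop rV rA ?f ?s' =
      ?s'(rV := [], rA := rev vs @ ?s' rA, rC := rev vs @ ?s' rC, rQ := rev vs @ ?s' rQ)"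
    by (rule Cons.IH) auto
  finally show ?case by (auto simp: fun_eq_iff)
qed

definition start_cycle :: "state \<Rightarrow> state" where
  "start_cycle = move rP rY ;; loop rP rR skip ;; move rR rX"

lemma start_cycle_eq:
  assumes "s rP = rev c" "2 \<le> length c" "s rX = []" "s rY = []" "s rR = []"
  shows "start_cycle s = put c (s(rP := []))"
proof -
  obtain x r y where c: "c = x # r @ [y]"
    using assms(2) by (cases c; cases "tl c" rule: rev_cases) auto
  then show ?thesis
    using assms by (auto simp: start_cycle_def exec_simps put_def fun_eq_iff)
qed

text \<open>If no vertex has low degree, \<open>P\<close> is empty only for the graph without
  vertices, which is not Hamiltonian as it stands.\<close>

definition solve :: "state \<Rightarrow> state" where
  "solve = parse ;; duplicate ;; loop rC rX classify_body ;;
     branch (\<lambda>s. \<not> s rL = [] \<or> s rP = []) (move rL rX ;; write_nil)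
       (start_cycle ;; loop rQ rQ' sweeps_prog ;; collect_gaps ;; write_cycle)"

section \<open>Running time\<close>

lemma ptime_if_adj:
  assumes "ptime nregs [:k, 1:] f" "ptime nregs [:k, 1:] g" "a < nregs" "b < nregs"
    "a \<notin> scratch" "b \<notin> scratch"
  shows "ptime nregs [:k, 1:] (if_adj a b f g)"
proof -
  have "ptime_pure nregs (adj_flag a b)"
    unfolding adj_flag_def adj_body_def same_edge_def
    by (intro ptime_pure_intros) (use assms in auto)
  moreover have "ptime nregs [:0 + k, 1:] (move rG rF ;; f)"
    by (intro ptime_andthen_additive ptime_move assms) auto
  then have "ptime nregs [:k, 1:] (branch (\<lambda>s. s rG = []) g (move rG rF ;; f))"
    by (intro ptime_branch ptest_empty assms) auto
  ultimately show ?thesis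
    unfolding if_adj_def using ptime_andthen_additive[of nregs 0] by fastforce
qed

lemmas ptime_pure_if_adj = ptime_if_adj[where k = 0]

lemma ptime_sweeps: "ptime_pure nregs (loop rQ rQ' sweeps_prog)"
  unfolding sweeps_prog_def sweep_prog_def scan_body_def reverse_prefix_def
  by (intro ptime_pure_intros ptime_pure_if_adj keeps_length_if_adj) auto

lemma ptime_classify: "ptime_pure nregs (loop rC rX classify_body)"
  unfolding classify_body_def degree_flag_def degree_body_def take_token_def at_vertex_def
  by (intro ptime_pure_intros) auto

lemma ptime_parse: "ptime_pure nregs parse"
  unfolding parse_def parse_body_def by (intro ptime_pure_intros) auto

lemma ptime_start_cycle: "ptime_pure nregs start_cycle"
  unfolding start_cycle_def by (intro ptime_pure_intros) auto

text \<open>At the top level nothing is iterated any more, so arbitrary polynomial size bounds may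
  be composed.\<close>

definition polytime :: "(state \<Rightarrow> state) \<Rightarrow> bool" where
  "polytime f \<longleftrightarrow> (\<exists>q. ptime nregs q f)"

lemma polytime_ptime: "ptime nregs q f \<Longrightarrow> polytime f"
  by (auto simp: polytime_def)

lemma polytime_pure: "ptime_pure nregs f \<Longrightarrow> polytime f"
  by (rule polytime_ptime)

lemma polytime_andthen: "polytime f \<Longrightarrow> polytime g \<Longrightarrow> polytime (f ;; g)"
  unfolding polytime_def using ptime_andthen by blast

lemma polytime_branch:
  assumes "ptest nregs P" "polytime f" "polytime g"
  shows "polytime (branch P f g)"
proof -
  obtain q r where "ptime nregs q f" "ptime nregs r g" using assms(2,3) by (auto simp: polytime_def)
  then have "ptime nregs (q + r) f" "ptime nregs (q + r) g"
    by (auto intro: ptime_weaken)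
  then show ?thesis using assms(1) polytime_ptime ptime_branch by blast
qed

text \<open>A gap costs two new tokens, so this body is not pure; its loop is not nested in another
  one.\<close>

lemma ptime_gap_step: "ptime nregs [:2, 1:] gap_step"
proof -
  have "ptime nregs [:1 + 1, 1:] (copy rP rN ;; copy rZ rN)"
    by (intro ptime_andthen_additive ptime_copy) auto
  then have "ptime nregs [:2, 1:] (copy rP rN ;; copy rZ rN)"
    by (simp only: one_add_one)
  moreover have "ptime nregs [:2, 1:] skip"
    by (rule ptime_weaken[OF ptime_skip]) simp
  ultimately have "ptime nregs [:2, 1:] (if_adj rP rZ skip (copy rP rN ;; copy rZ rN))"
    by (intro ptime_if_adj) auto
  moreover have "ptime nregs [:0, 1:] (move rZ rP)" by (intro ptime_move) auto
  ultimately have "ptime nregs [:2 + 0, 1:] gap_step"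
    unfolding gap_step_def by (rule ptime_andthen_additive)
  then show ?thesis by simp
qed

lemma polytime_skip_loop: "i < nregs \<Longrightarrow> j < nregs \<Longrightarrow> i \<noteq> j \<Longrightarrow> polytime (loop i j skip)"
  by (rule polytime_pure) (intro ptime_pure_intros)

lemma polytime_move: "i < nregs \<Longrightarrow> j < nregs \<Longrightarrow> i \<noteq> j \<Longrightarrow> polytime (move i j)"
  by (rule polytime_ptime, rule ptime_move)

lemma polytime_copy: "i < nregs \<Longrightarrow> j < nregs \<Longrightarrow> i \<noteq> j \<Longrightarrow> polytime (copy i j)"
  by (rule polytime_ptime, rule ptime_copy)

lemma polytime_new: "i < nregs \<Longrightarrow> polytime (new i)"
  by (rule polytime_ptime, rule ptime_new)

lemma polytime_emit: "i < nregs \<Longrightarrow> a \<noteq> Sep \<Longrightarrow> polytime (emit a i)"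
  by (rule polytime_ptime, rule ptime_emit)

lemmas polytime_intros = polytime_andthen polytime_skip_loop polytime_move polytime_copy
  polytime_new polytime_emit

lemma polytime_collect_gaps: "polytime collect_gaps"
proof -
  have "polytime (loop rR rZ gap_step)"
    by (rule polytime_ptime, rule ptime_loop[OF ptime_gap_step keeps_length_gap_step]) auto
  then show ?thesis
    unfolding collect_gaps_def by (intro polytime_intros) auto
qed

lemma polytime_duplicate: "polytime duplicate"
proof -
  have "ptime nregs [:1 + 1, 1:] (copy rA rC ;; copy rA rQ)"
    by (intro ptime_andthen_additive ptime_copy) auto
  then have "polytime (loop rV rA (copy rA rC ;; copy rA rQ))"
    by (rule polytime_ptime[OF ptime_loop]) (auto intro!: keeps_length_intros)
  then show ?thesis
    unfolding duplicate_def by (intro polytime_intros) auto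
qed

lemma polytime_write_cycle: "polytime write_cycle"
  unfolding write_cycle_def by (intro polytime_intros) auto

lemma polytime_write_nil: "polytime write_nil"
proof -
  have "polytime (loop rE rA thin_body)"
    unfolding thin_body_def at_vertex_def
    by (rule polytime_pure) (intro ptime_pure_intros; simp)
  moreover have "polytime (loop rB rO (move rA rO))"
    by (rule polytime_pure) (intro ptime_pure_intros; simp)
  ultimately show ?thesis
    unfolding write_nil_def by (intro polytime_intros) auto
qed

lemma polytime_solve: "polytime solve"
  unfolding solve_def
  by (intro polytime_intros polytime_branch polytime_collect_gaps polytime_duplicate
      polytime_write_cycle polytime_write_nil polytime_ptime[OF ptime_parse]
      polytime_ptime[OF ptime_classify] polytime_ptime[OF ptime_sweeps]
      polytime_ptime[OF ptime_start_cycle] ptest_intros) auto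

lemma length_word:
  assumes "\<And>w. w \<in> set ws \<Longrightarrow> length w \<le> b"
  shows "length (word ws) \<le> length ws * (b + 1)"
  using assms by (induction ws) (fastforce intro: add_mono)+

lemma length_le_word: "length ws \<le> length (word ws)" "w \<in> set ws \<Longrightarrow> length w \<le> length (word ws)"
  by (induction ws) auto

text \<open>Transferring the output stack twice to another tape removes its last separator on the way.\<close>

lemma ptime_machine:
  assumes "ptime K q f" "out < K" "out \<noteq> 0"
  shows "\<exists>M p. wf_tm M \<and> (\<forall>toks v.
    (\<forall>x \<in> set toks. Sep \<notin> set x) \<longrightarrow> f ((\<lambda>_. [])(0 := toks)) 0 = [] \<longrightarrow>
    word (f ((\<lambda>_. [])(0 := toks)) out) = v @ [Sep] \<longrightarrow>
    (\<exists>t \<le> poly p (length (word toks)). tm_computes M (word toks) t v))"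
proof -
  obtain c p where c: "uses_below (K + 2) c"
    "\<And>B s. bd K B s \<Longrightarrow> bd K (poly q B) (f s)"
    "\<And>B s. bd K B s \<Longrightarrow> \<exists>t \<le> poly p B. ex c (enc K s) t (enc K (f s))"
    using assms(1) by (rule ptimeE) (rule that)
  define d where "d = Seq c (Seq (xfer {} out K) (Seq (Pop K) (xfer {} K 0)))"
  have ub: "uses_below (K + 2) d" using c(1) assms(2) by (simp add: d_def xfer_def)
  \<comment> \<open>The output word has at most \<open>q * (q + 1)\<close> symbols, counting a
    separator for each token, and the two transfers take five steps per symbol each.\<close>
  define r where "r = p + [:20:] + [:10:] * (q * (q + 1))"
  have "\<exists>t \<le> poly r (length (word toks)). tm_computes (machine (K + 2) (compile 0 d)) (word toks) t v"
    if toks: "\<forall>x \<in> set toks. Sep \<notin> set x" and f0: "f ((\<lambda>_. [])(0 := toks)) 0 = []"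
      and out: "word (f ((\<lambda>_. [])(0 := toks)) out) = v @ [Sep]" for toks v
  proof -
    let ?s = "(\<lambda>_. [])(0 := toks) :: state"
    let ?B = "length (word toks)"
    let ?W = "length (word (f ?s out))"
    have e0: "enc K ?s = (\<lambda>_. [])(0 := word toks)"
      using assms(2) by (auto simp: enc_def)
    have "(\<Sum>i<K. length (?s i)) \<le> ?B"
      using sum_length_update[of 0 K "\<lambda>_. []" toks] assms(2) length_le_word(1)[of toks] by simp
    then have b: "bd K ?B ?s" using toks length_le_word(2)[of _ toks] by (auto simp: bd_def)
    obtain t where t: "t \<le> poly p ?B" "ex c (enc K ?s) t (enc K (f ?s))"
      using c(3)[OF b] by blast
    have b': "bd K (poly q ?B) (f ?s)" by (rule c(2)[OF b])
    have "?W \<le> length (f ?s out) * (poly q ?B + 1)"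
      using b' assms(2) by (intro length_word) (auto simp: bd_def)
    also have "\<dots> \<le> poly q ?B * (poly q ?B + 1)"
      using bd_length[OF b' assms(2)] by (rule mult_le_mono1)
    finally have W: "?W \<le> poly q ?B * (poly q ?B + 1)" .
    let ?o = "enc K (f ?s)"
    let ?o1 = "?o(out := [], K := Sep # rev v)" and ?o2 = "?o(out := [], K := rev v)"
    let ?o3 = "?o2(K := [], 0 := rev (rev v) @ ?o2 0)"
    have oK: "?o K = []" "?o out = v @ [Sep]" "?o 0 = []" using assms(2) out f0 by (simp_all add: enc_def)
    have 1: "ex (xfer {} out K) ?o (5 * ?W + 1) ?o1"
      using ex_xfer[of out K ?o "v @ [Sep]" "[]" "{}"] oK assms(2) out by simp
    have "?o1(K := tl (?o1 K)) = ?o2" by auto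
    then have 2: "ex (Pop K) ?o1 1 ?o2" using ex.Pop[of K ?o1] by simp
    have 3: "ex (xfer {} K 0) ?o2 (5 * length (rev v) + 1) ?o3"
      using ex_xfer[of K 0 ?o2 "rev v" "[]" "{}"] assms(2) by simp
    have ex: "ex d ((\<lambda>_. [])(0 := word toks)) (t + (5 * ?W + 1 + (1 + (5 * length (rev v) + 1)))) ?o3"
      unfolding d_def e0[symmetric] by (intro ex.Seq[OF t(2)] ex.Seq[OF 1] ex.Seq[OF 2] 3)
    have "tm_computes (machine (K + 2) (compile 0 d)) (word toks)
        (t + (5 * ?W + 1 + (1 + (5 * length (rev v) + 1)))) v"
      by (rule compile_computes[OF ex ub]) (use oK assms in auto)
    moreover have "length v \<le> ?W" using out by simp
    then have "t + (5 * ?W + 1 + (1 + (5 * length (rev v) + 1))) \<le> poly r ?B"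
      using t(1) W by (simp add: r_def)
    ultimately show ?thesis by blast
  qed
  moreover have "wf_tm (machine (K + 2) (compile 0 d))" by (rule machine_wf[OF _ ub]) simp
  ultimately show ?thesis by blast
qed

section \<open>Correctness\<close>

lemma vertices_word_eq: "vertices_word vs = word (map bin vs @ [[]])"
  by (induction vs) (auto simp: vertices_word_def)

abbreviation bin2 :: "nat \<times> nat \<Rightarrow> sym list \<times> sym list" where
  "bin2 \<equiv> map_prod bin bin"

lemma edges_word_eq: "edges_word es = word (flat (map bin2 es) @ [[]])"
  by (induction es) (auto simp: edges_word_def)

section \<open>Transport along the binary notation of vertices\<close>

lemma inj_bin: "inj bin"
  by (simp add: inj_def bin_inject)

lemma thin_bin: "thin (bin v) b (map bin2 es) = map bin2 (thin v b es)"
proof (induction es arbitrary: b)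
  case (Cons e es)
  have "incident (bin v) (bin2 e) \<longleftrightarrow> incident v e"
    by (simp add: incident_def bin_inject)
  then show ?case using Cons.IH by simp
qed simp

lemma adj_bin: "adj (map bin2 es) (bin u) (bin v) \<longleftrightarrow> adj es u v"
  by (auto simp: adj_def map_prod_def bin_inject image_iff split: prod.splits)

lemma gap_pairs_bin: "gap_pairs (map bin2 es) (map bin c) = map bin2 (gap_pairs es c)"
proof -
  have "filter (\<lambda>(u, v). \<not> adj (map bin2 es) u v) (map bin2 xs) =
      map bin2 (filter (\<lambda>(u, v). \<not> adj es u v) xs)" for xs
    by (induction xs) (auto simp: adj_bin)
  then show ?thesis by (simp add: gap_pairs_def zip_map_map rotate1_map map_prod_def)
qed

lemma incident_bin: "length (filter (incident (bin v)) (map bin2 es)) = length (filter (incident v) es)"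
proof -
  have "filter (incident (bin v)) (map bin2 es) = map bin2 (filter (incident v) es)"
    by (induction es) (auto simp: incident_def bin_inject)
  then show ?thesis by simp
qed

lemma simple_edges_bin:
  assumes "simple_edges V es"
  shows "simple_edges (bin ` V) (map bin2 es)"
proof -
  have "map edge_set (map bin2 es) = map ((`) bin) (map edge_set es)"
    by (induction es) auto
  moreover have "inj ((`) bin)" using inj_bin by (simp add: inj_image_eq_iff inj_def)
  moreover have "distinct (map edge_set es)" using assms by (simp add: simple_edges_def)
  ultimately have "distinct (map edge_set (map bin2 es))"
    using distinct_map[of "(`) bin"] inj_on_subset[OF _ subset_UNIV] by metis
  then show ?thesis using assms by (auto simp: simple_edges_def bin_inject)
qed

lemma edge_set_swap: "edge_set (prod.swap e) = edge_set e"
  by (cases e) (auto simp: insert_commute)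

lemma simple_edges_swap:
  assumes "simple_edges V es"
  shows "simple_edges V (map prod.swap (rev es))"
proof -
  have "map edge_set (map prod.swap (rev es)) = rev (map edge_set es)"
    unfolding rev_map map_map o_def edge_set_swap ..
  then show ?thesis using assms by (auto simp: simple_edges_def)
qed

lemma edge_set_image_swap: "edge_set ` set (map prod.swap (rev es)) = edge_set ` set es"
  by (simp only: set_map set_rev image_image edge_set_swap)

section \<open>Both kinds of answers and their distance from the input\<close>

lemma dist_E_le:
  assumes "verts G = verts J" "3 * card (sym_diff (edges G) (edges J)) \<le> n"
  shows "dist_E G J \<le> ennreal (real n / 3)"
proof -
  have "real (card (sym_diff (edges G) (edges J))) \<le> real n / 3" using assms(2) by linarith
  then show ?thesis
    using assms(1) by (simp add: dist_E_def ennreal_of_nat_eq_real_of_nat ennreal_leI)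
qed

lemma simple_graph_edges:
  assumes "simple_edges (set vs) es" "verts G = set vs" "edges G = edge_set ` set es"
  shows "simple_graph G"
  using assms by (fastforce simp: simple_graph_def simple_edges_def)

lemma graph_encI:
  assumes "distinct vs" "simple_edges (set vs) es"
  shows "graph_enc \<lparr>verts = set vs, edges = edge_set ` set es\<rparr> (vertices_word vs @ edges_word es)"
  using assms unfolding graph_enc_def simple_edges_def by auto

text \<open>It measures the distance for both answers: when edges are added, the output graph takes
  the role of \<open>es\<close>.\<close>

lemma few_edges_removed:
  assumes "simple_edges V es" "simple_edges V es'" "set es' \<subseteq> set es"
  shows "card (edge_set ` set es - edge_set ` set es') = length es - length es'"
proof -
  have c: "card (edge_set ` set xs) = length xs" if "simple_edges V xs" for xs :: "('a \<times> 'a) list"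
    using that distinct_card[of "map edge_set xs"] by (simp add: simple_edges_def)
  have "card (edge_set ` set es - edge_set ` set es') =
      card (edge_set ` set es) - card (edge_set ` set es')"
    using assms(3) by (intro card_Diff_subset image_mono) auto
  then show ?thesis using c assms by simp
qed

lemma nil_answer:
  assumes "distinct vs" "simple_edges (set vs) es" "verts G = set vs" "edges G = edge_set ` set es"
    "v \<in> set vs \<and> 3 * length (filter (incident v) es) \<le> length vs + 3 \<or> vs = []"
  defines "J \<equiv> \<lparr>verts = set vs, edges = edge_set ` set (thin v False es)\<rparr>"
  shows "(J, None) \<in> answers (Rel Hamiltonian_Cycle dist_E (\<lambda>n. ennreal (real n / 3))) G"
proof -
  let ?es = "thin v False es"
  have si: "simple_edges (set vs) ?es" by (rule simple_edges_thin[OF assms(2)])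
  then have "simple_graph J" by (intro simple_graph_edges[of vs ?es]) (auto simp: J_def)
  moreover have "\<not> hamiltonian_cycle J c" for c
  proof (cases "vs = []")
    case False
    then show ?thesis
      using not_hamiltonian[of J ?es v c] incident_thin[of v False es] assms(5)
      by (auto simp: J_def)
  qed (auto simp: J_def hamiltonian_cycle_def)
  moreover have "dist_E G J \<le> ennreal (real (card (verts G)) / 3)"
  proof (rule dist_E_le)
    have sub: "edge_set ` set ?es \<subseteq> edge_set ` set es" by (intro image_mono set_thin)
    have "card (sym_diff (edges G) (edges J)) = card (edge_set ` set es - edge_set ` set ?es)"
      using sub assms(4) by (simp add: J_def Diff_eq_empty_iff[THEN iffD2])
    also have "\<dots> = length es - length ?es"
      by (rule few_edges_removed[OF assms(2) si set_thin])
    finally have c: "card (sym_diff (edges G) (edges J)) = length es - length ?es" .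
    have n: "card (verts G) = length vs" using assms(1,3) distinct_card by simp
    show "3 * card (sym_diff (edges G) (edges J)) \<le> card (verts G)"
    proof (cases "vs = []")
      case True
      then have "es = []" using assms(2) by (cases es) (auto simp: simple_edges_def)
      then show ?thesis by (simp add: c)
    next
      case False
      then have "3 * length (filter (incident v) es) \<le> length vs + 3" using assms(5) by simp
      moreover have "length es - length ?es \<le> length (filter (incident v) es) - 1"
        using length_thin[of es v False] by simp
      \<comment> \<open>For degree \<open>Suc d\<close> the hypothesis is
        \<open>3 * d \<le> n\<close>; for degree 0 the subtraction is truncated and no edge is
        removed.\<close>
      ultimately show ?thesis
        unfolding c n by (cases "length (filter (incident v) es)") auto
    qed
  qed (simp add: J_def assms(3))
  ultimately show ?thesis
    by (auto simp: Rel_def Hamiltonian_Cycle_def or_nil_def)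
qed

lemma cycle_answer:
  assumes "distinct c" "3 \<le> length c" "simple_edges (set c) es" "verts G = set c"
    "edges G = edge_set ` set es" "3 * length (gap_pairs es c) \<le> length c"
  defines "J \<equiv> \<lparr>verts = set c, edges = edge_set ` set (es @ gap_pairs es c)\<rparr>"
  shows "(J, Some c) \<in> answers (Rel Hamiltonian_Cycle dist_E (\<lambda>n. ennreal (real n / 3))) G"
proof -
  let ?es = "es @ gap_pairs es c"
  have si: "simple_edges (set c) ?es" by (rule simple_edges_add_gaps[OF assms(3,1,2)])
  then have "simple_graph J" by (intro simple_graph_edges[of c ?es]) (auto simp: J_def)
  moreover have "hamiltonian_cycle J c"
    by (rule hamiltonian_add_gaps[of _ es]) (use assms in \<open>auto simp: J_def\<close>)
  moreover have "dist_E G J \<le> ennreal (real (card (verts G)) / 3)"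
  proof (rule dist_E_le)
    have "sym_diff (edges G) (edges J) = edge_set ` set ?es - edge_set ` set es"
      by (auto simp: J_def assms(5))
    then have "card (sym_diff (edges G) (edges J)) = length (gap_pairs es c)"
      using few_edges_removed[OF si assms(3)] by simp
    moreover have "card (verts G) = length c" using assms(1,4) distinct_card by simp
    ultimately show "3 * card (sym_diff (edges G) (edges J)) \<le> card (verts G)"
      using assms(6) by simp
  qed (simp add: J_def assms(4))
  ultimately show ?thesis
    by (auto simp: Rel_def Hamiltonian_Cycle_def or_nil_def)
qed

lemma adj_swap: "adj (map prod.swap (rev es)) = adj es"
  by (force simp: adj_def fun_eq_iff)

lemma gap_pairs_swap: "gap_pairs (map prod.swap (rev es)) c = gap_pairs es c"
  by (simp add: gap_pairs_def adj_swap)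

lemma bin2_swap: "map bin2 (map prod.swap (rev es)) = map prod.swap (rev (map bin2 es))"
  by (simp add: rev_map prod.map_comp split_def map_prod_def prod.swap_def)

definition input_state :: "nat list \<Rightarrow> (nat \<times> nat) list \<Rightarrow> state" where
  "input_state vs es = (\<lambda>_. [])(rI := map bin vs @ [] # flat (map bin2 es) @ [[]])"

text \<open>Parsing reverses the list of edges, which also swaps the ends of each edge.\<close>

definition swapped :: "(nat \<times> nat) list \<Rightarrow> (nat \<times> nat) list" where
  "swapped es = map prod.swap (rev es)"

definition high :: "nat list \<Rightarrow> (nat \<times> nat) list \<Rightarrow> nat \<Rightarrow> bool" where
  "high vs es v \<longleftrightarrow> length vs + 3 < 3 * length (filter (incident v) es)"

text \<open>The empty tokens on \<open>F\<close> and \<open>T\<close> are the former ends of the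
  vertex list and of the edge list.\<close>

definition classified :: "nat list \<Rightarrow> (nat \<times> nat) list \<Rightarrow> state" where
  "classified vs es = (\<lambda>_. [])(rV := rev (map bin vs), rE := flat (map bin2 (swapped es)),
     rQ := [[], [], []] @ map bin vs, rF := [[]], rT := [[]],
     rL := rev (map bin (filter (\<lambda>v. \<not> high vs (swapped es) v) vs)),
     rP := rev (map bin (filter (high vs (swapped es)) vs)))"

lemma solve_classified:
  "(parse ;; duplicate ;; loop rC rX classify_body) (input_state vs es) = classified vs es"
proof -
  let ?es = "map bin2 (swapped es)"
  let ?s1 = "(\<lambda>_. [])(rV := rev (map bin vs), rE := flat ?es, rF := [[]], rT := [[]]) :: state"
  let ?s2 = "?s1(rC := map bin vs, rQ := [[], [], []] @ map bin vs)"
  have e: "rev (flat (map bin2 es)) = flat ?es"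
    unfolding rev_flat swapped_def bin2_swap ..
  have "\<forall>x \<in> set (map bin vs). x \<noteq> []" by (simp add: bin_neq_Nil)
  then have "[] \<notin> set (map bin vs)" by blast
  then have "loop rI rZ parse_body (input_state vs es) = (input_state vs es)(rI := [],
      rV := rev (map bin vs) @ input_state vs es rV, rF := [[]],
      rE := rev (flat (map bin2 es) @ [[]]) @ input_state vs es rE)"
    by (intro parse_loop) (auto simp: input_state_def)
  then have 1: "parse (input_state vs es) = ?s1"
    unfolding parse_def andthen_def using e by (auto simp: input_state_def move_Cons fun_eq_iff)
  have "loop rV rA (copy rA rC ;; copy rA rQ) ?s1 = ?s1(rV := [], rA := rev (rev (map bin vs)) @ ?s1 rA,
      rC := rev (rev (map bin vs)) @ ?s1 rC, rQ := rev (rev (map bin vs)) @ ?s1 rQ)"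
    by (rule copy_loop) simp
  then have 2: "duplicate ?s1 = ?s2"
    unfolding duplicate_def andthen_def by (auto simp: loop_skip_eq new_def fun_eq_iff)
  have "loop rC rX classify_body ?s2 = ?s2(rC := [],
      rL := rev (filter (\<lambda>v. \<not> length (?s2 rQ) < 3 * length (filter (incident v) ?es)) (map bin vs)) @ ?s2 rL,
      rP := rev (filter (\<lambda>v. length (?s2 rQ) < 3 * length (filter (incident v) ?es)) (map bin vs)) @ ?s2 rP)"
    by (rule classify_loop) (auto simp: ready_def)
  moreover have "length (?s2 rQ) < 3 * length (filter (incident (bin v)) ?es) \<longleftrightarrow>
      high vs (swapped es) v" for v
  proof -
    have "length (?s2 rQ) = length vs + 3" by simp
    then show ?thesis unfolding incident_bin high_def by (simp only:)
  qed
  ultimately have "loop rC rX classify_body ?s2 = classified vs es"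
    by (auto simp: classified_def filter_map o_def fun_eq_iff)
  then show ?thesis by (simp only: andthen_def 1 2)
qed

lemma solve_eq:
  "solve (input_state vs es) = (if \<exists>v \<in> set vs. \<not> high vs (swapped es) v then
      write_nil (move rL rX (classified vs es)) else if vs = [] then
      write_nil (move rL rX (classified vs es)) else
      write_cycle (collect_gaps (loop rQ rQ' sweeps_prog (start_cycle (classified vs es)))))"
proof -
  have "solve (input_state vs es) = branch (\<lambda>s. \<not> s rL = [] \<or> s rP = []) (move rL rX ;; write_nil)
       (start_cycle ;; loop rQ rQ' sweeps_prog ;; collect_gaps ;; write_cycle) (classified vs es)"
    unfolding solve_classified[symmetric] by (simp only: solve_def andthen_def)
  moreover have "\<not> classified vs es rL = [] \<longleftrightarrow> (\<exists>v \<in> set vs. \<not> high vs (swapped es) v)"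
    by (auto simp: classified_def filter_empty_conv)
  moreover have "classified vs es rP = [] \<longleftrightarrow> (\<forall>v \<in> set vs. \<not> high vs (swapped es) v)"
    by (auto simp: classified_def filter_empty_conv)
  ultimately show ?thesis
    unfolding branch_def andthen_def by (cases vs) auto
qed

lemma solve_nil:
  assumes "vs = [] \<or> (\<exists>v \<in> set vs. \<not> high vs (swapped es) v)" "simple_edges (set vs) es"
  shows "solve (input_state vs es) rI = [] \<and> (\<exists>v. (v \<in> set vs \<and> \<not> high vs (swapped es) v \<or> vs = []) \<and>
    solve (input_state vs es) rO =
      map bin vs @ [] # flat (map bin2 (thin v False (swapped es))) @ [[], [Zero]])"
proof -
  let ?s = "move rL rX (classified vs es)"
  have s: "solve (input_state vs es) = write_nil ?s" using assms(1) by (auto simp: solve_eq)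
  \<comment> \<open>Without vertices there are no edges, and then \<open>v\<close> may be
    anything.\<close>
  have "\<exists>v. (v \<in> set vs \<and> \<not> high vs (swapped es) v \<or> vs = []) \<and> (?s rX = [bin v] \<or> es = [])"
  proof (cases "vs = []")
    case True
    then show ?thesis using assms(2) by (cases es) (auto simp: simple_edges_def)
  next
    case False
    let ?l = "rev (filter (\<lambda>v. \<not> high vs (swapped es) v) vs)"
    have "?l \<noteq> []" using False assms(1) by (auto simp: filter_empty_conv)
    then obtain v l where l: "?l = v # l" by (cases ?l) auto
    then have "v \<in> set ?l" by simp
    moreover have "classified vs es rL = bin v # map bin l"
      using l by (simp add: classified_def rev_map)
    then have "?s rX = [bin v]" by (simp add: move_Cons) (simp add: classified_def)
    ultimately show ?thesis by auto
  qed
  then obtain v where v: "v \<in> set vs \<and> \<not> high vs (swapped es) v \<or> vs = []"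
    "?s rX = [bin v] \<or> es = []" by blast
  have o: "?s i = classified vs es i" if "i \<noteq> rL" "i \<noteq> rX" for i
    using that by (simp add: move_def split: list.splits)
  have "ready (map bin2 (swapped es)) ?s" by (simp add: ready_def o) (simp add: classified_def)
  moreover have "?s rX = [bin v] \<or> map bin2 (swapped es) = []"
    using v(2) by (auto simp: swapped_def)
  moreover have "?s rO = []" "?s rI = []" "rev (?s rV) = map bin vs"
    by (simp_all add: o) (simp_all add: classified_def)
  ultimately show ?thesis
    unfolding s using write_nil_eq[of "map bin2 (swapped es)" ?s "bin v"] v(1) thin_bin by auto
qed

lemma simple_edges_irrefl: "simple_edges V es \<Longrightarrow> \<not> adj es v v"
  by (auto simp: adj_def simple_edges_def)

lemma solve_cycle:
  assumes "vs \<noteq> []" "\<forall>v \<in> set vs. high vs (swapped es) v" "distinct vs" "simple_edges (set vs) es"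
  shows "solve (input_state vs es) rI = [] \<and> (\<exists>c. mset c = mset vs \<and> 3 \<le> length c \<and>
    3 * length (gap_pairs es c) \<le> length c \<and>
    solve (input_state vs es) rO = map bin vs @ [] # flat (map bin2 (es @ gap_pairs es c)) @
      [] # (One # hd (map bin c)) # tl (map bin c) @ [[], []])"
proof -
  let ?n = "length vs"
  let ?es = "map bin2 (swapped es)"
  let ?c0 = "map bin vs"
  have si: "simple_edges (set ?c0) ?es"
    using simple_edges_bin[OF simple_edges_swap[OF assms(4)]] by (simp add: swapped_def)
  have irr: "\<not> adj ?es v v" for v by (rule simple_edges_irrefl[OF si])
  have deg: "length ?c0 + 3 < 3 * degree_in ?es ?c0 x" if x: "x \<in> set ?c0" for x
  proof -
    obtain v where v: "x = bin v" "v \<in> set vs" using x by auto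
    then have "length vs + 3 < 3 * length (filter (incident x) ?es)"
      using assms(2) unfolding v(1) incident_bin high_def by blast
    then show ?thesis using incident_le_degree[OF si, of x] by simp
  qed
  \<comment> \<open>A degree is at most \<open>n - 1\<close>, so \<open>n + 3 < 3 * (n - 1)\<close>.
    Hence graphs too small for a cycle never reach this branch.\<close>
  have n: "4 \<le> ?n"
  proof -
    obtain v where v: "v \<in> set ?c0" using assms(1) by (cases vs) auto
    have "degree_in ?es ?c0 v < length ?c0"
      unfolding degree_in_def using v irr by (intro length_filter_less) auto
    then show ?thesis using deg[OF v] by simp
  qed
  \<comment> \<open>The exponents are the lengths of the stacks that count: \<open>V\<close> holds
    \<open>n\<close> tokens and \<open>Q\<close> holds \<open>n + 3\<close>.\<close>
  define c1 where "c1 = ((sweep ?es ^^ ?n) ^^ (?n + 3)) ?c0"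
  have c1: "3 * gaps ?es c1 \<le> ?n" "mset c1 = mset ?c0"
    using few_gaps[of ?c0 ?n "?n + 3" ?es] n irr deg by (simp_all add: c1_def)
  \<comment> \<open>The sweeps permute words; a permutation of codes of vertices is again the code
    of a list of vertices.\<close>
  obtain c where c: "c1 = map bin c" "mset c = mset vs"
  proof
    have "set c1 = set ?c0" using c1(2) by (rule mset_eq_setD)
    then have "map bin (map (inv bin) c1) = map id c1"
      unfolding map_map by (intro map_cong) (auto simp: inv_f_f[OF inj_bin])
    then show "c1 = map bin (map (inv bin) c1)" by simp
    have "mset (map (inv bin) c1) = image_mset (inv bin) (mset ?c0)" by (simp add: c1(2))
    also have "\<dots> = mset vs" by (simp add: inv_f_f[OF inj_bin] o_def flip: mset_map)
    finally show "mset (map (inv bin) c1) = mset vs" .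
  qed
  have lc: "length c = ?n" using c(2) mset_eq_length by blast
  have gp: "gap_pairs ?es c1 = map bin2 (gap_pairs es c)"
    unfolding c(1) gap_pairs_bin swapped_def gap_pairs_swap ..
  have g: "3 * length (gap_pairs es c) \<le> length c"
    using c1(1) length_gap_pairs[of ?es c1] lc unfolding gp by simp
  let ?s = "classified vs es"
  let ?s1 = "?s(rP := [])"
  let ?s2 = "?s1(rQ := [], rQ' := rev (?s rQ))"
  have hf: "filter (high vs (swapped es)) vs = vs" "filter (\<lambda>v. \<not> high vs (swapped es) v) vs = []"
    using assms(2) by (auto simp: filter_id_conv filter_empty_conv)
  have r1: "ready ?es ?s1" "?s1 rP = []" "?s1 rZ = []" "?s1 rV' = []" "length (?s1 rV) = ?n"
    "length (?s1 rQ) = ?n + 3" by (simp_all add: classified_def ready_def)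
  have rl: "loop rQ rQ' sweeps_prog (put ?c0 ?s1) =
      put (((sweep ?es ^^ length (?s1 rV)) ^^ length (?s1 rQ)) ?c0)
        (?s1(rQ := [], rQ' := rev (?s1 rQ) @ ?s1 rQ'))"
    by (rule sweeps_loop[OF r1(1-4)]) (use n in simp)
  have "start_cycle ?s = put ?c0 ?s1"
    by (rule start_cycle_eq) (use n hf in \<open>auto simp: classified_def\<close>)
  moreover have "loop rQ rQ' sweeps_prog (put ?c0 ?s1) = put c1 (?s1(rQ := [], rQ' := rev (?s1 rQ) @ ?s1 rQ'))"
    using rl unfolding r1(5,6) c1_def[symmetric] .
  moreover have "?s1(rQ := [], rQ' := rev (?s1 rQ) @ ?s1 rQ') = ?s2"
    by (auto simp: classified_def fun_eq_iff)
  moreover obtain t where "collect_gaps (put c1 ?s2) = ?s2(rX := [], rR := [], rY := [], rP := rev c1,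
    rN := flat (map prod.swap (rev (gap_pairs ?es c1))) @ ?s2 rN, rT := t)"
    using collect_gaps_eq[of ?es ?s2 c1] r1 n lc c(1) by (auto simp: ready_def)
  moreover define s3 where "s3 = ?s2(rX := [], rR := [], rY := [], rP := rev c1,
    rN := flat (map prod.swap (rev (gap_pairs ?es c1))) @ ?s2 rN, rT := t)"
  ultimately have sol: "solve (input_state vs es) = write_cycle s3"
    using assms(1,2) unfolding solve_eq by simp
  have s3: "s3 rP = rev c1" "c1 \<noteq> []" "s3 rO = []"
    "s3 rN = flat (map prod.swap (rev (gap_pairs ?es c1)))" "s3 rE = flat ?es"
    "s3 rI = []" "s3 rV = rev ?c0"
    using n lc c(1) by (auto simp: s3_def classified_def)
  have sw: "map prod.swap (rev ?es) = map bin2 es"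
    unfolding swapped_def bin2_swap by (simp add: rev_map)
  have "solve (input_state vs es) rI = []"
    unfolding sol write_cycle_eq(2)[OF s3(1-5)] by (rule s3(6))
  moreover have "solve (input_state vs es) rO = map bin vs @ [] # flat (map bin2 (es @ gap_pairs es c)) @
      [] # (One # hd (map bin c)) # tl (map bin c) @ [[], []]"
    unfolding sol write_cycle_eq(1)[OF s3(1-5)] s3(7) sw gp unfolding c(1) by simp
  ultimately show ?thesis using c(2) g n lc by (intro conjI exI[of _ c]) auto
qed

theorem theorem2:
  shows "Rel Hamiltonian_Cycle dist_E (\<lambda>n. ennreal (real n / 3))
           \<in> FP graph_enc (pair_enc graph_enc cycle_enc)"
proof -
  let ?R = "Rel Hamiltonian_Cycle dist_E (\<lambda>n. ennreal (real n / 3))"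
  obtain q where q: "ptime nregs q solve" using polytime_solve by (auto simp: polytime_def)
  obtain M p where M: "wf_tm M" "\<And>toks v. \<forall>x \<in> set toks. Sep \<notin> set x \<Longrightarrow>
      solve ((\<lambda>_. [])(0 := toks)) 0 = [] \<Longrightarrow> word (solve ((\<lambda>_. [])(0 := toks)) rO) = v @ [Sep] \<Longrightarrow>
      \<exists>t \<le> poly p (length (word toks)). tm_computes M (word toks) t v"
    using ptime_machine[OF q, of rO, simplified] by blast
  have "\<exists>a v t. t \<le> poly p (length w) \<and> tm_computes M w t v \<and> a \<in> answers ?R G \<and>
      pair_enc graph_enc cycle_enc a v"
    if G: "simple_graph G" and w: "graph_enc G w" for G w
  proof -
    obtain vs es where vs: "distinct vs" "set vs = verts G"
      and es: "distinct (map edge_set es)" "edge_set ` set es = edges G"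
      and w: "w = vertices_word vs @ edges_word es"
      using w unfolding graph_enc_def by blast
    have si: "simple_edges (set vs) es"
      unfolding simple_edges_def
    proof (intro conjI es(1), clarify)
      fix u v assume "(u, v) \<in> set es"
      then have "{u, v} \<in> edges G" using es(2) by force
      then show "u \<noteq> v \<and> u \<in> set vs \<and> v \<in> set vs"
        using G vs(2) by (fastforce simp: simple_graph_def doubleton_eq_iff)
    qed
    let ?toks = "map bin vs @ [] # flat (map bin2 es) @ [[]]"
    have wt: "w = word ?toks" by (simp add: w vertices_word_eq edges_word_eq)
    have "Sep \<notin> set x" if "x \<in> set (flat (map bin2 es))" for x
      using that Sep_notin_bin by (auto simp: flat_def)
    then have sep: "\<forall>x \<in> set ?toks. Sep \<notin> set x" using Sep_notin_bin by auto
    note run = M(2)[OF sep, folded wt input_state_def]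
    show ?thesis
    proof (cases "vs = [] \<or> (\<exists>v \<in> set vs. \<not> high vs (swapped es) v)")
      case True
      then obtain v where sol: "solve (input_state vs es) rI = []"
        and v: "v \<in> set vs \<and> \<not> high vs (swapped es) v \<or> vs = []"
        and out: "solve (input_state vs es) rO =
          map bin vs @ [] # flat (map bin2 (thin v False (swapped es))) @ [[], [Zero]]"
        using solve_nil[OF True si] by blast
      let ?J = "\<lparr>verts = set vs, edges = edge_set ` set (thin v False (swapped es))\<rparr>"
      let ?o = "(vertices_word vs @ edges_word (thin v False (swapped es))) @ [Zero]"
      \<comment> \<open>The nil answer lists the edges as parsed, reversed and with exchanged ends,
        which enumerates the same edge set.\<close>
      have "simple_edges (set vs) (swapped es)" "edges G = edge_set ` set (swapped es)"
        using simple_edges_swap[OF si] es(2) edge_set_image_swap[of es] by (auto simp: swapped_def)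
      note sw = this
      have "v \<in> set vs \<and> 3 * length (filter (incident v) (swapped es)) \<le> length vs + 3 \<or> vs = []"
        using v by (auto simp: high_def)
      then have "(?J, None) \<in> answers ?R G"
        by (rule nil_answer[OF vs(1) sw(1) vs(2)[symmetric] sw(2)])
      moreover have "graph_enc ?J (vertices_word vs @ edges_word (thin v False (swapped es)))"
        by (rule graph_encI[OF vs(1) simple_edges_thin[OF sw(1)]])
      moreover have "word (solve (input_state vs es) rO) = ?o @ [Sep]"
        by (simp add: out vertices_word_eq edges_word_eq)
      moreover have "cycle_enc None [Zero]" by simp
      ultimately show ?thesis
        using run[OF sol] unfolding pair_enc_def by blast
    next
      case False
      then obtain c where sol: "solve (input_state vs es) rI = []"
        and c: "mset c = mset vs" "3 \<le> length c" "3 * length (gap_pairs es c) \<le> length c"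
        and out: "solve (input_state vs es) rO = map bin vs @ [] # flat (map bin2 (es @ gap_pairs es c)) @
          [] # (One # hd (map bin c)) # tl (map bin c) @ [[], []]"
        using solve_cycle[of vs es] vs(1) si by blast
      have sc: "set c = set vs" "distinct c"
        using c(1) vs(1) mset_eq_setD mset_eq_imp_distinct_iff by blast+
      let ?es = "es @ gap_pairs es c"
      let ?J = "\<lparr>verts = set c, edges = edge_set ` set ?es\<rparr>"
      have "(?J, Some c) \<in> answers ?R G"
        by (rule cycle_answer) (use sc c vs es si in auto)
      moreover have "graph_enc ?J (vertices_word vs @ edges_word ?es)"
        unfolding sc(1) by (rule graph_encI[OF vs(1)])
          (use simple_edges_add_gaps[of c es] si sc c(2) in simp)
      \<comment> \<open>As \<open>c\<close> is nonempty, \<open>One\<close> merges with its first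
        vertex; the surplus empty token supplies the final \<open>[Sep]\<close>.\<close>
      moreover have "word (solve (input_state vs es) rO) =
          ((vertices_word vs @ edges_word ?es) @ One # vertices_word c) @ [Sep]"
        using c(2) by (cases c) (auto simp: out vertices_word_eq edges_word_eq)
      moreover have "cycle_enc (Some c) (One # vertices_word c)" by simp
      ultimately show ?thesis
        using run[OF sol] unfolding pair_enc_def by blast
    qed
  qed
  moreover have "inputs ?R = {G. simple_graph G}" by (simp add: Rel_def Hamiltonian_Cycle_def)
  ultimately have "\<forall>G \<in> inputs ?R. \<forall>w. graph_enc G w \<longrightarrow> (\<exists>a v t. t \<le> poly p (length w) \<and>
      tm_computes M w t v \<and> a \<in> answers ?R G \<and> pair_enc graph_enc cycle_enc a v)"
    by (metis mem_Collect_eq)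
  then show ?thesis using M(1) unfolding FP_def by blast
qed

end
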